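(* (i) For every $C_0\ge1$ there exist constants $c,c',C,C'\in(0,\infty)$, depending only on $C_0$, such that for every height function $h$, every integer $N\ge1$ and every $x=(y,z)\in\mathbb S_N$ with $\|x\|\le C_0N$, $$\frac{c}{\|x\|\vee1}+\frac{c'}{h_N}K_0\Big(\frac{|y|\vee h_N}{N}\Big)\le g_N(x)\le\frac{C}{\|x\|\vee1}+\frac{C'}{h_N}K_0\Big(\frac{|y|\vee h_N}{N}\Big).$$ (ii) Let $h$ be a height function with $\lim_{N}\frac{h_N}{N}=0$, and let $x=x_N=(y,z)\in\mathbb S_N$ be such that $\lim_N\|x\|\in[0,\infty]$ exists and $\limsup_N\frac{\|x\|}{N}<\infty$. Then as $N\to\infty$, $$g_N(x)\sim\frac3\pi\frac1{h_N}K_0\Big(\sqrt6\,\frac{|y|\vee h_N}{N}\Big)+g_{\mathbb Z^3}(x)\exp\Big(-\sqrt6\,\frac{\|x\|}{N}\Big).$$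
   Context: $a_N\sim b_N$ means $a_N/b_N\to1$. $a\vee b=\max\{a,b\}$. Height function: a non-decreasing $h:(0,\infty)\to\mathbb R$ with $1\le h(t)\le t$ for all $t\ge1$. For an integer $N\ge1$ set $h_N=\lfloor h(N)\rfloor$ and $\mathbb S_N=\mathbb Z^2\times(\mathbb Z/h_N\mathbb Z)$, with points $x=(y,z)$, $y\in\mathbb Z^2$, $z\in\mathbb Z/h_N\mathbb Z$. $|\cdot|$ is the Euclidean norm. For $z\in\mathbb Z/h_N\mathbb Z$, $\hat z\in\mathbb Z$ is a representative with $|\hat z|=d_{\mathbb Z/h_N\mathbb Z}(0,z)\le h_N/2$ (graph distance on the cycle), and $\|x\|=|(y,\hat z)|$. Weights: $\lambda_{x,x'}$ is $\frac16$ times the number of the six unit steps $e\in\{\pm e_1,\pm e_2,\pm e_3\}$ (third coordinate mod $h_N$) with $x'=x+e$; the killing measure is $\kappa_x=N^{-2}$; $\lambda_x=\sum_{x'}\lambda_{x,x'}+\kappa_x=1+N^{-2}$. $X=(X_t)_{t\ge0}$ is the continuous-time Markov chain on $\mathbb S_N\cup\{\Delta\}$ ($\Delta$ an absorbing cemetery) jumping from $x$ to $x'$ at rate $\lambda_{x,x'}$ and from $x$ to $\Delta$ at rate $\kappa_x$, with law $P_x$ when started at $x$. Its Green's function is $g_N(x,x')=\frac1{\lambda_{x'}}E_x[\int_0^\infty 1_{\{X_t=x'\}}dt]$, and $g_N(x)=g_N(0,x)$. $K_0(t)=\int_0^\infty e^{-t\cosh r}\,dr$, $t>0$. $g_{\mathbb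 Z^3}(w)=\int_0^\infty\overline P_0(\overline X_t=w)\,dt$, $w\in\mathbb Z^3$, is the Green's function of the continuous-time simple random walk $\overline X$ on $\mathbb Z^3$ with unit jump rate; for $x=(y,z)\in\mathbb S_N$, $g_{\mathbb Z^3}(x):=g_{\mathbb Z^3}((y,\hat z))$. *)

theory Defs
  imports "HOL-Probability.Probability"
begin

section \<open>Continuous-time Markov chains with killing\<close>

text \<open>
  A chain on a countable type is given by weights \<open>w x x'\<close> (rate of the jump from \<open>x\<close> to
  \<open>x'\<close>; \<open>w x x > 0\<close> is allowed and such a jump is invisible) and a killing measure \<open>k\<close>
  (rate of the jump to the cemetery, which is \<open>None\<close>).  It is built from
  its jump chain and holding times: at a state \<open>s\<close> of total weight \<open>total_weight w k s\<close> the
  chain waits an exponential time with this parameter and then, independently, jumps according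
  to \<open>jump_pmf w k s\<close>.
\<close>

definition total_weight :: "('s \<Rightarrow> 's \<Rightarrow> real) \<Rightarrow> ('s \<Rightarrow> real) \<Rightarrow> 's \<Rightarrow> real" where
  "total_weight w k x = (\<Sum>\<^sub>\<infinity>x'. w x x') + k x"

definition jump_pmf :: "('s \<Rightarrow> 's \<Rightarrow> real) \<Rightarrow> ('s \<Rightarrow> real) \<Rightarrow> 's \<Rightarrow> 's option pmf" where
  "jump_pmf w k x = embed_pmf (\<lambda>u. case u of
      None \<Rightarrow> k x / total_weight w k x
    | Some x' \<Rightarrow> w x x' / total_weight w k x)"

text \<open>
  The coordinates \<open>(n, s)\<close> are independent; coordinate \<open>(n, s)\<close> carries the pair
  (next state, holding time) that is used if the jump chain is at \<open>s\<close> after \<open>n\<close> jumps.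
  The same space therefore serves every starting point.
\<close>

definition ctmc_space ::
    "('s \<Rightarrow> 's \<Rightarrow> real) \<Rightarrow> ('s \<Rightarrow> real) \<Rightarrow> (nat \<times> 's \<Rightarrow> 's option \<times> real) measure" where
  "ctmc_space w k = (\<Pi>\<^sub>M (n, s)\<in>UNIV.
      measure_pmf (jump_pmf w k s)
        \<Otimes>\<^sub>M density lborel (\<lambda>t. ennreal (exponential_density (total_weight w k s) t)))"

primrec jump_chain :: "'s \<Rightarrow> (nat \<times> 's \<Rightarrow> 's option \<times> real) \<Rightarrow> nat \<Rightarrow> 's option" where
  "jump_chain x \<omega> 0 = Some x"
| "jump_chain x \<omega> (Suc n) =
     (case jump_chain x \<omega> n of None \<Rightarrow> None | Some s \<Rightarrow> fst (\<omega> (n, s)))"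

primrec jump_time :: "'s \<Rightarrow> (nat \<times> 's \<Rightarrow> 's option \<times> real) \<Rightarrow> nat \<Rightarrow> ereal" where
  "jump_time x \<omega> 0 = 0"
| "jump_time x \<omega> (Suc n) = jump_time x \<omega> n +
     (case jump_chain x \<omega> n of None \<Rightarrow> \<infinity> | Some s \<Rightarrow> ereal (snd (\<omega> (n, s))))"

text \<open>
  State at time \<open>t \<ge> 0\<close> of the chain started at \<open>x\<close>: the \<open>n\<close>-th state of the jump chain if
  the \<open>n\<close>-th jump time is at most \<open>t\<close> and the next one exceeds \<open>t\<close>.  The last
  alternative (explosion) is a null event for bounded total weights.
\<close>

definition ctmc :: "'s \<Rightarrow> real \<Rightarrow> (nat \<times> 's \<Rightarrow> 's option \<times> real) \<Rightarrow> 's option" where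
  "ctmc x t \<omega> = (if \<exists>n. ereal t < jump_time x \<omega> (Suc n)
     then jump_chain x \<omega> (LEAST n. ereal t < jump_time x \<omega> (Suc n))
     else None)"

definition green :: "('s \<Rightarrow> 's \<Rightarrow> real) \<Rightarrow> ('s \<Rightarrow> real) \<Rightarrow> 's \<Rightarrow> 's \<Rightarrow> real" where
  "green w k x x' = 1 / total_weight w k x' *
     enn2real (\<integral>\<^sup>+\<omega>. (\<integral>\<^sup>+t\<in>{0..}. indicator {t. ctmc x t \<omega> = Some x'} t \<partial>lborel) \<partial>ctmc_space w k)"


section \<open>Slabs\<close>

type_synonym point = "(int \<times> int) \<times> int"

definition height_function :: "(real \<Rightarrow> real) \<Rightarrow> bool" where
  "height_function h \<longleftrightarrow> mono_on {0<..} h \<and> (\<forall>t\<ge>1. 1 \<le> h t \<and> h t \<le> t)"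

definition height :: "(real \<Rightarrow> real) \<Rightarrow> nat \<Rightarrow> int" where
  "height h N = \<lfloor>h (real N)\<rfloor>"

text \<open>
  In the following \<open>m\<close> is the height, and \<open>\<int>/m\<int>\<close> is represented by \<open>{0..<m}\<close>.
\<close>

definition slab :: "int \<Rightarrow> point set" where
  "slab m = UNIV \<times> {0..<m}"

definition unit_steps :: "point set" where
  "unit_steps = {((1,0),0), ((-1,0),0), ((0,1),0), ((0,-1),0), ((0,0),1), ((0,0),-1)}"

definition slab_add :: "int \<Rightarrow> point \<Rightarrow> point \<Rightarrow> point" where
  "slab_add m x e = (fst x + fst e, (snd x + snd e) mod m)"

definition slab_weight :: "int \<Rightarrow> point \<Rightarrow> point \<Rightarrow> real" where
  "slab_weight m x x' = 1 / 6 * real (card {e \<in> unit_steps. x' = slab_add m x e})"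

definition slab_green :: "(real \<Rightarrow> real) \<Rightarrow> nat \<Rightarrow> point \<Rightarrow> real" where
  "slab_green h N x = green (slab_weight (height h N)) (\<lambda>_. 1 / (real N)\<^sup>2) ((0,0),0) x"

text \<open>
  The representative of smallest absolute value of \<open>z \<in> {0..<m}\<close> modulo \<open>m\<close>; of the two
  candidates \<open>\<plusminus>m/2\<close> the positive one is taken.
\<close>

definition cyc_rep :: "int \<Rightarrow> int \<Rightarrow> int" where
  "cyc_rep m z = (if 2 * z \<le> m then z else z - m)"

definition lift :: "int \<Rightarrow> point \<Rightarrow> point" where
  "lift m x = (fst x, cyc_rep m (snd x))"

definition norm2 :: "int \<times> int \<Rightarrow> real" where
  "norm2 y = norm (real_of_int (fst y), real_of_int (snd y))"

definition norm3 :: "point \<Rightarrow> real" where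
  "norm3 w = norm ((real_of_int (fst (fst w)), real_of_int (snd (fst w))), real_of_int (snd w))"

definition slab_norm :: "int \<Rightarrow> point \<Rightarrow> real" where
  "slab_norm m x = norm3 (lift m x)"


section \<open>Simple random walk on the three-dimensional lattice\<close>

definition Z3_weight :: "point \<Rightarrow> point \<Rightarrow> real" where
  "Z3_weight x x' = 1 / 6 * real (card {e \<in> unit_steps. x' = x + e})"

definition Z3_green :: "point \<Rightarrow> real" where
  "Z3_green w = enn2real (\<integral>\<^sup>+t\<in>{0..}.
     emeasure (ctmc_space Z3_weight (\<lambda>_. 0))
       {\<omega> \<in> space (ctmc_space Z3_weight (\<lambda>_. 0)). ctmc ((0,0),0) t \<omega> = Some w} \<partial>lborel)"


section \<open>The Bessel function\<close>

definition K0 :: "real \<Rightarrow> real" where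
  "K0 t = (LBINT r:{0..}. exp (- t * cosh r))"


section \<open>Sanity checks\<close>

lemma cyc_rep_minimal:
  assumes "0 \<le> z" "z < m"
  shows "cyc_rep m z mod m = z" "2 * \<bar>cyc_rep m z\<bar> \<le> m"
    and "v mod m = z \<Longrightarrow> \<bar>cyc_rep m z\<bar> \<le> \<bar>v\<bar>"
proof -
  show "cyc_rep m z mod m = z"
    using assms by (auto simp: cyc_rep_def)
  show "2 * \<bar>cyc_rep m z\<bar> \<le> m"
    using assms by (auto simp: cyc_rep_def)
  assume v: "v mod m = z"
  define q where "q = v div m"
  have eq: "v = q * m + z"
    using v by (metis q_def div_mult_mod_eq)
  consider "q \<ge> 0" | "q \<le> -1" by linarith
  then show "\<bar>cyc_rep m z\<bar> \<le> \<bar>v\<bar>"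
  proof cases
    case 1
    then have "q * m \<ge> 0" using assms by simp
    then show ?thesis using assms eq by (auto simp: cyc_rep_def)
  next
    case 2
    then have "q * m \<le> -1 * m" using assms by (intro mult_right_mono) auto
    then show ?thesis using assms eq by (auto simp: cyc_rep_def)
  qed
qed

lemma card_unit_steps: "card unit_steps = 6"
  by (simp add: unit_steps_def)

lemma finite_unit_steps [simp]: "finite unit_steps"
  by (simp add: unit_steps_def)

lemma step_weight_sum:
  fixes f :: "point \<Rightarrow> point"
  shows "(\<Sum>x'\<in>f ` unit_steps. 1 / 6 * real (card {e \<in> unit_steps. x' = f e})) = 1"
proof -
  have sym: "{e \<in> unit_steps. x' = f e} = {e \<in> unit_steps. f e = x'}" for x'
    by blast
  have "(\<Sum>x'\<in>f ` unit_steps. card {e \<in> unit_steps. x' = f e})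
      = (\<Sum>x'\<in>f ` unit_steps. \<Sum>e\<in>{e \<in> unit_steps. f e = x'}. 1)"
    unfolding sym by (simp only: card_eq_sum)
  also have "\<dots> = (\<Sum>e\<in>unit_steps. 1)"
    by (rule sum.group) simp_all
  finally have "(\<Sum>x'\<in>f ` unit_steps. card {e \<in> unit_steps. x' = f e}) = 6"
    by (simp add: card_unit_steps)
  then have "real (\<Sum>x'\<in>f ` unit_steps. card {e \<in> unit_steps. x' = f e}) = 6"
    by (simp only: of_nat_numeral)
  then have "1 / 6 * (\<Sum>x'\<in>f ` unit_steps. real (card {e \<in> unit_steps. x' = f e})) = 1"
    by (simp only: of_nat_sum)
  then show ?thesis
    by (simp only: sum_distrib_left)
qed

lemma total_weight_finite:
  assumes "finite A" "\<And>x'. x' \<notin> A \<Longrightarrow> w x x' = 0"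
  shows "total_weight w k x = sum (w x) A + k x"
proof -
  have "(\<Sum>\<^sub>\<infinity>x'. w x x') = (\<Sum>\<^sub>\<infinity>x'\<in>A. w x x')"
    by (rule infsum_cong_neutral) (use assms in auto)
  then show ?thesis
    using assms by (simp add: total_weight_def)
qed

lemma pmf_jump_pmf:
  assumes A: "finite A" "\<And>x'. x' \<notin> A \<Longrightarrow> w x x' = 0"
    and nonneg: "\<And>x'. 0 \<le> w x x'" "0 \<le> k x" and pos: "0 < total_weight w k x"
  shows "pmf (jump_pmf w k x) None = k x / total_weight w k x"
    and "pmf (jump_pmf w k x) (Some x') = w x x' / total_weight w k x"
proof -
  let ?f = "\<lambda>u. case u of None \<Rightarrow> k x / total_weight w k x
    | Some x' \<Rightarrow> w x x' / total_weight w k x"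
  have f0: "0 \<le> ?f u" for u
    using nonneg pos by (auto split: option.splits)
  have "(\<integral>\<^sup>+u. ennreal (?f u) \<partial>count_space UNIV)
      = (\<Sum>u\<in>insert None (Some ` A). ennreal (?f u))"
    by (rule nn_integral_count_space') (use A in \<open>force split: option.splits\<close>)+
  also have "\<dots> = ennreal (\<Sum>u\<in>insert None (Some ` A). ?f u)"
    by (rule sum_ennreal) (use f0 in auto)
  also have "(\<Sum>u\<in>insert None (Some ` A). ?f u) = 1"
    using A pos total_weight_finite[of A w x k]
    by (simp add: sum.reindex sum_divide_distrib[symmetric] add_divide_distrib[symmetric] add.commute)
  finally have f1: "(\<integral>\<^sup>+u. ennreal (?f u) \<partial>count_space UNIV) = 1" by simp
  show "pmf (jump_pmf w k x) None = k x / total_weight w k x"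
    "pmf (jump_pmf w k x) (Some x') = w x x' / total_weight w k x"
    unfolding jump_pmf_def by (simp_all add: pmf_embed_pmf[OF f0 f1])
qed

lemma slab_weight_outside: "x' \<notin> slab_add m x ` unit_steps \<Longrightarrow> slab_weight m x x' = 0"
  by (auto simp: slab_weight_def)

lemma Z3_weight_outside: "x' \<notin> (+) x ` unit_steps \<Longrightarrow> Z3_weight x x' = 0"
  by (auto simp: Z3_weight_def)

lemma total_weight_slab: "total_weight (slab_weight m) k x = 1 + k x"
proof -
  have "total_weight (slab_weight m) k x = sum ((slab_weight m) x) (slab_add m x ` unit_steps) + k x"
    by (rule total_weight_finite) (auto simp: slab_weight_outside)
  also have "sum (slab_weight m x) (slab_add m x ` unit_steps)
      = (\<Sum>x'\<in>slab_add m x ` unit_steps. 1 / 6 * real (card {e \<in> unit_steps. x' = slab_add m x e}))"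
    by (rule sum.cong) (simp_all only: slab_weight_def)
  also have "\<dots> = 1"
    by (rule step_weight_sum)
  finally show ?thesis .
qed

lemma total_weight_Z3: "total_weight Z3_weight k x = 1 + k x"
proof -
  have "total_weight Z3_weight k x = sum (Z3_weight x) ((+) x ` unit_steps) + k x"
    by (rule total_weight_finite) (auto simp: Z3_weight_outside)
  also have "sum (Z3_weight x) ((+) x ` unit_steps)
      = (\<Sum>x'\<in>(+) x ` unit_steps. 1 / 6 * real (card {e \<in> unit_steps. x' = x + e}))"
    by (rule sum.cong) (simp_all only: Z3_weight_def)
  also have "\<dots> = 1"
    by (rule step_weight_sum)
  finally show ?thesis .
qed

lemma prob_space_ctmc_space:
  assumes "\<And>x. 0 < total_weight w k x"
  shows "prob_space (ctmc_space w k)"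
  unfolding ctmc_space_def
  by (intro prob_space_PiM)
     (auto split: prod.split intro!: prob_space_pair prob_space_measure_pmf
        prob_space_exponential_density assms)

end

theory Submission
  imports Defs "HOL-Real_Asymp.Real_Asymp"
begin

text \<open>
  Run in continuous time, the three coordinates of the walk are independent: two walks on the
  integers and one on the cycle of length \<open>m\<close>, the height.  With \<open>e = 1 / N^2\<close>, with the heat
  kernel \<open>p_s\<close> of the integers (\<open>heat\<close>) and its periodization \<open>c_s\<close> (\<open>cyc_heat\<close>), and with time
  scaled by 3,

    \<open>(1 + e) * g_N (y, z) = 3 * (integral over s > 0 of exp (- 3 e s) p_s(y1) p_s(y2) c_s(z))\<close>,

  which is lemma \<open>green_slab_eq\<close>.  Instead of factorizing the law of the chain one observes that the
  right-hand side, a Laplace transform of a solution of the heat equation, is a bounded solution of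
  \<open>(1 + e) f = \<delta> + P f\<close> (\<open>resolvent_equation\<close>).  Iterating this identity expresses \<open>(1 + e) f\<close> as the sum of
  the probabilities of all visits of the jump chain (\<open>step_prob_sums\<close>), and each visit lasts for an
  exponential time (\<open>green_eq_suminf_visit_prob\<close>).

  Now split \<open>c_s(z) = p_s(v) + (c_s(z) - p_s(v))\<close>, where \<open>v\<close> is the smallest representative of \<open>z\<close>.

  The first summand yields the Green's function \<open>G\<close> of the killed walk on the cubic lattice.  It is
  comparable to \<open>1 / (\<parallel>x\<parallel> \<or> 1)\<close> as long as \<open>\<parallel>x\<parallel>\<close> is at most of order \<open>N\<close>
  (\<open>lattice_green_le\<close>, \<open>lattice_green_ge\<close>), and it differs from the Green's function without killing by
  \<open>O(1 / N)\<close> (\<open>lattice_resolvent_ge_0\<close>).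

  The second summand collects the images of \<open>v\<close> under translation by multiples of \<open>m\<close>.  It is small
  before time \<open>m^2\<close> and close to \<open>1 / m\<close> afterwards, while \<open>p_s(y1) p_s(y2)\<close> is close to a Gaussian
  density in the plane.  With \<open>M = \<bar>y\<bar> \<or> m\<close> this suggests the value

    \<open>(3 / m) * (integral over s > 0 of exp (- 3 e s - M^2 / (2 s)) / (2 pi s)) = (3 / pi) (1 / m) K0 (sqrt 6 M / N)\<close>

  and the pointwise comparison \<open>kernel_comparison\<close> bounds the total error by an absolute constant times
  \<open>1 / M\<close>.  The outcome is \<open>slab_green_decomposition\<close>: the slab Green's function is, up to the factor
  \<open>1 + e\<close>, equal to \<open>G + (3 / pi) (1 / m) K0 (sqrt 6 M / N) + O(1 / M)\<close>, uniformly in all parameters.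

  Both claims follow.  In the two-sided bound the error is absorbed by \<open>G\<close>, because
  \<open>\<parallel>x\<parallel> \<or> 1 \<le> 2 M\<close>.  In the asymptotic statement all errors, including the one made by replacing \<open>G\<close> by
  \<open>g * exp (- sqrt 6 \<parallel>x\<parallel> / N)\<close>, where \<open>g\<close> is the Green's function of the simple random walk, are of
  order \<open>1 / M + 1 / N\<close>.  They are negligible against \<open>(1 / m) K0 (sqrt 6 M / N)\<close> when \<open>m / N\<close> tends to
  0: \<open>K0\<close> is bounded below here, which settles the error \<open>1 / N\<close>, and either \<open>M\<close> is comparable to \<open>N\<close>,
  hence much larger than \<open>m\<close>, or \<open>M / N\<close> is small and \<open>K0\<close> is large.
\<close>

section \<open>Occupation times of a chain built from jumps and holding times\<close>

text \<open>
  Redrawing one coordinate preserves a product measure, so that this coordinate is independent of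
  every function that ignores it.  The chain needs no other form of independence: its position after
  \<open>n\<close> jumps ignores the coordinates \<open>(n, s)\<close>.
\<close>

lemma nn_integral_PiM_coordinate:
  fixes M :: "'i \<Rightarrow> 'a measure"
  assumes M: "\<And>i. prob_space (M i)"
    and [measurable]: "F \<in> borel_measurable (M i)" "G \<in> borel_measurable (PiM UNIV M)"
    and G: "\<And>X v. G (X(i := v)) = G X"
  shows "(\<integral>\<^sup>+\<omega>. F (\<omega> i) * G \<omega> \<partial>PiM UNIV M) = (\<integral>\<^sup>+v. F v \<partial>M i) * (\<integral>\<^sup>+\<omega>. G \<omega> \<partial>PiM UNIV M)"
proof -
  interpret P: prob_space "PiM UNIV M" by (rule prob_space_PiM) (rule M)
  have meas: "(\<lambda>(x, X). X(i := x)) \<in> M i \<Otimes>\<^sub>M PiM UNIV M \<rightarrow>\<^sub>M PiM UNIV M"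
    using measurable_fun_upd[of "UNIV" "UNIV" i "\<lambda>p. snd p" "M i \<Otimes>\<^sub>M PiM UNIV M" M "\<lambda>p. fst p"]
    by (simp add: case_prod_beta')
  have "(\<integral>\<^sup>+\<omega>. F (\<omega> i) * G \<omega> \<partial>PiM UNIV M)
      = (\<integral>\<^sup>+\<omega>. F (\<omega> i) * G \<omega> \<partial>distr (M i \<Otimes>\<^sub>M PiM UNIV M) (PiM UNIV M) (\<lambda>(x, X). X(i := x)))"
    using distr_pair_PiM_eq_PiM[of UNIV M i] M by simp
  also have "\<dots> = (\<integral>\<^sup>+p. F (fst p) * G (snd p) \<partial>(M i \<Otimes>\<^sub>M PiM UNIV M))"
    by (subst nn_integral_distr[OF meas]) (auto simp: case_prod_beta' G)
  also have "\<dots> = (\<integral>\<^sup>+v. \<integral>\<^sup>+\<omega>. F v * G \<omega> \<partial>PiM UNIV M \<partial>M i)"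
    by (subst P.nn_integral_fst[symmetric]) auto
  also have "\<dots> = (\<integral>\<^sup>+v. F v * (\<integral>\<^sup>+\<omega>. G \<omega> \<partial>PiM UNIV M) \<partial>M i)"
    by (intro nn_integral_cong nn_integral_cmult) auto
  also have "\<dots> = (\<integral>\<^sup>+v. F v \<partial>M i) * (\<integral>\<^sup>+\<omega>. G \<omega> \<partial>PiM UNIV M)"
    by (rule nn_integral_multc) auto
  finally show ?thesis .
qed

definition step_space :: "('s \<Rightarrow> 's \<Rightarrow> real) \<Rightarrow> ('s \<Rightarrow> real) \<Rightarrow> 's \<Rightarrow> ('s option \<times> real) measure" where
  "step_space w k s = measure_pmf (jump_pmf w k s)
        \<Otimes>\<^sub>M density lborel (\<lambda>t. ennreal (exponential_density (total_weight w k s) t))"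

lemma ctmc_space_eq: "ctmc_space w k = PiM UNIV (\<lambda>i. step_space w k (snd i))"
  by (simp add: ctmc_space_def step_space_def case_prod_beta')

lemma prob_space_step_space:
  "0 < total_weight w k s \<Longrightarrow> prob_space (step_space w k s)"
  unfolding step_space_def
  by (intro prob_space_pair prob_space_measure_pmf prob_space_exponential_density)

lemma sets_step_space [measurable_cong]:
  "sets (step_space w k s) = sets (count_space UNIV \<Otimes>\<^sub>M borel)"
  unfolding step_space_def by (rule sets_pair_measure_cong) simp_all

lemma measurable_ctmc_coordinate:
  "(\<lambda>\<omega>. \<omega> i) \<in> ctmc_space w k \<rightarrow>\<^sub>M count_space UNIV \<Otimes>\<^sub>M borel"
proof -
  have "(\<lambda>\<omega>. \<omega> i) \<in> ctmc_space w k \<rightarrow>\<^sub>M step_space w k (snd i)"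
    unfolding ctmc_space_eq by (rule measurable_component_singleton) simp
  then show ?thesis by (simp cong: measurable_cong_sets add: sets_step_space)
qed

lemma measurable_ctmc_coordinate_fst: "(\<lambda>\<omega>. fst (\<omega> i)) \<in> ctmc_space w k \<rightarrow>\<^sub>M count_space UNIV"
  and measurable_ctmc_coordinate_snd: "(\<lambda>\<omega>. snd (\<omega> i)) \<in> borel_measurable (ctmc_space w k)"
  by (rule measurable_compose[OF measurable_ctmc_coordinate measurable_fst]
        measurable_compose[OF measurable_ctmc_coordinate measurable_snd])+

lemma measurable_jump_chain [measurable]:
  fixes w :: "'s::countable \<Rightarrow> 's \<Rightarrow> real"
  shows "(\<lambda>\<omega>. jump_chain x \<omega> n) \<in> ctmc_space w k \<rightarrow>\<^sub>M count_space UNIV"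
proof (induction n)
  case (Suc n)
  have "(\<lambda>\<omega>. case u of None \<Rightarrow> None | Some s \<Rightarrow> fst (\<omega> (n, s))) \<in> ctmc_space w k \<rightarrow>\<^sub>M count_space UNIV"
    for u :: "'s option"
    by (cases u) (simp_all add: measurable_ctmc_coordinate_fst)
  from measurable_compose_countable[OF this Suc] show ?case by simp
qed simp

lemma measurable_jump_time [measurable]:
  fixes w :: "'s::countable \<Rightarrow> 's \<Rightarrow> real"
  shows "(\<lambda>\<omega>. jump_time x \<omega> n) \<in> borel_measurable (ctmc_space w k)"
proof (induction n)
  case (Suc n)
  have "(\<lambda>\<omega>. case u of None \<Rightarrow> \<infinity> | Some s \<Rightarrow> ereal (snd (\<omega> (n, s)))) \<in> borel_measurable (ctmc_space w k)"
    for u :: "'s option"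
    by (cases u) (simp_all add: measurable_ctmc_coordinate_snd borel_measurable_ereal)
  from measurable_compose_countable[OF this measurable_jump_chain] Suc show ?case by simp
qed simp

lemma measurable_ctmc [measurable]:
  fixes w :: "'s::countable \<Rightarrow> 's \<Rightarrow> real"
  shows "(\<lambda>(\<omega>, t). ctmc x t \<omega>) \<in> ctmc_space w k \<Otimes>\<^sub>M borel \<rightarrow>\<^sub>M count_space UNIV"
proof -
  have "(\<lambda>p. jump_chain x (fst p) (LEAST n. ereal (snd p) < jump_time x (fst p) (Suc n)))
      \<in> ctmc_space w k \<Otimes>\<^sub>M borel \<rightarrow>\<^sub>M count_space UNIV"
    by (rule measurable_compose_countable[where f = "\<lambda>n p. jump_chain x (fst p) n"])
       (simp_all del: jump_time.simps)
  then show ?thesis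
    unfolding ctmc_def case_prod_beta' by (simp del: jump_time.simps)
qed

lemma jump_chain_upd: "j \<le> n \<Longrightarrow> jump_chain x (fun_upd \<omega> (n, s) v) j = jump_chain x \<omega> j"
  by (induction j) (auto split: option.split)

abbreviation visit :: "'s \<Rightarrow> nat \<Rightarrow> 's \<Rightarrow> (nat \<times> 's \<Rightarrow> 's option \<times> real) set" where
  "visit x n s \<equiv> {\<omega>. jump_chain x \<omega> n = Some s}"

definition visit_prob :: "('s \<Rightarrow> 's \<Rightarrow> real) \<Rightarrow> ('s \<Rightarrow> real) \<Rightarrow> 's \<Rightarrow> nat \<Rightarrow> 's \<Rightarrow> ennreal" where
  "visit_prob w k x n x' = (\<integral>\<^sup>+\<omega>. indicator (visit x n x') \<omega> \<partial>ctmc_space w k)"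

lemma visit_prob_0:
  assumes "\<And>x. 0 < total_weight w k x"
  shows "visit_prob w k x 0 x' = (if x' = x then 1 else 0)"
proof -
  interpret prob_space "ctmc_space w k" by (rule prob_space_ctmc_space) fact
  show ?thesis by (simp add: visit_prob_def emeasure_space_1)
qed

lemma measurable_step_space_fst:
  "(\<lambda>v. indicator A (fst v) :: ennreal) \<in> borel_measurable (step_space w k s)"
proof -
  have "(\<lambda>v. indicator A (fst v) :: ennreal) \<in> borel_measurable (count_space UNIV \<Otimes>\<^sub>M borel)"
    by (rule measurable_compose[OF measurable_fst]) simp
  then show ?thesis by (simp cong: measurable_cong_sets add: sets_step_space)
qed

lemma nn_integral_step_space_fst:
  assumes "0 < total_weight w k s"
  shows "(\<integral>\<^sup>+v. indicator {Some x'} (fst v) \<partial>step_space w k s) = ennreal (pmf (jump_pmf w k s) (Some x'))"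
proof -
  interpret E: prob_space "density lborel (\<lambda>t. ennreal (exponential_density (total_weight w k s) t))"
    by (rule prob_space_exponential_density) fact
  note measurable_step_space_fst [measurable]
  have "(\<integral>\<^sup>+v. indicator {Some x'} (fst v) \<partial>step_space w k s)
      = (\<integral>\<^sup>+u. indicator {Some x'} u \<partial>measure_pmf (jump_pmf w k s))"
    unfolding step_space_def
    using E.emeasure_space_1
    by (subst E.nn_integral_fst[symmetric])
       (simp_all add: step_space_def[symmetric] emeasure_pmf_single[symmetric] del: emeasure_density)
  then show ?thesis by (simp add: emeasure_pmf_single)
qed

lemma nn_integral_step_space_snd:
  assumes "0 < total_weight w k s"
  shows "(\<integral>\<^sup>+v. ennreal (snd v) \<partial>step_space w k s) = ennreal (1 / total_weight w k s)"
proof -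
  let ?l = "total_weight w k s"
  let ?E = "density lborel (\<lambda>t. ennreal (exponential_density ?l t))"
  interpret E: prob_space ?E
    by (rule prob_space_exponential_density) fact
  have [measurable]: "(\<lambda>v. ennreal (snd v)) \<in> borel_measurable (step_space w k s)"
    by measurable
  have "(\<integral>\<^sup>+v. ennreal (snd v) \<partial>step_space w k s)
      = (\<integral>\<^sup>+u. (\<integral>\<^sup>+t. ennreal t \<partial>?E) \<partial>measure_pmf (jump_pmf w k s))"
    unfolding step_space_def
    by (subst E.nn_integral_fst[symmetric]) (simp_all add: step_space_def[symmetric])
  also have "\<dots> = (\<integral>\<^sup>+t. ennreal t \<partial>?E)"
    by (simp add: measure_pmf.emeasure_space_1)
  also have "\<dots> = (\<integral>\<^sup>+t. ennreal (exponential_density ?l t) * ennreal t \<partial>lborel)"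
    by (subst nn_integral_density) auto
  also have "\<dots> = (\<integral>\<^sup>+t. ennreal (exponential_density ?l t * t ^ 1) \<partial>lborel)"
    by (intro nn_integral_cong)
       (use assms in \<open>auto simp: exponential_density_def ennreal_mult''[symmetric] ennreal_neg\<close>)
  also have "\<dots> = ennreal (1 / ?l)"
    using nn_integral_erlang_ith_moment[OF assms, of 0 1] by (simp)
  finally show ?thesis .
qed

text \<open>
  The Markov property of the jump chain: its position after \<open>n\<close> jumps ignores the coordinates that
  decide the next jump.
\<close>

lemma visit_prob_Suc:
  fixes w :: "'s::countable \<Rightarrow> 's \<Rightarrow> real"
  assumes pos: "\<And>x. 0 < total_weight w k x"
  shows "visit_prob w k x (Suc n) x'
    = (\<integral>\<^sup>+s. ennreal (pmf (jump_pmf w k s) (Some x')) * visit_prob w k x n s \<partial>count_space UNIV)"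
proof -
  note measurable_ctmc_coordinate_fst [measurable]
  have "visit_prob w k x (Suc n) x' = (\<integral>\<^sup>+\<omega>. (\<integral>\<^sup>+s. indicator {Some x'} (fst (\<omega> (n, s)))
      * indicator (visit x n s) \<omega> \<partial>count_space UNIV) \<partial>ctmc_space w k)"
    unfolding visit_prob_def
  proof (rule nn_integral_cong)
    fix \<omega> :: "nat \<times> 's \<Rightarrow> 's option \<times> real"
    show "indicator {\<omega>. jump_chain x \<omega> (Suc n) = Some x'} \<omega> =
      (\<integral>\<^sup>+s. indicator {Some x'} (fst (\<omega> (n, s))) * indicator (visit x n s) \<omega> \<partial>count_space UNIV)"
    proof (cases "jump_chain x \<omega> n")
      case (Some s0)
      have "(\<integral>\<^sup>+s. indicator {Some x'} (fst (\<omega> (n, s))) * indicator (visit x n s) \<omega> \<partial>count_space UNIV)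
        = (\<integral>\<^sup>+s. indicator {Some x'} (fst (\<omega> (n, s0))) * indicator {s0} s \<partial>count_space UNIV)"
        using Some by (intro nn_integral_cong) (auto simp: indicator_def)
      also have "\<dots> = indicator {Some x'} (fst (\<omega> (n, s0)))"
        by (subst nn_integral_cmult) auto
      finally show ?thesis using Some by (simp add: indicator_def)
    qed (simp add: indicator_def)
  qed
  also have "\<dots> = (\<integral>\<^sup>+s. (\<integral>\<^sup>+\<omega>. indicator {Some x'} (fst (\<omega> (n, s)))
      * indicator (visit x n s) \<omega> \<partial>ctmc_space w k) \<partial>count_space UNIV)"
    by (rule nn_integral_count_space_nn_integral) auto
  also have "\<dots> = (\<integral>\<^sup>+s. ennreal (pmf (jump_pmf w k s) (Some x')) * visit_prob w k x n s \<partial>count_space UNIV)"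
  proof (rule nn_integral_cong)
    fix s
    show "(\<integral>\<^sup>+\<omega>. indicator {Some x'} (fst (\<omega> (n, s)))
      * indicator (visit x n s) \<omega> \<partial>ctmc_space w k)
      = ennreal (pmf (jump_pmf w k s) (Some x')) * visit_prob w k x n s"
      unfolding visit_prob_def ctmc_space_eq
    proof (subst nn_integral_PiM_coordinate[where F = "\<lambda>v. indicator {Some x'} (fst v)"])
      show "prob_space (step_space w k (snd i))" for i :: "nat \<times> 's"
        by (rule prob_space_step_space[OF pos])
      show "indicator (visit x n s)
          \<in> borel_measurable (Pi\<^sub>M UNIV (\<lambda>i. step_space w k (snd i)))"
        unfolding ctmc_space_eq[symmetric] by measurable
      show "(\<lambda>v. indicator {Some x'} (fst v) :: ennreal) \<in> borel_measurable (step_space w k (snd (n, s)))"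
        by (rule measurable_step_space_fst)
    qed (simp_all add: jump_chain_upd nn_integral_step_space_fst[OF pos] indicator_def[of "{\<omega>. _ \<omega>}"])
  qed
  finally show ?thesis .
qed

lemma jump_time_mono:
  assumes "\<forall>i. 0 \<le> snd (\<omega> i)"
  shows "mono (jump_time x \<omega>)"
  by (rule mono_iff_le_Suc[THEN iffD2])
     (auto split: option.split intro!: ereal_le_add_self assms[rule_format])

lemma jump_time_finite:
  assumes "\<forall>i. 0 \<le> snd (\<omega> i)" "jump_chain x \<omega> n = Some s"
  shows "\<exists>a\<ge>0. jump_time x \<omega> n = ereal a"
  using assms(2)
proof (induction n arbitrary: s)
  case (Suc n)
  then obtain s' where s': "jump_chain x \<omega> n = Some s'"
    by (auto split: option.splits)
  with Suc.IH obtain a where "a \<ge> 0" "jump_time x \<omega> n = ereal a" by blast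
  with s' assms(1)[rule_format, of "(n, s')"] show ?case by (intro exI[of _ "a + snd (\<omega> (n, s'))"]) auto
qed (simp add: zero_ereal_def)

text \<open>
  The holding intervals are disjoint because the jump times never decrease; for a time after an explosion
  both sides vanish.
\<close>

lemma indicator_ctmc:
  assumes nonneg: "\<forall>i. 0 \<le> snd (\<omega> i)" and "0 \<le> t"
  shows "indicator {t. ctmc x t \<omega> = Some x'} t
    = (\<Sum>n. indicator (visit x n x') \<omega>
        * indicator {t. jump_time x \<omega> n \<le> ereal t \<and> ereal t < jump_time x \<omega> (Suc n)} t :: ennreal)"
proof (cases "\<exists>n. ereal t < jump_time x \<omega> (Suc n)")
  case True
  define N where "N = (LEAST n. ereal t < jump_time x \<omega> (Suc n))"
  have less: "ereal t < jump_time x \<omega> (Suc N)"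
    unfolding N_def using True by (rule LeastI_ex)
  have ge: "jump_time x \<omega> N \<le> ereal t"
  proof (cases N)
    case (Suc j)
    then have "\<not> ereal t < jump_time x \<omega> (Suc j)"
      using not_less_Least[of j "\<lambda>n. ereal t < jump_time x \<omega> (Suc n)"] by (simp add: N_def)
    then show ?thesis using Suc by simp
  qed (use assms in \<open>simp add: zero_ereal_def\<close>)
  have uniq: "n = N" if "jump_time x \<omega> n \<le> ereal t" "ereal t < jump_time x \<omega> (Suc n)" for n
  proof (rule ccontr)
    assume "n \<noteq> N"
    then consider "Suc n \<le> N" | "Suc N \<le> n" by linarith
    then show False
      using monoD[OF jump_time_mono[OF nonneg], of "Suc n" N x] monoD[OF jump_time_mono[OF nonneg], of "Suc N" n x]
        that less ge by cases (meson dual_order.trans leD)+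
  qed
  have "(\<Sum>n. indicator (visit x n x') \<omega>
        * indicator {t. jump_time x \<omega> n \<le> ereal t \<and> ereal t < jump_time x \<omega> (Suc n)} t :: ennreal)
     = (\<Sum>n\<in>{N}. indicator (visit x n x') \<omega>
        * indicator {t. jump_time x \<omega> n \<le> ereal t \<and> ereal t < jump_time x \<omega> (Suc n)} t)"
    by (rule suminf_finite) (use uniq in \<open>auto simp: indicator_def simp del: jump_time.simps\<close>)
  also have "\<dots> = indicator {t. ctmc x t \<omega> = Some x'} t"
    using less ge True by (simp add: indicator_def ctmc_def N_def del: jump_time.simps)
  finally show ?thesis ..
next
  case False
  then show ?thesis by (simp add: ctmc_def indicator_def del: jump_time.simps)
qed

text \<open>Each visit contributes its holding time.\<close>

lemma occupation_time:
  assumes nonneg: "\<forall>i. 0 \<le> snd (\<omega> i)"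
  shows "(\<integral>\<^sup>+t\<in>{0..}. indicator {t. ctmc x t \<omega> = Some x'} t \<partial>lborel)
    = (\<Sum>n. ennreal (snd (\<omega> (n, x'))) * indicator (visit x n x') \<omega>)"
proof -
  let ?I = "\<lambda>n t. indicator {t. jump_time x \<omega> n \<le> ereal t \<and> ereal t < jump_time x \<omega> (Suc n)} t :: ennreal"
  have "(\<integral>\<^sup>+t\<in>{0..}. indicator {t. ctmc x t \<omega> = Some x'} t \<partial>lborel)
    = (\<integral>\<^sup>+t. (\<Sum>n. indicator (visit x n x') \<omega> * ?I n t * indicator {0..} t) \<partial>lborel)"
    by (intro nn_integral_cong) (auto simp: indicator_ctmc[OF nonneg] split: split_indicator)
  also have "\<dots> = (\<Sum>n. \<integral>\<^sup>+t. indicator (visit x n x') \<omega> * ?I n t * indicator {0..} t \<partial>lborel)"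
    by (rule nn_integral_suminf) (simp del: jump_time.simps)
  also have "\<dots> = (\<Sum>n. ennreal (snd (\<omega> (n, x'))) * indicator (visit x n x') \<omega>)"
  proof (rule suminf_cong)
    fix n
    show "(\<integral>\<^sup>+t. indicator (visit x n x') \<omega> * ?I n t * indicator {0..} t \<partial>lborel)
      = ennreal (snd (\<omega> (n, x'))) * indicator (visit x n x') \<omega>"
    proof (cases "jump_chain x \<omega> n = Some x'")
      case True
      from jump_time_finite[OF nonneg True] obtain a where a: "a \<ge> 0" "jump_time x \<omega> n = ereal a" by blast
      have "(\<integral>\<^sup>+t. indicator (visit x n x') \<omega> * ?I n t * indicator {0..} t \<partial>lborel)
        = (\<integral>\<^sup>+t. indicator {a..<a + snd (\<omega> (n, x'))} t \<partial>lborel)"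
        using True a by (intro nn_integral_cong) (auto simp: indicator_def)
      also have "\<dots> = ennreal (snd (\<omega> (n, x')))"
        using nonneg[rule_format, of "(n, x')"] by simp
      finally show ?thesis using True by simp
    qed simp
  qed
  finally show ?thesis .
qed

lemma AE_holding_times_nonneg:
  fixes w :: "'s::countable \<Rightarrow> 's \<Rightarrow> real"
  assumes pos: "\<And>x. 0 < total_weight w k x"
  shows "AE \<omega> in ctmc_space w k. \<forall>i. 0 \<le> snd (\<omega> i)"
  unfolding AE_all_countable
proof
  fix i :: "nat \<times> 's"
  let ?l = "total_weight w k (snd i)"
  let ?E = "density lborel (\<lambda>t. ennreal (exponential_density ?l t))"
  interpret E: prob_space ?E
    by (rule prob_space_exponential_density) (rule pos)
  interpret PE: pair_sigma_finite "measure_pmf (jump_pmf w k (snd i))" ?E ..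
  have "AE t in ?E. 0 \<le> t"
    by (subst AE_density) (auto simp: exponential_density_def split: if_splits)
  then have "AE v in step_space w k (snd i). 0 \<le> snd v"
    unfolding step_space_def by (intro PE.AE_pair_measure) auto
  then show "AE \<omega> in ctmc_space w k. 0 \<le> snd (\<omega> i)"
    unfolding ctmc_space_eq
    by (intro AE_PiM_component[where i = i and M = "\<lambda>i. step_space w k (snd i)"])
       (auto intro: prob_space_step_space[OF pos])
qed

text \<open>
  A holding time is independent of the event that it is used, and its mean is the inverse of the
  total weight.
\<close>

lemma expected_occupation_time:
  fixes w :: "'s::countable \<Rightarrow> 's \<Rightarrow> real"
  assumes pos: "\<And>x. 0 < total_weight w k x"
  shows "(\<integral>\<^sup>+\<omega>. (\<integral>\<^sup>+t\<in>{0..}. indicator {t. ctmc x t \<omega> = Some x'} t \<partial>lborel) \<partial>ctmc_space w k)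
    = ennreal (1 / total_weight w k x') * (\<Sum>n. visit_prob w k x n x')"
proof -
  note measurable_ctmc_coordinate_snd [measurable]
  have "(\<integral>\<^sup>+\<omega>. (\<integral>\<^sup>+t\<in>{0..}. indicator {t. ctmc x t \<omega> = Some x'} t \<partial>lborel) \<partial>ctmc_space w k)
    = (\<integral>\<^sup>+\<omega>. (\<Sum>n. ennreal (snd (\<omega> (n, x'))) * indicator (visit x n x') \<omega>) \<partial>ctmc_space w k)"
    using AE_holding_times_nonneg[OF pos]
    by (intro nn_integral_cong_AE) (auto elim!: eventually_mono intro!: occupation_time)
  also have "\<dots> = (\<Sum>n. \<integral>\<^sup>+\<omega>. ennreal (snd (\<omega> (n, x'))) * indicator (visit x n x') \<omega> \<partial>ctmc_space w k)"
    by (rule nn_integral_suminf) measurable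
  also have "\<dots> = (\<Sum>n. ennreal (1 / total_weight w k x') * visit_prob w k x n x')"
  proof (rule suminf_cong)
    fix n :: nat
    have "(\<lambda>v. ennreal (snd v)) \<in> borel_measurable (count_space (UNIV :: 's option set) \<Otimes>\<^sub>M borel)"
      by measurable
    then have F: "(\<lambda>v. ennreal (snd v)) \<in> borel_measurable (step_space w k (snd (n, x')))"
      by (simp cong: measurable_cong_sets add: sets_step_space)
    have G: "indicator (visit x n x') \<in> borel_measurable (Pi\<^sub>M UNIV (\<lambda>i. step_space w k (snd i)))"
      unfolding ctmc_space_eq[symmetric] by measurable
    show "(\<integral>\<^sup>+\<omega>. ennreal (snd (\<omega> (n, x'))) * indicator (visit x n x') \<omega> \<partial>ctmc_space w k)
        = ennreal (1 / total_weight w k x') * visit_prob w k x n x'"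
      unfolding visit_prob_def ctmc_space_eq
      by (subst nn_integral_PiM_coordinate[OF prob_space_step_space[OF pos] F G])
         (simp_all add: jump_chain_upd nn_integral_step_space_snd[OF pos] indicator_def[of "{\<omega>. _ \<omega>}"])
  qed
  finally show ?thesis by simp
qed

lemma green_eq_suminf_visit_prob:
  fixes w :: "'s::countable \<Rightarrow> 's \<Rightarrow> real"
  assumes pos: "\<And>x. 0 < total_weight w k x"
  shows "green w k x x'
    = 1 / (total_weight w k x')\<^sup>2 * enn2real (\<Sum>n. visit_prob w k x n x')"
  unfolding green_def expected_occupation_time[OF pos]
  using pos[of x'] by (simp add: enn2real_mult power2_eq_square)

text \<open>
  By Tonelli's theorem the left-hand side is the expected occupation time.
\<close>

lemma integral_transition_prob:
  fixes w :: "'s::countable \<Rightarrow> 's \<Rightarrow> real"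
  assumes pos: "\<And>x. 0 < total_weight w k x"
  shows "(\<integral>\<^sup>+t\<in>{0..}. emeasure (ctmc_space w k)
      {\<omega> \<in> space (ctmc_space w k). ctmc x t \<omega> = Some x'} \<partial>lborel)
    = ennreal (1 / total_weight w k x') * (\<Sum>n. visit_prob w k x n x')"
proof -
  interpret P: prob_space "ctmc_space w k" by (rule prob_space_ctmc_space) (rule pos)
  interpret L: pair_sigma_finite "ctmc_space w k" lborel ..
  have [measurable]: "(\<lambda>\<omega>. ctmc x t \<omega>) \<in> ctmc_space w k \<rightarrow>\<^sub>M count_space UNIV" for t
    using measurable_compose[OF measurable_Pair2'[of t borel "ctmc_space w k"] measurable_ctmc[of x w k]]
    by simp
  have "(\<integral>\<^sup>+t\<in>{0..}. emeasure (ctmc_space w k)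
      {\<omega> \<in> space (ctmc_space w k). ctmc x t \<omega> = Some x'} \<partial>lborel)
    = (\<integral>\<^sup>+t. (\<integral>\<^sup>+\<omega>. indicator {Some x'} (ctmc x t \<omega>) * indicator {0..} t \<partial>ctmc_space w k) \<partial>lborel)"
  proof (rule nn_integral_cong)
    fix t
    have "emeasure (ctmc_space w k) {\<omega> \<in> space (ctmc_space w k). ctmc x t \<omega> = Some x'}
      = (\<integral>\<^sup>+\<omega>. indicator {\<omega> \<in> space (ctmc_space w k). ctmc x t \<omega> = Some x'} \<omega> \<partial>ctmc_space w k)"
      by (rule nn_integral_indicator[symmetric]) measurable
    also have "\<dots> = (\<integral>\<^sup>+\<omega>. indicator {Some x'} (ctmc x t \<omega>) \<partial>ctmc_space w k)"
      by (rule nn_integral_cong) (auto simp: indicator_def)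
    finally show "emeasure (ctmc_space w k) {\<omega> \<in> space (ctmc_space w k). ctmc x t \<omega> = Some x'} * indicator {0..} t
      = (\<integral>\<^sup>+\<omega>. indicator {Some x'} (ctmc x t \<omega>) * indicator {0..} t \<partial>ctmc_space w k)"
      by (subst nn_integral_multc) auto
  qed
  also have "\<dots> = (\<integral>\<^sup>+\<omega>. (\<integral>\<^sup>+t. indicator {Some x'} (ctmc x t \<omega>) * indicator {0..} t \<partial>lborel) \<partial>ctmc_space w k)"
  proof (rule L.Fubini')
    have "sets (ctmc_space w k \<Otimes>\<^sub>M lborel) = sets (ctmc_space w k \<Otimes>\<^sub>M borel)"
      by (rule sets_pair_measure_cong) simp_all
    then have [measurable]: "(\<lambda>p. ctmc x (snd p) (fst p)) \<in> ctmc_space w k \<Otimes>\<^sub>M lborel \<rightarrow>\<^sub>M count_space UNIV"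
      using measurable_ctmc[of x w k] by (simp add: case_prod_beta' cong: measurable_cong_sets)
    have [measurable]: "(\<lambda>p. indicator {Some x'} (ctmc x (snd p) (fst p)) :: ennreal)
        \<in> borel_measurable (ctmc_space w k \<Otimes>\<^sub>M lborel)"
      by (rule measurable_compose[of _ _ "count_space UNIV"]) simp_all
    show "(\<lambda>(\<omega>, t). indicator {Some x'} (ctmc x t \<omega>) * indicator {0..} t :: ennreal)
        \<in> borel_measurable (ctmc_space w k \<Otimes>\<^sub>M lborel)"
      unfolding case_prod_beta' by (intro borel_measurable_times_ennreal) measurable
  qed
  also have "\<dots> = (\<integral>\<^sup>+\<omega>. (\<integral>\<^sup>+t\<in>{0..}. indicator {t. ctmc x t \<omega> = Some x'} t \<partial>lborel) \<partial>ctmc_space w k)"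
    by (intro nn_integral_cong) (auto simp: indicator_def)
  finally show ?thesis by (simp add: expected_occupation_time[OF pos])
qed

section \<open>Gaussian integrals and the cosine\<close>

lemma integral_cos_std_normal:
  "(\<integral>x. std_normal_density x * cos (t * x) \<partial>lborel) = exp (- t\<^sup>2 / 2)"
proof -
  interpret N: prob_space std_normal_distribution by (rule prob_space_normal_density) simp
  have int: "complex_integrable std_normal_distribution (\<lambda>x. iexp (t * x))"
    by (rule N.integrable_const_bound[of _ 1]) simp_all
  have "exp (- t\<^sup>2 / 2) = Re (char std_normal_distribution t)"
    by (simp add: char_std_normal_distribution Re_exp)
  also have "\<dots> = (\<integral>x. Re (iexp (t * x)) \<partial>std_normal_distribution)"
    unfolding char_def using int by (rule integral_Re[symmetric])
  also have "\<dots> = (\<integral>x. std_normal_density x * cos (t * x) \<partial>lborel)"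
    by (subst integral_density) (simp_all add: Re_exp)
  finally show ?thesis by simp
qed

lemma has_integral_cos_gaussian:
  fixes a k :: real
  assumes a: "a > 0"
  shows "((\<lambda>x. cos (k * x) * exp (- a * x\<^sup>2)) has_integral sqrt (pi / a) * exp (- k\<^sup>2 / (4 * a))) UNIV"
proof -
  define c where "c = sqrt (2 * a)"
  have c: "c > 0" "c\<^sup>2 = 2 * a" using a by (simp_all add: c_def)
  let ?g = "\<lambda>x. std_normal_density x * cos (k / c * x)"
  interpret N: prob_space std_normal_distribution by (rule prob_space_normal_density) simp
  have "integrable std_normal_distribution (\<lambda>x. cos (k / c * x))"
    by (rule N.integrable_const_bound[of _ 1]) simp_all
  then have g: "integrable lborel ?g"
    by (subst (asm) integrable_density) simp_all
  have eq: "sqrt (2 * pi) * ?g (0 + c * x) = cos (k * x) * exp (- a * x\<^sup>2)" for x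
    using c by (simp add: std_normal_density_def power_mult_distrib)
  have "integrable lborel (\<lambda>x. sqrt (2 * pi) * ?g (0 + c * x))"
    using lborel_integrable_real_affine[OF g, of c 0] c by (intro integrable_mult_right) simp
  then have int: "integrable lborel (\<lambda>x. cos (k * x) * exp (- a * x\<^sup>2))"
    by (simp only: eq)
  have "exp (- (k / c)\<^sup>2 / 2) = c * (\<integral>x. ?g (0 + c * x) \<partial>lborel)"
    using lborel_integral_real_affine[of c ?g 0] c integral_cos_std_normal[of "k / c"] by simp
  then have "sqrt (2 * pi) * exp (- (k / c)\<^sup>2 / 2) = c * (\<integral>x. sqrt (2 * pi) * ?g (0 + c * x) \<partial>lborel)"
    by simp
  then have "(\<integral>x. cos (k * x) * exp (- a * x\<^sup>2) \<partial>lborel) = sqrt (2 * pi) / c * exp (- (k / c)\<^sup>2 / 2)"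
    unfolding eq using c by (simp add: field_simps)
  also have "sqrt (2 * pi) / c = sqrt (pi / a)"
    by (simp add: c_def real_sqrt_divide[symmetric])
  also have "- (k / c)\<^sup>2 / 2 = - k\<^sup>2 / (4 * a)"
    using c by (simp add: power_divide)
  finally show ?thesis
    using has_integral_integral_lborel[OF int] by simp
qed

lemma has_integral_gaussian:
  fixes a :: real
  assumes "a > 0"
  shows "((\<lambda>x. exp (- a * x\<^sup>2)) has_integral sqrt (pi / a)) UNIV"
  using has_integral_cos_gaussian[OF assms, of 0] by simp

text \<open>
  Concavity of the sine.  The bound controls \<open>exp (- s (1 - cos \<theta>))\<close> by a Gaussian on a full period,
  and it also separates the frequencies of the cycle from 0.
\<close>

lemma one_minus_cos_ge:
  assumes "\<bar>x\<bar> \<le> pi"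
  shows "2 * x\<^sup>2 / pi\<^sup>2 \<le> 1 - cos x"
proof -
  have *: "2 / pi * u \<le> sin u" if u: "0 \<le> u" "u \<le> pi / 2" for u
  proof -
    have "convex_on {0..pi/2} (\<lambda>x. - sin x)"
    proof (rule f''_ge0_imp_convex)
      show "((\<lambda>x. - sin x) has_real_derivative - cos x) (at x)" for x
        by (auto intro!: derivative_eq_intros)
      show "((\<lambda>x. - cos x) has_real_derivative sin x) (at x)" for x
        by (auto intro!: derivative_eq_intros)
    qed (auto intro!: sin_ge_zero)
    from convex_onD[OF this, of "2 * u / pi" 0 "pi / 2"] u show ?thesis
      by (simp add: field_simps)
  qed
  define u where "u = \<bar>x\<bar> / 2"
  have u: "0 \<le> u" "u \<le> pi / 2" "x\<^sup>2 = 4 * u\<^sup>2" "cos x = cos (2 * u)"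
    using assms by (auto simp: u_def power_divide)
  have "(2 / pi * u)\<^sup>2 \<le> (sin u)\<^sup>2"
    using *[OF u(1,2)] u by (intro power_mono) auto
  then show ?thesis
    by (simp add: u cos_double_sin power_divide power_mult_distrib)
qed

lemma one_minus_cos_le: "1 - cos x \<le> x\<^sup>2 / 2" for x :: real
proof -
  have "(sin (x / 2))\<^sup>2 \<le> (x / 2)\<^sup>2"
    using abs_sin_x_le_abs_x[of "x / 2"] by (rule abs_le_square_iff[THEN iffD1])
  then show ?thesis
    using cos_double_sin[of "x / 2"] by (simp add: power_divide)
qed

lemma one_minus_cos_taylor: "x\<^sup>2 / 2 - (1 - cos x) \<le> x ^ 4 / 24" for x :: real
proof -
  obtain t where t: "cos x = (\<Sum>m<4. cos_coeff m * x ^ m) + (cos (t + 1/2 * real 4 * pi) / fact 4) * x ^ 4"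
    using Maclaurin_cos_expansion[of x 4] by blast
  have "(\<Sum>m<4. cos_coeff m * x ^ m) = 1 - x\<^sup>2 / 2"
  proof -
    have "{..<4} = {0, 1, 2, 3 :: nat}" by auto
    then show ?thesis by (simp add: cos_coeff_def fact_numeral)
  qed
  moreover have "cos (t + 1/2 * real 4 * pi) / fact 4 * x ^ 4 \<le> 1 / 24 * x ^ 4"
    by (intro mult_right_mono) (simp_all add: fact_numeral)
  ultimately show ?thesis using t by simp
qed

lemma mult_exp_minus_le: "u * exp (- u) \<le> 1" for u :: real
proof -
  have "u \<le> exp u" using exp_ge_add_one_self[of u] by linarith
  then show ?thesis by (simp add: exp_minus field_simps)
qed

lemma square_mult_exp_minus_le: "u\<^sup>2 * exp (- u) \<le> 2" if "0 \<le> u" for u :: real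
proof -
  have "u\<^sup>2 \<le> 2 * exp u" using exp_lower_Taylor_quadratic[OF that] that by simp
  then show ?thesis by (simp add: exp_minus field_simps)
qed

section \<open>The heat kernel of the continuous-time walk on the integers\<close>

abbreviation sq :: "int \<Rightarrow> real" where "sq k \<equiv> (real_of_int k)\<^sup>2"

text \<open>
  The transition probability of the walk that jumps by \<open>1\<close> and by \<open>-1\<close> at rate \<open>1/2\<close> each, given by Fourier
  inversion, since all its estimates come from this integral.  Lemmas \<open>heat_0\<close> and
  \<open>has_derivative_heat\<close> identify it as the solution of the heat equation on the integers.
\<close>

definition heat :: "real \<Rightarrow> int \<Rightarrow> real" where
  "heat s k = integral {-pi..pi} (\<lambda>\<theta>. cos (real_of_int k * \<theta>) * exp (- s * (1 - cos \<theta>))) / (2 * pi)"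

definition gauss :: "real \<Rightarrow> real \<Rightarrow> real" where
  "gauss s u = exp (- u\<^sup>2 / (2 * s)) / sqrt (2 * pi * s)"

lemma exp_cos_le_gaussian:
  assumes "s \<ge> 0" "\<theta> \<in> {-pi..pi}"
  shows "exp (- s * (1 - cos \<theta>)) \<le> exp (- (2 * s / pi\<^sup>2) * \<theta>\<^sup>2)"
  using mult_left_mono[OF one_minus_cos_ge[of \<theta>], of s] assms by (auto simp: mult_ac)

lemma integral_gaussian_le:
  assumes "a > 0"
  shows "integral {-pi..pi} (\<lambda>x. exp (- a * x\<^sup>2)) \<le> sqrt (pi / a)"
proof -
  have "integral {-pi..pi} (\<lambda>x. exp (- a * x\<^sup>2)) \<le> integral UNIV (\<lambda>x. exp (- a * x\<^sup>2))"
    using has_integral_gaussian[OF assms]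
    by (intro integral_subset_le) (auto intro!: integrable_continuous_real continuous_intros)
  then show ?thesis using has_integral_gaussian[OF assms] by (simp add: integral_unique)
qed

lemma abs_heat_le_one:
  assumes "s \<ge> 0" shows "\<bar>heat s k\<bar> \<le> 1"
proof -
  have "norm (integral {-pi..pi} (\<lambda>\<theta>. cos (real_of_int k * \<theta>) * exp (- s * (1 - cos \<theta>)))) \<le> integral {-pi..pi} (\<lambda>_. 1)"
    using assms
    by (intro integral_norm_bound_integral)
       (auto intro!: integrable_continuous_real continuous_intros mult_le_one simp: abs_mult)
  then show ?thesis by (simp add: heat_def field_simps)
qed

lemma abs_heat_le_sqrt:
  assumes s: "s > 0" shows "\<bar>heat s k\<bar> \<le> 1 / sqrt s"
proof -
  let ?a = "2 * s / pi\<^sup>2"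
  have "norm (integral {-pi..pi} (\<lambda>\<theta>. cos (real_of_int k * \<theta>) * exp (- s * (1 - cos \<theta>))))
      \<le> integral {-pi..pi} (\<lambda>\<theta>. exp (- ?a * \<theta>\<^sup>2))"
  proof (intro integral_norm_bound_integral)
    fix \<theta> assume "\<theta> \<in> {-pi..pi}"
    have "\<bar>cos (real_of_int k * \<theta>)\<bar> * exp (- s * (1 - cos \<theta>)) \<le> 1 * exp (- s * (1 - cos \<theta>))"
      by (intro mult_right_mono) auto
    also have "\<dots> \<le> exp (- ?a * \<theta>\<^sup>2)"
      using exp_cos_le_gaussian[of s \<theta>] s \<open>\<theta> \<in> _\<close> by simp
    finally show "norm (cos (real_of_int k * \<theta>) * exp (- s * (1 - cos \<theta>))) \<le> exp (- ?a * \<theta>\<^sup>2)"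
      by (simp add: abs_mult)
  qed (auto intro!: integrable_continuous_real continuous_intros)
  also have "\<dots> \<le> sqrt (pi / ?a)"
    using s by (intro integral_gaussian_le) simp
  also have "\<dots> \<le> sqrt ((2 * pi)\<^sup>2 / s)"
  proof (rule real_sqrt_le_mono)
    have "pi * pi\<^sup>2 \<le> 4 * (pi\<^sup>2 * 2)"
      using pi_less_4 by (simp add: mult_right_mono)
    then show "pi / ?a \<le> (2 * pi)\<^sup>2 / s"
      using s by (simp add: field_simps power2_eq_square)
  qed
  also have "\<dots> = 2 * pi / sqrt s"
    by (simp add: real_sqrt_divide real_sqrt_mult)
  finally show ?thesis using s by (simp add: heat_def field_simps)
qed

text \<open>
  Decay in space, which is what counts for times below \<open>k^2\<close>.  Two integrations by parts turn the
  factor \<open>k^2\<close> into a second derivative of \<open>exp (- s (1 - cos \<theta>))\<close>, which is at most of order \<open>s\<close>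
  times a Gaussian.
\<close>

lemma abs_heat_mult_square_le:
  assumes s: "s > 0" shows "\<bar>heat s k\<bar> * sq k \<le> 17 * sqrt s"
proof -
  let ?F = "\<lambda>\<theta>::real. exp (- s * (1 - cos \<theta>))"
  let ?G = "\<lambda>\<theta>::real. cos (real_of_int k * \<theta>) * ((s\<^sup>2 * (sin \<theta>)\<^sup>2 - s * cos \<theta>) * ?F \<theta>)"
  let ?B = "\<lambda>\<theta>::real. real_of_int k * sin (real_of_int k * \<theta>) * ?F \<theta> + cos (real_of_int k * \<theta>) * (- s * sin \<theta> * ?F \<theta>)"
  (* ?G is cos (k \<theta>) times the second derivative of ?F, and ?B collects the boundary terms. *)
  have "((\<lambda>\<theta>::real. sq k * (cos (real_of_int k * \<theta>) * ?F \<theta>) + ?G \<theta>) has_integral ?B pi - ?B (-pi)) {-pi..pi}"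
    by (rule fundamental_theorem_of_calculus)
       (auto intro!: derivative_eq_intros simp: has_real_derivative_iff_has_vector_derivative[symmetric]
         power2_eq_square algebra_simps)
  moreover have "?B pi - ?B (-pi) = 0"
    by (simp add: sin_int_times_real mult.commute)
  ultimately have "integral {-pi..pi} (\<lambda>\<theta>::real. sq k * (cos (real_of_int k * \<theta>) * ?F \<theta>) + ?G \<theta>) = 0"
    by (simp add: integral_unique)
  moreover have "integral {-pi..pi} (\<lambda>\<theta>::real. sq k * (cos (real_of_int k * \<theta>) * ?F \<theta>) + ?G \<theta>)
      = sq k * integral {-pi..pi} (\<lambda>\<theta>. cos (real_of_int k * \<theta>) * ?F \<theta>) + integral {-pi..pi} ?G"
    by (subst integral_add) (auto intro!: integrable_continuous_real continuous_intros)
  ultimately have eq: "sq k * integral {-pi..pi} (\<lambda>\<theta>. cos (real_of_int k * \<theta>) * ?F \<theta>) = - integral {-pi..pi} ?G"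
    by linarith
  let ?a = "s / pi\<^sup>2"
  have "norm (integral {-pi..pi} ?G) \<le> integral {-pi..pi} (\<lambda>\<theta>. (pi\<^sup>2 + 1) * s * exp (- ?a * \<theta>\<^sup>2))"
  proof (intro integral_norm_bound_integral)
    fix \<theta> assume \<theta>: "\<theta> \<in> {-pi..pi}"
    define u where "u = ?a * \<theta>\<^sup>2"
    have u: "0 \<le> u" "s * \<theta>\<^sup>2 = pi\<^sup>2 * u" using s by (simp_all add: u_def)
    have "\<bar>s\<^sup>2 * (sin \<theta>)\<^sup>2 - s * cos \<theta>\<bar> \<le> s\<^sup>2 * (sin \<theta>)\<^sup>2 + s * \<bar>cos \<theta>\<bar>"
      using s by (intro order_trans[OF abs_triangle_ineq4]) (simp add: abs_mult)
    also have "\<dots> \<le> s\<^sup>2 * \<theta>\<^sup>2 + s * 1"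
      using s abs_le_square_iff[THEN iffD1, OF abs_sin_x_le_abs_x[of \<theta>]]
      by (intro add_mono mult_left_mono) auto
    also have "\<dots> = s * (pi\<^sup>2 * u + 1)" using u by (simp add: power2_eq_square algebra_simps)
    finally have 1: "\<bar>s\<^sup>2 * (sin \<theta>)\<^sup>2 - s * cos \<theta>\<bar> \<le> s * (pi\<^sup>2 * u + 1)" .
    have 2: "?F \<theta> \<le> exp (- u) * exp (- u)"
      using exp_cos_le_gaussian[of s \<theta>] s \<theta> by (simp add: exp_add[symmetric] u_def)
    have "norm (?G \<theta>) \<le> 1 * ((s * (pi\<^sup>2 * u + 1)) * (exp (- u) * exp (- u)))"
      unfolding norm_mult using 1 2 s u by (intro mult_mono) auto
    also have "\<dots> = s * exp (- u) * (pi\<^sup>2 * (u * exp (- u)) + exp (- u))"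
      by (simp add: algebra_simps)
    also have "\<dots> \<le> s * exp (- u) * (pi\<^sup>2 * 1 + 1)"
      using s u mult_exp_minus_le[of u] by (intro mult_left_mono add_mono) auto
    finally show "norm (?G \<theta>) \<le> (pi\<^sup>2 + 1) * s * exp (- ?a * \<theta>\<^sup>2)"
      by (simp add: u_def mult_ac)
  qed (auto intro!: integrable_continuous_real continuous_intros)
  also have "\<dots> = (pi\<^sup>2 + 1) * s * integral {-pi..pi} (\<lambda>\<theta>. exp (- ?a * \<theta>\<^sup>2))"
    by simp
  also have "\<dots> \<le> (pi\<^sup>2 + 1) * s * sqrt (pi / ?a)"
    using s by (intro mult_left_mono integral_gaussian_le) auto
  also have "sqrt (pi / ?a) = pi * (sqrt pi / sqrt s)"
    using s by (simp add: real_sqrt_divide real_sqrt_mult)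
  also have "(pi\<^sup>2 + 1) * s * (pi * (sqrt pi / sqrt s)) = (pi\<^sup>2 + 1) * sqrt pi * pi * sqrt s"
    using s by (simp add: field_simps)
  also have "\<dots> \<le> (4\<^sup>2 + 1) * 2 * pi * sqrt s"
  proof -
    have "sqrt pi \<le> sqrt 4" using pi_less_4 by (intro real_sqrt_le_mono) simp
    moreover have "pi\<^sup>2 \<le> 4\<^sup>2" using pi_less_4 by (intro power_mono) auto
    ultimately show ?thesis using s by (intro mult_right_mono mult_mono add_mono) auto
  qed
  finally have "norm (sq k * integral {-pi..pi} (\<lambda>\<theta>. cos (real_of_int k * \<theta>) * ?F \<theta>)) \<le> 2 * pi * (17 * sqrt s)"
    unfolding eq by (simp add: mult_ac)
  then show ?thesis by (simp add: heat_def abs_mult field_simps)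
qed

text \<open>
  The local central limit theorem, uniformly in space.  Inside the period the integrands have relative
  difference at most of order \<open>s \<theta>^4\<close>, and outside of it only the Gaussian is left.
\<close>

lemma heat_gauss_diff_le:
  assumes s: "s > 0" shows "\<bar>heat s k - gauss s (real_of_int k)\<bar> \<le> 22 / (s * sqrt s)"
proof -
  let ?f = "\<lambda>\<theta>::real. if \<theta> \<in> {-pi..pi} then cos (real_of_int k * \<theta>) * exp (- s * (1 - cos \<theta>)) else 0"
  let ?g = "\<lambda>\<theta>::real. cos (real_of_int k * \<theta>) * exp (- (s / 2) * \<theta>\<^sup>2)"
  let ?a = "s / pi\<^sup>2"
  have f: "?f integrable_on UNIV"
    by (subst integrable_restrict_UNIV) (auto intro!: integrable_continuous_real continuous_intros)
  have g: "(?g has_integral sqrt (pi / (s / 2)) * exp (- k\<^sup>2 / (4 * (s / 2)))) UNIV"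
    using has_integral_cos_gaussian[of "s / 2" k] s by simp
  have gauss: "gauss s k = integral UNIV ?g / (2 * pi)"
  proof -
    have "sqrt (pi / (s / 2)) = sqrt ((2 * pi)\<^sup>2 / (2 * pi * s))"
      using s by (simp add: field_simps power2_eq_square)
    also have "\<dots> = 2 * pi / sqrt (2 * pi * s)"
      by (subst real_sqrt_divide) (simp add: real_sqrt_mult)
    finally show ?thesis
      unfolding integral_unique[OF g] gauss_def by simp
  qed
  have heat: "heat s k = integral UNIV ?f / (2 * pi)"
    unfolding heat_def by (subst integral_restrict_UNIV) simp
  have "norm (integral UNIV (\<lambda>\<theta>. ?f \<theta> - ?g \<theta>)) \<le> integral UNIV (\<lambda>\<theta>. 22 / s * exp (- ?a * \<theta>\<^sup>2))"
  proof (intro integral_norm_bound_integral)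
    show "(\<lambda>\<theta>. ?f \<theta> - ?g \<theta>) integrable_on UNIV"
      using f g by (intro integrable_diff) auto
    show "(\<lambda>\<theta>. 22 / s * exp (- ?a * \<theta>\<^sup>2)) integrable_on UNIV"
      using has_integral_mult_right[OF has_integral_gaussian[of ?a], of "22 / s"] s
      by (auto simp: has_integral_integrable)
    fix \<theta> :: real
    define u where "u = ?a * \<theta>\<^sup>2"
    have u: "0 \<le> u" "s * \<theta>\<^sup>2 = pi\<^sup>2 * u" using s by (simp_all add: u_def)
    have "\<bar>?f \<theta> - ?g \<theta>\<bar> \<le> 22 / s * exp (- u)"
    proof (cases "\<theta> \<in> {-pi..pi}")
      case True
      define b where "b = s * (\<theta>\<^sup>2 / 2 - (1 - cos \<theta>))"
      have b: "0 \<le> b" "b \<le> s * (\<theta> ^ 4 / 24)"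
        unfolding b_def using s one_minus_cos_le[of \<theta>] one_minus_cos_taylor[of \<theta>]
        by (auto intro!: mult_left_mono mult_nonneg_nonneg)
      have "s * (\<theta> ^ 4 / 24) = (s * \<theta>\<^sup>2)\<^sup>2 / (24 * s)"
        using s by (simp add: power2_eq_square field_simps numeral_eq_Suc)
      with b have b': "b \<le> pi ^ 4 * u\<^sup>2 / (24 * s)"
        by (simp add: u power_mult_distrib)
      have "?f \<theta> - ?g \<theta> = cos (real_of_int k * \<theta>) * (exp (- s * (1 - cos \<theta>)) - exp (- s * (1 - cos \<theta>)) * exp (- b))"
        using True by (simp add: b_def exp_add[symmetric] algebra_simps)
      also have "\<dots> = cos (real_of_int k * \<theta>) * (exp (- s * (1 - cos \<theta>)) * (1 - exp (- b)))"
        by (simp add: algebra_simps)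
      finally have "\<bar>?f \<theta> - ?g \<theta>\<bar> = \<bar>cos (real_of_int k * \<theta>)\<bar> * (exp (- s * (1 - cos \<theta>)) * (1 - exp (- b)))"
        using b by (simp only: abs_mult) simp
      also have "\<dots> \<le> 1 * (exp (- u) * exp (- u) * (pi ^ 4 * u\<^sup>2 / (24 * s)))"
      proof (intro mult_mono)
        show "exp (- s * (1 - cos \<theta>)) \<le> exp (- u) * exp (- u)"
          using exp_cos_le_gaussian[of s \<theta>] s True by (simp add: exp_add[symmetric] u_def)
        show "1 - exp (- b) \<le> pi ^ 4 * u\<^sup>2 / (24 * s)"
          using b' exp_ge_add_one_self[of "- b"] by linarith
      qed (use s b in auto)
      also have "\<dots> = exp (- u) * (pi ^ 4 / (24 * s)) * (u\<^sup>2 * exp (- u))"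
        by (simp add: field_simps)
      also have "\<dots> \<le> exp (- u) * (pi ^ 4 / (24 * s)) * 2"
        using s square_mult_exp_minus_le[OF u(1)] by (intro mult_left_mono) auto
      also have "\<dots> \<le> exp (- u) * (4 ^ 4 / (24 * s)) * 2"
        using s pi_less_4 by (intro mult_left_mono mult_right_mono divide_right_mono power_mono) auto
      also have "\<dots> \<le> 22 / s * exp (- u)" using s by (simp add: field_simps)
      finally show ?thesis .
    next
      case False
      then have "pi\<^sup>2 \<le> \<theta>\<^sup>2" by (auto simp: abs_le_square_iff[symmetric])
      have "s * 1 \<le> s * (\<theta>\<^sup>2 / pi\<^sup>2)"
        using s \<open>pi\<^sup>2 \<le> \<theta>\<^sup>2\<close> by (intro mult_left_mono) auto
      then have "s \<le> u" by (simp add: u_def)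
      have "2 * u \<le> (s / 2) * \<theta>\<^sup>2"
      proof -
        have "2 * 2 \<le> pi * pi" using pi_ge_two by (intro mult_mono) auto
        then have "2 * 2 * u \<le> pi * pi * u" using u by (intro mult_right_mono) auto
        then show ?thesis using u by (simp add: power2_eq_square)
      qed
      then have "?g \<theta> \<le> 1 * (exp (- u) * exp (- u))" and "\<bar>?g \<theta>\<bar> \<le> 1 * (exp (- u) * exp (- u))"
        unfolding exp_add[symmetric] abs_mult by (intro mult_mono; simp)+
      moreover have "exp (- u) \<le> 22 / s"
      proof -
        have "s * exp (- u) \<le> u * exp (- u)" using \<open>s \<le> u\<close> by (rule mult_right_mono) simp
        also have "\<dots> \<le> 22" using mult_exp_minus_le[of u] by linarith
        finally show ?thesis using s by (simp add: pos_le_divide_eq mult.commute)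
      qed
      then have "exp (- u) * exp (- u) \<le> 22 / s * exp (- u)"
        by (intro mult_right_mono) auto
      ultimately show ?thesis using False by auto
    qed
    then show "norm (?f \<theta> - ?g \<theta>) \<le> 22 / s * exp (- ?a * \<theta>\<^sup>2)" by (simp add: u_def)
  qed
  also have "\<dots> = 22 / s * sqrt (pi / ?a)"
    using has_integral_gaussian[of ?a] s by (simp add: integral_unique)
  also have "sqrt (pi / ?a) = pi * (sqrt pi / sqrt s)"
    using s by (simp add: real_sqrt_divide real_sqrt_mult)
  also have "22 / s * (pi * (sqrt pi / sqrt s)) \<le> 22 / s * (pi * (2 / sqrt s))"
  proof -
    have "sqrt pi \<le> sqrt 4" using pi_less_4 by (intro real_sqrt_le_mono) simp
    then show ?thesis using s by (intro mult_left_mono divide_right_mono) auto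
  qed
  also have "integral UNIV (\<lambda>\<theta>. ?f \<theta> - ?g \<theta>) = integral UNIV ?f - integral UNIV ?g"
    using f g by (intro integral_diff) auto
  finally show ?thesis
    by (simp add: heat gauss diff_divide_distrib[symmetric] field_simps)
qed

section \<open>Positivity and periodization\<close>

text \<open>
  The discrete-time walk.  The recursion makes positivity and periodization provable by induction;
  both pass to the heat kernel by Poissonization, that is by expanding \<open>exp (s cos \<theta>)\<close>.
\<close>

primrec srw :: "nat \<Rightarrow> int \<Rightarrow> real" where
  "srw 0 k = (if k = 0 then 1 else 0)"
| "srw (Suc n) k = (srw n (k + 1) + srw n (k - 1)) / 2"

lemma srw_nonneg: "0 \<le> srw n k"
  by (induction n arbitrary: k) auto

lemma cos_add_cos_shift: "cos (x * (k + 1)) + cos (x * (k - 1)) = 2 * cos x * cos (x * k)" for x :: real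
  by (simp add: cos_add cos_diff distrib_left right_diff_distrib)

lemma has_integral_srw:
  "((\<lambda>\<theta>. cos (real_of_int k * \<theta>) * cos \<theta> ^ n) has_integral 2 * pi * srw n k) {-pi..pi}"
proof (induction n arbitrary: k)
  case 0
  show ?case
  proof (cases "k = 0")
    case True
    then show ?thesis using has_integral_const_real[of "1::real" "-pi" pi] by simp
  next
    case False
    have "((\<lambda>\<theta>. cos (real_of_int k * \<theta>)) has_integral
        sin (real_of_int k * pi) / real_of_int k - sin (real_of_int k * (- pi)) / real_of_int k) {-pi..pi}"
      using False
      by (intro fundamental_theorem_of_calculus)
         (auto intro!: derivative_eq_intros simp: has_real_derivative_iff_has_vector_derivative[symmetric])
    then show ?thesis using False by (simp add: sin_int_times_real mult.commute)
  qed
next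
  case (Suc n)
  have "((\<lambda>\<theta>. (cos (real_of_int (k + 1) * \<theta>) * cos \<theta> ^ n + cos (real_of_int (k - 1) * \<theta>) * cos \<theta> ^ n) / 2)
      has_integral (2 * pi * srw n (k + 1) + 2 * pi * srw n (k - 1)) / 2) {-pi..pi}"
    by (intro has_integral_divide has_integral_add Suc.IH)
  moreover have "(cos (real_of_int (k + 1) * \<theta>) * cos \<theta> ^ n + cos (real_of_int (k - 1) * \<theta>) * cos \<theta> ^ n) / 2
      = cos (real_of_int k * \<theta>) * cos \<theta> ^ Suc n" for \<theta>
  proof -
    have "cos (real_of_int (k + 1) * \<theta>) + cos (real_of_int (k - 1) * \<theta>) = 2 * cos \<theta> * cos (real_of_int k * \<theta>)"
      using cos_add_cos_shift[of \<theta> "real_of_int k"] by (simp add: mult.commute)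
    then show ?thesis by (simp add: distrib_right[symmetric])
  qed
  ultimately show ?case by (simp add: algebra_simps add_divide_distrib)
qed

lemma poisson_sums_exp: "(\<lambda>n. exp (- s) * (s ^ n / fact n) * c ^ n) sums exp (- s * (1 - c))" for s c :: real
proof -
  have "(\<lambda>n. exp (- s) * ((s * c) ^ n /\<^sub>R fact n)) sums (exp (- s) * exp (s * c))"
    by (intro sums_mult exp_converges)
  moreover have "exp (- s) * exp (s * c) = exp (- s * (1 - c))"
    by (simp add: exp_add[symmetric] algebra_simps)
  ultimately show ?thesis by (simp add: power_mult_distrib divide_inverse mult_ac)
qed

lemma heat_sums:
  assumes s: "s \<ge> 0"
  shows "(\<lambda>n. exp (- s) * (s ^ n / fact n) * srw n k) sums heat s k"
proof -
  let ?t = "\<lambda>n \<theta>. exp (- s) * (s ^ n / fact n) * (cos (real_of_int k * \<theta>) * cos \<theta> ^ n)"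
  have lim: "uniform_limit {-pi..pi} (\<lambda>n \<theta>. \<Sum>i<n. ?t i \<theta>) (\<lambda>\<theta>. \<Sum>i. ?t i \<theta>) sequentially"
  proof (rule Weierstrass_m_test)
    show "summable (\<lambda>n. exp (- s) * (s ^ n / fact n) * 1 ^ n)"
      using poisson_sums_exp[of s 1] by (simp only: sums_iff)
    fix n and \<theta> :: real
    have "\<bar>cos (real_of_int k * \<theta>) * cos \<theta> ^ n\<bar> \<le> 1"
      by (auto simp: abs_mult power_abs intro!: mult_le_one power_le_one)
    then have "exp (- s) * (s ^ n / fact n) * \<bar>cos (real_of_int k * \<theta>) * cos \<theta> ^ n\<bar> \<le> exp (- s) * (s ^ n / fact n) * 1"
      using s by (intro mult_left_mono) auto
    then show "norm (?t n \<theta>) \<le> exp (- s) * (s ^ n / fact n) * 1 ^ n"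
      using s by (simp add: abs_mult)
  qed
  have eq: "(\<Sum>i. ?t i \<theta>) = cos (real_of_int k * \<theta>) * exp (- s * (1 - cos \<theta>))" for \<theta>
    using sums_mult[OF poisson_sums_exp[of s "cos \<theta>"], of "cos (real_of_int k * \<theta>)"]
    by (simp add: sums_iff mult_ac)
  obtain I J where
    I: "\<And>n. ((\<lambda>\<theta>. \<Sum>i<n. ?t i \<theta>) has_integral I n) {-pi..pi}" and
    J0: "((\<lambda>\<theta>. \<Sum>i. ?t i \<theta>) has_integral J) {-pi..pi}" and "I \<longlonglongrightarrow> J"
    by (rule uniform_limit_integral[OF lim]) (auto intro!: continuous_intros)
  from J0[unfolded eq] have J: "J = 2 * pi * heat s k" by (simp only: heat_def integral_unique) simp
  have "((\<lambda>\<theta>. \<Sum>i<n. ?t i \<theta>) has_integral (\<Sum>i<n. exp (- s) * (s ^ i / fact i) * (2 * pi * srw i k))) {-pi..pi}" for n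
    by (intro has_integral_sum has_integral_mult_right has_integral_srw) auto
  from has_integral_unique[OF I this]
  have "I = (\<lambda>n. \<Sum>i<n. exp (- s) * (s ^ i / fact i) * (2 * pi * srw i k))" by blast
  with \<open>I \<longlonglongrightarrow> J\<close> J have "(\<lambda>i. exp (- s) * (s ^ i / fact i) * (2 * pi * srw i k)) sums (2 * pi * heat s k)"
    by (simp add: sums_def)
  from sums_divide[OF this, of "2 * pi"] show ?thesis by (simp add: mult.assoc)
qed

lemma heat_nonneg: "0 \<le> s \<Longrightarrow> 0 \<le> heat s k"
  by (rule sums_le[OF _ sums_zero heat_sums]) (auto simp: srw_nonneg)

lemma heat_0: "heat 0 k = (if k = 0 then 1 else 0)"
  using has_integral_srw[of k 0] by (simp add: heat_def integral_unique)

lemma has_derivative_heat: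
  "((\<lambda>s. heat s k) has_real_derivative (heat s (k + 1) + heat s (k - 1)) / 2 - heat s k) (at s)"
proof -
  let ?F = "\<lambda>j s \<theta>. cos (real_of_int j * \<theta>) * exp (- s * (1 - cos \<theta>))"
  let ?D = "\<lambda>s \<theta>. - (1 - cos \<theta>) * ?F k s \<theta>"
  have int: "?F j s integrable_on {-pi..pi}" for j s
    by (intro integrable_continuous_real continuous_intros)
  have "((\<lambda>s. integral (cbox (-pi) pi) (?F k s)) has_field_derivative integral (cbox (-pi) pi) (?D s)) (at s within UNIV)"
    by (rule leibniz_rule_field_derivative[where fx = ?D])
       (auto intro!: derivative_eq_intros continuous_intros integrable_continuous_real simp: case_prod_beta')
  then have "((\<lambda>s. heat s k) has_real_derivative integral {-pi..pi} (?D s) / (2 * pi)) (at s)"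
    unfolding heat_def by (intro DERIV_cdivide) simp
  moreover have "integral {-pi..pi} (?D s) = (integral {-pi..pi} (?F (k + 1) s) + integral {-pi..pi} (?F (k - 1) s)) / 2
      - integral {-pi..pi} (?F k s)"
  proof -
    have "?D s \<theta> = (?F (k + 1) s \<theta> + ?F (k - 1) s \<theta>) / 2 - ?F k s \<theta>" for \<theta>
    proof -
      have "cos (real_of_int (k + 1) * \<theta>) + cos (real_of_int (k - 1) * \<theta>) = 2 * cos \<theta> * cos (real_of_int k * \<theta>)"
        using cos_add_cos_shift[of \<theta> "real_of_int k"] by (simp add: mult.commute)
      then show ?thesis by (simp only: distrib_right[symmetric]) (simp add: algebra_simps)
    qed
    then have "integral {-pi..pi} (?D s) = integral {-pi..pi} (\<lambda>\<theta>. (?F (k + 1) s \<theta> + ?F (k - 1) s \<theta>) / 2 - ?F k s \<theta>)"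
      by presburger
    also have "\<dots> = integral {-pi..pi} (\<lambda>\<theta>. (?F (k + 1) s \<theta> + ?F (k - 1) s \<theta>) / 2) - integral {-pi..pi} (?F k s)"
      by (intro integral_diff int integrable_on_divide integrable_add)
    also have "integral {-pi..pi} (\<lambda>\<theta>. (?F (k + 1) s \<theta> + ?F (k - 1) s \<theta>) / 2)
      = (integral {-pi..pi} (?F (k + 1) s) + integral {-pi..pi} (?F (k - 1) s)) / 2"
      by (simp only: integral_divide integral_add[OF int int])
    finally show ?thesis .
  qed
  ultimately show ?thesis
    by (simp add: heat_def diff_divide_distrib add_divide_distrib)
qed

lemma continuous_on_heat [continuous_intros]:
  "continuous_on A f \<Longrightarrow> continuous_on A (\<lambda>x. heat (f x) k)"
  by (rule continuous_on_compose2[of UNIV "\<lambda>s. heat s k"])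
     (auto intro!: DERIV_continuous_on has_derivative_heat intro: has_field_derivative_at_within)

definition cyc_freq :: "nat \<Rightarrow> nat \<Rightarrow> real" where
  "cyc_freq m l = 2 * pi * real l / real m"

text \<open>
  The heat kernel of the cycle of length \<open>m\<close>, as a finite Fourier sum.  In this form the convergence to
  \<open>1 / m\<close> is visible, and the form as a sum over images is lemma \<open>has_sum_heat_periodization\<close>.
\<close>

definition cyc_heat :: "nat \<Rightarrow> real \<Rightarrow> int \<Rightarrow> real" where
  "cyc_heat m s z = (\<Sum>l<m. cos (cyc_freq m l * z) * exp (- s * (1 - cos (cyc_freq m l)))) / real m"

lemma sum_cos_cyc_freq:
  assumes m: "m > 0"
  shows "(\<Sum>l<m. cos (cyc_freq m l * real_of_int z)) = (if int m dvd z then real m else 0)"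
proof (cases "int m dvd z")
  case True
  then obtain q where q: "z = int m * q" by auto
  have "cos (cyc_freq m l * real_of_int z) = 1" for l
  proof -
    have "cyc_freq m l * real_of_int z = 2 * pi * real_of_int (int l * q)"
      using m by (simp add: cyc_freq_def q)
    then show ?thesis by (simp only: cos_int_2pin)
  qed
  then show ?thesis using True by simp
next
  case False
  define \<zeta> where "\<zeta> = cis (2 * pi * z / m)"
  have pow: "\<zeta> ^ l = cis (cyc_freq m l * z)" for l
    by (simp add: \<zeta>_def Complex.DeMoivre cyc_freq_def mult_ac)
  have "\<zeta> ^ m = 1"
    using m cis_multiple_2pi[of "real_of_int z"] by (simp add: \<zeta>_def Complex.DeMoivre)
  moreover have "\<zeta> \<noteq> 1"
  proof
    assume "\<zeta> = 1"
    then have "cos (2 * pi * z / m) = 1" by (simp add: \<zeta>_def complex_eq_iff)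
    then obtain n :: int where "2 * pi * z / m = n * 2 * pi" by (auto simp: cos_one_2pi_int)
    then have "real_of_int z = real_of_int (n * int m)" using m by (simp add: field_simps)
    then have "z = n * int m" by (simp only: of_int_eq_iff)
    then show False using False by simp
  qed
  ultimately have "(\<Sum>l<m. \<zeta> ^ l) = 0" by (simp add: sum_gp_strict)
  moreover have "(\<Sum>l<m. cos (cyc_freq m l * real_of_int z)) = Re (\<Sum>l<m. \<zeta> ^ l)"
    by (simp add: pow)
  ultimately show ?thesis using False by simp
qed

text \<open>
  Both sides satisfy the same recursion in \<open>n\<close>, and for \<open>n = 0\<close> the claim is the orthogonality of the
  characters.
\<close>

lemma has_sum_srw_periodization:
  assumes m: "m > 0"
  shows "((\<lambda>j. srw n (z + j * int m)) has_sum
    (\<Sum>l<m. cos (cyc_freq m l * real_of_int z) * cos (cyc_freq m l) ^ n) / real m) UNIV"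
proof (induction n arbitrary: z)
  case 0
  show ?case
  proof (cases "int m dvd z")
    case True
    then obtain q where q: "z = int m * q" by auto
    have "((\<lambda>j. srw 0 (z + j * int m)) has_sum (\<Sum>j\<in>{-q}. srw 0 (z + j * int m))) {-q}"
      by (rule has_sum_finite) simp
    then have "((\<lambda>j. srw 0 (z + j * int m)) has_sum (\<Sum>j\<in>{-q}. srw 0 (z + j * int m))) UNIV"
    proof (rule has_sum_cong_neutral[THEN iffD1, rotated -1])
      fix j assume "j \<in> UNIV - {-q}"
      then have "int m * (q + j) \<noteq> 0" using m by auto
      then show "srw 0 (z + j * int m) = 0" by (simp add: q algebra_simps)
    qed auto
    then show ?thesis using sum_cos_cyc_freq[OF m, of z] m True by (simp add: q)
  next
    case False
    have "srw 0 (z + j * int m) = 0" for j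
      using False by (auto simp: add_eq_0_iff2)
    then show ?thesis using sum_cos_cyc_freq[OF m, of z] False by simp
  qed
next
  case (Suc n)
  have "((\<lambda>j. (srw n ((z + 1) + j * int m) + srw n ((z - 1) + j * int m)) * (1 / 2)) has_sum
    ((\<Sum>l<m. cos (cyc_freq m l * real_of_int (z + 1)) * cos (cyc_freq m l) ^ n) / real m
    + (\<Sum>l<m. cos (cyc_freq m l * real_of_int (z - 1)) * cos (cyc_freq m l) ^ n) / real m) * (1 / 2)) UNIV"
    by (intro has_sum_cmult_left has_sum_add Suc.IH)
  also have "(\<lambda>j. (srw n ((z + 1) + j * int m) + srw n ((z - 1) + j * int m)) * (1 / 2)) = (\<lambda>j. srw (Suc n) (z + j * int m))"
    by (auto simp: add_ac diff_add_eq)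
  also have "((\<Sum>l<m. cos (cyc_freq m l * real_of_int (z + 1)) * cos (cyc_freq m l) ^ n) / real m
    + (\<Sum>l<m. cos (cyc_freq m l * real_of_int (z - 1)) * cos (cyc_freq m l) ^ n) / real m) * (1 / 2)
    = (\<Sum>l<m. (cos (cyc_freq m l * (real_of_int z + 1)) + cos (cyc_freq m l * (real_of_int z - 1)))
        * cos (cyc_freq m l) ^ n * (1 / 2)) / real m"
    by (simp add: sum.distrib distrib_right add_divide_distrib sum_divide_distrib mult.commute[of "real m"])
  also have "\<dots> = (\<Sum>l<m. cos (cyc_freq m l * real_of_int z) * cos (cyc_freq m l) ^ Suc n) / real m"
    unfolding cos_add_cos_shift by (simp add: mult_ac)
  finally show ?case .
qed

text \<open>
  Poisson summation: all terms are nonnegative, so that the sum over the images may be exchanged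
  with the Poissonization.
\<close>

lemma has_sum_heat_periodization:
  assumes m: "m > 0" and s: "s \<ge> 0"
  shows "((\<lambda>j. heat s (z + j * int m)) has_sum cyc_heat m s z) UNIV"
proof -
  let ?f = "\<lambda>(n, j). exp (- s) * (s ^ n / fact n) * srw n (z + j * int m)"
  let ?d = "\<lambda>n. (\<Sum>l<m. cos (cyc_freq m l * real_of_int z) * cos (cyc_freq m l) ^ n) / real m"
  let ?g = "\<lambda>n. exp (- s) * (s ^ n / fact n) * ?d n"
  have inner: "((\<lambda>j. ?f (n, j)) has_sum ?g n) UNIV" for n
    unfolding split_conv by (intro has_sum_cmult_right has_sum_srw_periodization m)
  have "?g sums cyc_heat m s z"
  proof -
    have "(\<lambda>n. (\<Sum>l<m. cos (cyc_freq m l * real_of_int z) * (exp (- s) * (s ^ n / fact n) * cos (cyc_freq m l) ^ n)) / real m)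
      sums cyc_heat m s z"
      unfolding cyc_heat_def by (intro sums_divide sums_sum sums_mult poisson_sums_exp)
    then show ?thesis by (simp add: sum_distrib_left mult_ac)
  qed
  moreover have gnn: "0 \<le> ?g n" for n
    by (rule has_sum_nonneg[OF inner]) (use s in \<open>auto simp: srw_nonneg\<close>)
  ultimately have g: "(?g has_sum cyc_heat m s z) UNIV"
    by (intro sums_nonneg_imp_has_sum)
  have "?f summable_on (UNIV \<times> UNIV)"
    by (rule summable_on_SigmaI[OF inner]) (use g s in \<open>auto simp: srw_nonneg has_sum_imp_summable\<close>)
  then have "(?f has_sum cyc_heat m s z) (UNIV \<times> UNIV)"
    using has_sum_SigmaI[OF inner g] by simp
  then have "((\<lambda>(j, n). ?f (n, j)) has_sum cyc_heat m s z) (UNIV \<times> UNIV)"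
    by (subst has_sum_swap) simp
  moreover have "((\<lambda>n. (\<lambda>(j, n). ?f (n, j)) (j, n)) has_sum heat s (z + j * int m)) UNIV" for j
    using sums_nonneg_imp_has_sum[OF heat_sums[OF s, of "z + j * int m"]] s by (simp add: srw_nonneg)
  ultimately show ?thesis by (rule has_sum_SigmaD)
qed

lemma cyc_heat_nonneg: "m > 0 \<Longrightarrow> s \<ge> 0 \<Longrightarrow> 0 \<le> cyc_heat m s z"
  by (rule has_sum_nonneg[OF has_sum_heat_periodization]) (auto simp: heat_nonneg)

lemma cyc_heat_le_one:
  assumes "m > 0" "s \<ge> 0" shows "cyc_heat m s z \<le> 1"
proof -
  have "(\<Sum>l<m. cos (cyc_freq m l * z) * exp (- s * (1 - cos (cyc_freq m l)))) \<le> (\<Sum>l<m. 1)"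
  proof (rule sum_mono)
    fix l
    have "cos (cyc_freq m l * z) * exp (- s * (1 - cos (cyc_freq m l))) \<le> 1 * exp (- s * (1 - cos (cyc_freq m l)))"
      by (intro mult_right_mono) auto
    also have "\<dots> \<le> 1" using assms by simp
    finally show "cos (cyc_freq m l * z) * exp (- s * (1 - cos (cyc_freq m l))) \<le> 1" .
  qed
  then show ?thesis using assms by (simp add: cyc_heat_def)
qed

lemma cyc_heat_0:
  assumes "m > 0" shows "cyc_heat m 0 z = (if int m dvd z then 1 else 0)"
  using sum_cos_cyc_freq[OF assms, of z] assms by (simp add: cyc_heat_def)

lemma cyc_heat_mod:
  assumes m: "m > 0" and "a mod int m = b mod int m"
  shows "cyc_heat m s a = cyc_heat m s b"
proof -
  from assms obtain q where q: "a = b + int m * q"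
    by (metis add.commute mod_eqE)
  have "cos (cyc_freq m l * a) = cos (cyc_freq m l * b)" for l
  proof -
    have "cyc_freq m l * a = cyc_freq m l * b + 2 * pi * real_of_int (int l * q)"
      using m by (simp add: cyc_freq_def q field_simps)
    then show ?thesis
      by (simp add: cos_add cos_int_2pin sin_int_2pin del: of_int_mult)
  qed
  then show ?thesis by (simp add: cyc_heat_def)
qed

lemma has_derivative_cyc_heat:
  "((\<lambda>s. cyc_heat m s z) has_real_derivative (cyc_heat m s (z + 1) + cyc_heat m s (z - 1)) / 2 - cyc_heat m s z) (at s)"
proof -
  let ?e = "\<lambda>l. exp (- s * (1 - cos (cyc_freq m l)))"
  have "((\<lambda>s. cyc_heat m s z) has_real_derivative
      (\<Sum>l<m. cos (cyc_freq m l * z) * (?e l * (- (1 - cos (cyc_freq m l))))) / real m) (at s)"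
    unfolding cyc_heat_def by (auto intro!: derivative_eq_intros sum.cong simp: sum_divide_distrib)
  also have "(\<Sum>l<m. cos (cyc_freq m l * z) * (?e l * (- (1 - cos (cyc_freq m l)))))
      = (\<Sum>l<m. (cos (cyc_freq m l * (real_of_int z + 1)) + cos (cyc_freq m l * (real_of_int z - 1))) * ?e l / 2
          - cos (cyc_freq m l * z) * ?e l)"
    unfolding cos_add_cos_shift by (simp add: algebra_simps)
  also have "\<dots> / real m = (cyc_heat m s (z + 1) + cyc_heat m s (z - 1)) / 2 - cyc_heat m s z"
    by (simp add: cyc_heat_def sum_subtractf sum.distrib distrib_right add_divide_distrib
        diff_divide_distrib sum_divide_distrib[symmetric])
  finally show ?thesis .
qed

lemma continuous_on_cyc_heat [continuous_intros]:
  "continuous_on A f \<Longrightarrow> continuous_on A (\<lambda>x. cyc_heat m (f x) z)"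
  by (rule continuous_on_compose2[of UNIV "\<lambda>s. cyc_heat m s z"])
     (auto intro!: DERIV_continuous_on has_derivative_cyc_heat intro: has_field_derivative_at_within)

lemma sum_inverse_squares_le: "(\<Sum>l\<in>{1..<m}. 1 / (real l)\<^sup>2) \<le> 2"
proof -
  have "(\<Sum>l\<in>{1..<Suc n}. 1 / (real l)\<^sup>2) \<le> 2 - 1 / real n" if "n > 0" for n
    using that
  proof (induction n rule: nat_induct_non_zero)
    case (Suc n)
    have "1 / (real (Suc n))\<^sup>2 \<le> 1 / real n - 1 / real (Suc n)"
    proof -
      have "1 / (real (Suc n))\<^sup>2 \<le> 1 / (real n * real (Suc n))"
        using Suc.hyps by (intro divide_left_mono) (auto simp: power2_eq_square)
      also have "\<dots> = 1 / real n - 1 / real (Suc n)" using Suc.hyps by (simp add: field_simps)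
      finally show ?thesis .
    qed
    with Suc.IH show ?case by (simp add: sum.atLeastLessThan_Suc)
  qed simp
  from this[of "m - 1"] show ?thesis
    by (cases "m \<le> 1") (auto intro: order_trans)
qed

text \<open>
  The frequency 0 contributes \<open>1 / m\<close>.  For the others \<open>exp (- u) \<le> 1 / u\<close> is already summable, with the
  frequencies \<open>l\<close> and \<open>m - l\<close> being equal in size.
\<close>

lemma cyc_heat_near_uniform:
  assumes m: "m > 0" and s: "s > 0"
  shows "\<bar>cyc_heat m s z - 1 / real m\<bar> \<le> real m / (2 * s)"
proof -
  let ?t = "\<lambda>l. cos (cyc_freq m l * z) * exp (- s * (1 - cos (cyc_freq m l)))"
  let ?c = "(real m)\<^sup>2 / (8 * s)"
  have bound: "exp (- s * (1 - cos (cyc_freq m l))) \<le> ?c / (real l)\<^sup>2"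
    if l: "l > 0" "2 * l \<le> m" for l
  proof -
    have "cyc_freq m l \<le> pi" using l m by (simp add: cyc_freq_def field_simps)
    then have "2 * (cyc_freq m l)\<^sup>2 / pi\<^sup>2 \<le> 1 - cos (cyc_freq m l)"
      by (intro one_minus_cos_ge) (simp add: cyc_freq_def)
    then have "8 * (real l)\<^sup>2 / (real m)\<^sup>2 \<le> 1 - cos (cyc_freq m l)"
      by (simp add: cyc_freq_def power_mult_distrib power_divide)
    then have u: "s * (8 * (real l)\<^sup>2 / (real m)\<^sup>2) \<le> s * (1 - cos (cyc_freq m l))"
      using s by (intro mult_left_mono) auto
    let ?u = "s * (8 * (real l)\<^sup>2 / (real m)\<^sup>2)"
    have "exp (- s * (1 - cos (cyc_freq m l))) \<le> exp (- ?u)" using u by simp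
    also have "\<dots> \<le> 1 / ?u"
      using mult_exp_minus_le[of ?u] s l m by (simp add: field_simps)
    also have "\<dots> = ?c / (real l)\<^sup>2" using s l m by (simp add: field_simps)
    finally show ?thesis .
  qed
  have tbound: "\<bar>?t l\<bar> \<le> ?c * (1 / (real l)\<^sup>2 + 1 / (real (m - l))\<^sup>2)" if l: "l \<in> {1..<m}" for l
  proof -
    have "\<bar>?t l\<bar> \<le> 1 * exp (- s * (1 - cos (cyc_freq m l)))"
      unfolding abs_mult by (intro mult_mono) auto
    also have "\<dots> \<le> ?c * (1 / (real l)\<^sup>2 + 1 / (real (m - l))\<^sup>2)"
    proof (cases "2 * l \<le> m")
      case True
      have "0 \<le> ?c / (real (m - l))\<^sup>2" using s by simp
      with bound[of l] True l show ?thesis by (simp add: distrib_left)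
    next
      case False
      have "cyc_freq m l = 2 * pi - cyc_freq m (m - l)"
        using l m by (simp add: cyc_freq_def field_simps of_nat_diff)
      then have "cos (cyc_freq m l) = cos (cyc_freq m (m - l))" by (simp add: cos_diff)
      moreover have "0 \<le> ?c / (real l)\<^sup>2" using s by simp
      moreover have "2 * (m - l) \<le> m" using False by linarith
      ultimately show ?thesis using bound[of "m - l"] l by (simp add: distrib_left)
    qed
    finally show ?thesis .
  qed
  have rev: "(\<Sum>l\<in>{1..<m}. 1 / (real (m - l))\<^sup>2) = (\<Sum>l\<in>{1..<m}. 1 / (real l)\<^sup>2)"
    by (rule sum.reindex_bij_witness[of _ "\<lambda>l. m - l" "\<lambda>l. m - l"]) auto
  have "{..<m} = insert 0 {1..<m}" using m by auto
  then have "cyc_heat m s z - 1 / real m = (\<Sum>l\<in>{1..<m}. ?t l) / real m"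
    using m by (simp add: cyc_heat_def cyc_freq_def add_divide_distrib)
  also have "\<bar>\<dots>\<bar> = \<bar>\<Sum>l\<in>{1..<m}. ?t l\<bar> / real m" by simp
  also have "\<dots> \<le> (\<Sum>l\<in>{1..<m}. ?c * (1 / (real l)\<^sup>2 + 1 / (real (m - l))\<^sup>2)) / real m"
    by (intro divide_right_mono order_trans[OF sum_abs] sum_mono tbound) auto
  also have "\<dots> = ?c * (2 * (\<Sum>l\<in>{1..<m}. 1 / (real l)\<^sup>2)) / real m"
    by (simp only: sum_distrib_left[symmetric] sum.distrib rev) simp
  also have "\<dots> \<le> ?c * (2 * 2) / real m"
    using s sum_inverse_squares_le[of m] by (intro divide_right_mono mult_left_mono) auto
  also have "\<dots> = real m / (2 * s)" using m s by (simp add: field_simps power2_eq_square)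
  finally show ?thesis .
qed

lemma abs_le_two_abs_add: "2 * \<bar>v\<bar> \<le> \<bar>w\<bar> \<Longrightarrow> \<bar>w\<bar> \<le> \<bar>2 * (v + w)\<bar>" for v w :: int
proof -
  assume "2 * \<bar>v\<bar> \<le> \<bar>w\<bar>"
  moreover have "\<bar>w\<bar> \<le> \<bar>v + w\<bar> + \<bar>v\<bar>" using abs_triangle_ineq4[of "v + w" v] by simp
  ultimately show ?thesis by (simp add: abs_mult)
qed

lemma has_sum_inverse_squares_int:
  "((\<lambda>j::int. 1 / sq j) has_sum pi\<^sup>2 / 6 + pi\<^sup>2 / 6) (- {0})"
proof -
  have base: "((\<lambda>n. 1 / (real (n + 1))\<^sup>2) has_sum pi\<^sup>2 / 6) UNIV"
    using sums_nonneg_imp_has_sum[OF inverse_squares_sums] by (simp add: add.commute)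
  have pos: "((\<lambda>j::int. 1 / sq j) has_sum pi\<^sup>2 / 6) {0<..}"
    by (rule has_sum_reindex_bij_witness[THEN iffD1, OF _ _ _ _ _ _ base,
          of "\<lambda>j. nat (j - 1)" "\<lambda>n. int n + 1"]) (auto simp: add.commute)
  have neg: "((\<lambda>j::int. 1 / sq j) has_sum pi\<^sup>2 / 6) {..<0}"
    by (rule has_sum_reindex_bij_witness[THEN iffD1, OF _ _ _ _ _ _ pos,
          of "\<lambda>j. - j" "\<lambda>j. - j"]) auto
  have "- {0::int} = {0<..} \<union> {..<0}" by auto
  then show ?thesis using has_sum_Un_disjoint[OF pos neg] by (simp add: disjoint_iff)
qed

text \<open>
  The image \<open>v + j m\<close> has distance at least \<open>\<bar>j\<bar> m / 2\<close> from 0, which makes the decay of the heat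
  kernel summable over \<open>j\<close>.
\<close>

lemma
  assumes m: "m > 0" and s: "s > 0" and v: "2 * \<bar>v\<bar> \<le> int m"
  shows heat_le_cyc_heat: "heat s v \<le> cyc_heat m s v"
    and cyc_heat_minus_heat_le: "cyc_heat m s v - heat s v \<le> 408 * sqrt s / (real m)\<^sup>2"
proof -
  have diff: "((\<lambda>j. heat s (v + j * int m)) has_sum (cyc_heat m s v - heat s v)) (- {0})"
    using has_sum_Diff[OF has_sum_heat_periodization[OF m, of s v] has_sum_finite[of "{0}"]] s
    by (simp add: Compl_eq_Diff_UNIV)
  show "heat s v \<le> cyc_heat m s v"
    using has_sum_nonneg[OF diff] s by (simp add: heat_nonneg)
  have "heat s (v + j * int m) \<le> 68 * sqrt s / (real m)\<^sup>2 * (1 / sq j)" if "j \<in> - {0}" for j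
  proof -
    let ?k = "v + j * int m"
    have "int m * 1 \<le> int m * \<bar>j\<bar>" using that by (intro mult_left_mono) auto
    then have "2 * \<bar>v\<bar> \<le> \<bar>j * int m\<bar>" using v by (simp add: abs_mult mult.commute)
    then have "\<bar>j * int m\<bar> \<le> \<bar>2 * ?k\<bar>" by (rule abs_le_two_abs_add)
    then have "real_of_int \<bar>j * int m\<bar> \<le> real_of_int \<bar>2 * ?k\<bar>" by (simp only: of_int_le_iff)
    then have "\<bar>real_of_int j * real m\<bar> \<le> \<bar>2 * real_of_int ?k\<bar>" by simp
    then have "(real_of_int j * real m)\<^sup>2 \<le> (2 * real_of_int ?k)\<^sup>2" by (rule abs_le_square_iff[THEN iffD1])
    then have k: "(real_of_int j * real m)\<^sup>2 \<le> 4 * sq ?k" by (simp only: power_mult_distrib) simp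
    have "heat s ?k * (real_of_int j * real m)\<^sup>2 \<le> heat s ?k * (4 * sq ?k)"
      using k s by (intro mult_left_mono heat_nonneg) auto
    also have "\<dots> \<le> 4 * (17 * sqrt s)"
      using abs_heat_mult_square_le[OF s, of ?k] s by (simp add: heat_nonneg)
    finally show ?thesis using that m by (simp add: field_simps power_mult_distrib)
  qed
  from has_sum_mono[OF diff has_sum_cmult_right[OF has_sum_inverse_squares_int] this]
  have "cyc_heat m s v - heat s v \<le> 68 * sqrt s / (real m)\<^sup>2 * (pi\<^sup>2 / 6 + pi\<^sup>2 / 6)" .
  also have "\<dots> \<le> 68 * sqrt s / (real m)\<^sup>2 * 6"
  proof -
    have "pi\<^sup>2 \<le> 4\<^sup>2" using pi_less_4 by (intro power_mono) auto
    then show ?thesis using s by (intro mult_left_mono) auto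
  qed
  finally show "cyc_heat m s v - heat s v \<le> 408 * sqrt s / (real m)\<^sup>2" by simp
qed

section \<open>Integrals over the time half-line\<close>

lemma einterval_0_infty: "einterval 0 \<infinity> = {0<..}"
  by (auto simp: einterval_iff)

lemma
  fixes f g :: "real \<Rightarrow> real"
  assumes g: "set_integrable lborel {0<..} g" and f: "continuous_on {0<..} f"
    and le: "\<And>s. s > 0 \<Longrightarrow> \<bar>f s\<bar> \<le> g s"
  shows set_integrable_dominated: "set_integrable lborel {0<..} f"
    and abs_set_integral_dominated: "\<bar>LBINT s:{0<..}. f s\<bar> \<le> (LBINT s:{0<..}. g s)"
proof -
  show f': "set_integrable lborel {0<..} f"
  proof (rule set_integrable_bound[OF g])
    show "set_borel_measurable lborel {0<..} f"
      unfolding set_borel_measurable_def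
      using borel_measurable_continuous_on_indicator[OF _ f] by simp
    show "AE x in lborel. x \<in> {0<..} \<longrightarrow> norm (f x) \<le> norm (g x)"
      using le by (intro AE_I2) (force intro: order_trans)
  qed
  have "\<bar>LBINT s:{0<..}. f s\<bar> \<le> (LBINT s:{0<..}. \<bar>f s\<bar>)"
    using set_integral_norm_bound[OF f'] by simp
  also have "\<dots> \<le> (LBINT s:{0<..}. g s)"
    using le by (intro set_integral_mono g set_integrable_abs f') auto
  finally show "\<bar>LBINT s:{0<..}. f s\<bar> \<le> (LBINT s:{0<..}. g s)" .
qed

lemma
  fixes f F :: "real \<Rightarrow> real"
  assumes deriv: "\<And>s. s > 0 \<Longrightarrow> (F has_real_derivative f s) (at s)"
    and nonneg: "\<And>s. s > 0 \<Longrightarrow> 0 \<le> f s" and cont: "continuous_on {0<..} f"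
    and lim: "(F \<longlongrightarrow> A) (at_right 0)" "(F \<longlongrightarrow> B) at_top"
  shows set_integrable_FTC_half_line: "set_integrable lborel {0<..} f"
    and set_integral_FTC_half_line: "(LBINT s:{0<..}. f s) = B - A"
proof -
  have isCont: "isCont f s" if "s > 0" for s
    using continuous_on_interior[OF cont, of s] that by (simp add: interior_open)
  have lim': "((F \<circ> real_of_ereal) \<longlongrightarrow> A) (at_right 0)" "((F \<circ> real_of_ereal) \<longlongrightarrow> B) (at_left \<infinity>)"
    using lim by (simp_all add: zero_ereal_def ereal_tendsto_simps1)
  note FTC = interval_integral_FTC_nonneg[OF _ _ _ _ lim', of f]
  show "set_integrable lborel {0<..} f"
    unfolding einterval_0_infty[symmetric] by (rule FTC(1)) (use deriv isCont nonneg in auto)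
  have "(LBINT s=0..\<infinity>. f s) = B - A"
    by (rule FTC(2)) (use deriv isCont nonneg in auto)
  then show "(LBINT s:{0<..}. f s) = B - A"
    by (simp add: interval_lebesgue_integral_def einterval_0_infty)
qed

text \<open>
  The following two functions dominate all error terms.  Their integrals are constant multiples of
  \<open>1 / M\<close>.
\<close>

lemma
  fixes M :: real
  assumes M: "M > 0"
  shows set_integrable_kernel1: "set_integrable lborel {0<..} (\<lambda>s. 1 / (sqrt s * (M\<^sup>2 + s)))"
    and set_integral_kernel1: "(LBINT s:{0<..}. 1 / (sqrt s * (M\<^sup>2 + s))) = pi / M"
proof -
  let ?F = "\<lambda>s. 2 / M * arctan (sqrt s / M)"
  have deriv: "(?F has_real_derivative 1 / (sqrt s * (M\<^sup>2 + s))) (at s)" if "s > 0" for s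
  proof -
    have "(?F has_real_derivative 2 / M * (inverse (1 + (sqrt s / M)\<^sup>2) * (inverse (sqrt s) / 2 / M))) (at s)"
      using that M by (auto intro!: derivative_eq_intros)
    moreover have "2 / M * (inverse (1 + (r / M)\<^sup>2) * (inverse r / 2 / M)) = 1 / (r * (M\<^sup>2 + r\<^sup>2))"
      if "r > 0" for r :: real
    proof -
      have "2 / M * (inverse (Q / M\<^sup>2) * (inverse r / 2 / M)) = 1 / (r * Q)" if "Q > 0" for Q
        using M that \<open>r > 0\<close> by (simp add: field_simps power2_eq_square)
      from this[of "M\<^sup>2 + r\<^sup>2"] show ?thesis
        using M by (simp add: add_pos_nonneg add_divide_distrib power_divide)
    qed
    from this[of "sqrt s"]
    have "2 / M * (inverse (1 + (sqrt s / M)\<^sup>2) * (inverse (sqrt s) / 2 / M)) = 1 / (sqrt s * (M\<^sup>2 + s))"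
      using that by simp
    ultimately show ?thesis by metis
  qed
  have 0: "(?F \<longlongrightarrow> 0) (at_right 0)"
    using M by (auto intro!: tendsto_eq_intros)
  have "filterlim (\<lambda>s. sqrt s / M) at_top at_top"
    using M by real_asymp
  then have "((\<lambda>s. arctan (sqrt s / M)) \<longlongrightarrow> pi / 2) at_top"
    by (rule filterlim_compose[OF tendsto_arctan_at_top])
  then have "(?F \<longlongrightarrow> 2 / M * (pi / 2)) at_top" by (intro tendsto_mult tendsto_const)
  then have inf: "(?F \<longlongrightarrow> pi / M) at_top" by simp
  have cont: "continuous_on {0<..} (\<lambda>s. 1 / (sqrt s * (M\<^sup>2 + s)))"
  proof (intro continuous_intros ballI)
    fix s :: real assume "s \<in> {0<..}"
    then have "0 < sqrt s * (M\<^sup>2 + s)" using M by (simp add: add_pos_pos)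
    then show "sqrt s * (M\<^sup>2 + s) \<noteq> 0" by (rule less_imp_neq[symmetric])
  qed
  note FTC = set_integrable_FTC_half_line[OF deriv _ cont 0 inf] set_integral_FTC_half_line[OF deriv _ cont 0 inf]
  show "set_integrable lborel {0<..} (\<lambda>s. 1 / (sqrt s * (M\<^sup>2 + s)))"
    "(LBINT s:{0<..}. 1 / (sqrt s * (M\<^sup>2 + s))) = pi / M"
    using FTC by simp_all
qed

lemma
  fixes M :: real
  assumes M: "M > 0"
  shows set_integrable_kernel2: "set_integrable lborel {0<..} (\<lambda>s. 1 / (s\<^sup>2 + M\<^sup>2))"
    and set_integral_kernel2: "(LBINT s:{0<..}. 1 / (s\<^sup>2 + M\<^sup>2)) = pi / (2 * M)"
proof -
  let ?F = "\<lambda>s. 1 / M * arctan (s / M)"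
  have deriv: "(?F has_real_derivative 1 / (s\<^sup>2 + M\<^sup>2)) (at s)" for s
  proof -
    have "(?F has_real_derivative 1 / M * (inverse (1 + (s / M)\<^sup>2) * (1 / M))) (at s)"
      using M by (auto intro!: derivative_eq_intros)
    also have "1 / M * (inverse (1 + (s / M)\<^sup>2) * (1 / M)) = 1 / (s\<^sup>2 + M\<^sup>2)"
      using M by (simp add: field_simps power2_eq_square)
    finally show ?thesis .
  qed
  have 0: "(?F \<longlongrightarrow> 0) (at_right 0)"
    using M by (auto intro!: tendsto_eq_intros)
  have "filterlim (\<lambda>s. s / M) at_top at_top"
    using M by real_asymp
  then have "((\<lambda>s. arctan (s / M)) \<longlongrightarrow> pi / 2) at_top"
    by (rule filterlim_compose[OF tendsto_arctan_at_top])
  then have "(?F \<longlongrightarrow> 1 / M * (pi / 2)) at_top" by (intro tendsto_mult tendsto_const)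
  then have inf: "(?F \<longlongrightarrow> pi / (2 * M)) at_top" by (simp add: mult.commute)
  have cont: "continuous_on {0<..} (\<lambda>s. 1 / (s\<^sup>2 + M\<^sup>2))"
    using M by (intro continuous_intros) (simp add: add_nonneg_eq_0_iff)
  note FTC = set_integrable_FTC_half_line[OF deriv _ cont 0 inf] set_integral_FTC_half_line[OF deriv _ cont 0 inf]
  show "set_integrable lborel {0<..} (\<lambda>s. 1 / (s\<^sup>2 + M\<^sup>2))" "(LBINT s:{0<..}. 1 / (s\<^sup>2 + M\<^sup>2)) = pi / (2 * M)"
    using FTC by simp_all
qed

lemma set_integrable_exp_minus:
  assumes "k > 0" shows "set_integrable lborel {0<..} (\<lambda>s. exp (- k * s) :: real)"
proof -
  have "((\<lambda>s. - exp (- k * s) / k) \<longlongrightarrow> - 1 / k) (at_right 0)"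
    using assms by (auto intro!: tendsto_eq_intros)
  moreover have "((\<lambda>s. - exp (- k * s) / k) \<longlongrightarrow> 0) at_top"
    using assms by real_asymp
  ultimately show ?thesis
    by (rule set_integrable_FTC_half_line[rotated 3])
       (use assms in \<open>auto intro!: derivative_eq_intros continuous_intros\<close>)
qed

text \<open>
  Integration by parts; for \<open>H' = A H\<close> it says that the Laplace transform of \<open>H\<close> solves the resolvent
  equation of \<open>A\<close> with right-hand side \<open>H 0\<close>.
\<close>

lemma laplace_of_derivative:
  fixes H H' :: "real \<Rightarrow> real"
  assumes k: "k > 0"
    and deriv: "\<And>s. (H has_real_derivative H' s) (at s)" and cont: "continuous_on UNIV H'"
    and bound: "\<And>s. s \<ge> 0 \<Longrightarrow> \<bar>H s\<bar> \<le> B" "\<And>s. s \<ge> 0 \<Longrightarrow> \<bar>H' s\<bar> \<le> B"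
  shows "(LBINT s:{0<..}. exp (- k * s) * (k * H s - H' s)) = H 0"
proof -
  let ?F = "\<lambda>s. - exp (- k * s) * H s"
  let ?f = "\<lambda>s. exp (- k * s) * (k * H s - H' s)"
  have contH: "continuous_on UNIV H"
    by (rule DERIV_continuous_on[where D = H']) (rule has_field_derivative_at_within[OF deriv])
  have contf: "continuous_on UNIV ?f"
    by (intro continuous_intros contH cont)
  have int: "set_integrable lborel {0<..} ?f"
  proof (rule set_integrable_dominated)
    show "set_integrable lborel {0<..} (\<lambda>s. (k * B + B) * exp (- k * s))"
      using set_integrable_exp_minus[OF k] by (intro set_integrable_mult_right) auto
    show "continuous_on {0<..} ?f" using contf by (rule continuous_on_subset) auto
    fix s :: real assume "s > 0"
    have "\<bar>k * H s - H' s\<bar> \<le> k * B + B"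
      using bound[of s] \<open>s > 0\<close> k by (intro order_trans[OF abs_triangle_ineq4] add_mono) (auto simp: abs_mult)
    then show "\<bar>?f s\<bar> \<le> (k * B + B) * exp (- k * s)" by (simp add: abs_mult mult.commute)
  qed
  have "(LBINT s=0..\<infinity>. ?f s) = 0 - (- H 0)"
  proof (rule interval_integral_FTC_integrable[where F = ?F])
    show "(?F has_vector_derivative ?f s) (at s)" for s
      unfolding has_real_derivative_iff_has_vector_derivative[symmetric]
    proof -
      have "((\<lambda>s. - exp (- k * s)) has_real_derivative k * exp (- k * s)) (at s)"
        by (auto intro!: derivative_eq_intros)
      from DERIV_mult[OF this deriv] show "(?F has_real_derivative ?f s) (at s)"
        by (simp add: algebra_simps)
    qed
    show "isCont ?f s" for s
      by (rule continuous_on_interior[OF contf]) simp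
    show "set_integrable lborel (einterval 0 \<infinity>) ?f" using int by (simp only: einterval_0_infty)
    have "(H \<longlongrightarrow> H 0) (at_right 0)"
      by (rule tendsto_within_subset[OF isContD[OF DERIV_isCont[OF deriv]]]) simp
    moreover have "((\<lambda>s. - exp (- k * s)) \<longlongrightarrow> - 1) (at_right 0)"
      by (auto intro!: tendsto_eq_intros)
    ultimately have "(?F \<longlongrightarrow> - 1 * H 0) (at_right 0)"
      by (rule tendsto_mult[rotated])
    then show "((?F \<circ> real_of_ereal) \<longlongrightarrow> - H 0) (at_right 0)"
      by (simp add: zero_ereal_def ereal_tendsto_simps1)
  next
    have "(?F \<longlongrightarrow> 0) at_top"
    proof (rule Lim_null_comparison)
      show "((\<lambda>s. B * exp (- k * s)) \<longlongrightarrow> 0) at_top"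
        using k by real_asymp
      show "\<forall>\<^sub>F s in at_top. norm (?F s) \<le> B * exp (- k * s)"
        using eventually_ge_at_top[of 0] by eventually_elim (use bound in \<open>auto simp: abs_mult mult.commute\<close>)
    qed
    then show "((?F \<circ> real_of_ereal) \<longlongrightarrow> 0) (at_left \<infinity>)"
      by (simp add: ereal_tendsto_simps1)
  qed simp
  then show ?thesis by (simp add: interval_lebesgue_integral_def einterval_0_infty)
qed

section \<open>The Bessel function\<close>

lemma cosh_ge_self: "r \<le> cosh r" if "0 \<le> r" for r :: real
proof -
  have "1 + r + r\<^sup>2 / 2 \<le> exp r" using exp_lower_Taylor_quadratic[OF that] by simp
  moreover have "1 - r \<le> exp (- r)" using exp_ge_add_one_self[of "- r"] by simp
  moreover have "0 \<le> (1 - r / 2)\<^sup>2" by simp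
  ultimately show ?thesis by (simp add: cosh_def power2_eq_square algebra_simps)
qed

lemma set_integrable_K0:
  fixes t :: real
  assumes t: "t > 0" shows "set_integrable lborel {0<..} (\<lambda>r::real. exp (- t * cosh r))"
proof (rule set_integrable_dominated[OF set_integrable_exp_minus[OF t]])
  fix r :: real assume "r > 0"
  then show "\<bar>exp (- t * cosh r)\<bar> \<le> exp (- t * r)" using cosh_ge_self[of r] t by simp
qed (intro continuous_intros)

lemma K0_eq: "K0 t = (LBINT r:{0<..}. exp (- t * cosh r))"
  unfolding K0_def
  by (rule set_integral_discrete_difference[of "{0}"]) auto

lemma K0_antimono:
  assumes "0 < s" "s \<le> t" shows "K0 t \<le> K0 s"
  unfolding K0_eq using assms
  by (intro set_integral_mono set_integrable_K0) (auto intro!: mult_right_mono)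

lemma K0_ge:
  assumes t: "t > 0" and R: "R \<ge> 0" shows "R * exp (- t * cosh R) \<le> K0 t"
proof -
  have K: "integrable lborel (\<lambda>r. indicator {0<..} r * exp (- t * cosh r))"
    using set_integrable_K0[OF t] by (simp add: set_integrable_def)
  have c: "integrable lborel (\<lambda>r. indicator {0<..R} r * exp (- t * cosh R))"
    using R by (intro integrable_mult_left integrable_real_indicator) auto
  have "(\<integral>r. indicator {0<..R} r * exp (- t * cosh R) \<partial>lborel) \<le> (\<integral>r. indicator {0<..} r * exp (- t * cosh r) \<partial>lborel)"
    using t by (intro integral_mono c K) (auto simp: indicator_def cosh_real_nonneg_le_iff)
  then show ?thesis using R by (simp add: K0_eq set_lebesgue_integral_def)
qed

lemma K0_pos: "t > 0 \<Longrightarrow> 0 < K0 t"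
  using K0_ge[of t 1] by (simp add: less_le_trans[rotated])

text \<open>
  The choice of \<open>\<delta>\<close> makes the exponential at least \<open>exp (- 1)\<close> on an interval of length \<open>A exp 1\<close>.
\<close>

lemma K0_tendsto_infinity:
  assumes "A > 0" obtains \<delta> where "\<delta> > 0" "\<And>t. 0 < t \<Longrightarrow> t \<le> \<delta> \<Longrightarrow> A \<le> K0 t"
proof
  let ?R = "A * exp 1"
  have R: "?R > 0" using assms by simp
  have c: "cosh ?R > 0" by (rule cosh_real_pos)
  then show "1 / cosh ?R > 0" by simp
  fix t :: real assume t: "0 < t" "t \<le> 1 / cosh ?R"
  then have "t * cosh ?R \<le> 1" using c by (simp add: field_simps)
  then have "exp (- 1) \<le> exp (- t * cosh ?R)" by simp
  then have "?R * exp (- 1) \<le> ?R * exp (- t * cosh ?R)" using R by (intro mult_left_mono) auto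
  also have "\<dots> \<le> K0 t" using t R by (intro K0_ge) auto
  also have "?R * exp (- 1) = A" by (simp add: exp_minus)
  finally show "A \<le> K0 t" .
qed

text \<open>
  A shift of \<open>r\<close> by \<open>ln (2 sqrt 6)\<close> increases \<open>cosh r\<close> at least by the factor \<open>sqrt 6\<close>, since
  \<open>exp r / 2 \<le> cosh r \<le> exp r\<close>.  The part of the integral below this value is at most its length.
\<close>

lemma K0_le_scaled:
  assumes t: "t > 0" shows "K0 t \<le> ln (2 * sqrt 6) + K0 (sqrt 6 * t)"
proof -
  let ?a = "ln (2 * sqrt 6)"
  have "1 \<le> sqrt 6" by (rule real_le_rsqrt) simp
  then have a: "?a \<ge> 0" by (intro ln_ge_zero) linarith
  let ?F = "\<lambda>c r. indicator {0<..} r * exp (- c * cosh r) :: real"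
  have int: "integrable lborel (?F c)" if "c > 0" for c
    using set_integrable_K0[OF that] by (simp add: set_integrable_def)
  have K0F: "K0 c = (\<integral>r. ?F c r \<partial>lborel)" for c
    by (simp add: K0_eq set_lebesgue_integral_def)
  have int': "integrable lborel (\<lambda>r. ?F (sqrt 6 * t) (- ?a + 1 * r))"
    using t by (intro lborel_integrable_real_affine int) auto
  have "K0 t \<le> (\<integral>r. indicator {0<..?a} r + ?F (sqrt 6 * t) (- ?a + 1 * r) \<partial>lborel)"
    unfolding K0F
  proof (rule integral_mono)
    show "integrable lborel (\<lambda>r. indicator {0<..?a} r + ?F (sqrt 6 * t) (- ?a + 1 * r))"
      using int' a by (intro Bochner_Integration.integrable_add integrable_real_indicator) auto
    fix r :: real
    consider "r \<le> 0" | "0 < r" "r \<le> ?a" | "?a < r" by linarith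
    then show "?F t r \<le> indicator {0<..?a} r + ?F (sqrt 6 * t) (- ?a + 1 * r)"
    proof cases
      case 2
      then show ?thesis using t by (auto simp: indicator_def)
    next
      case 3
      have "sqrt 6 * cosh (r - ?a) \<le> sqrt 6 * exp (r - ?a)"
        using 3 by (intro mult_left_mono) (auto simp: cosh_def)
      also have "\<dots> = exp r / 2" by (simp add: exp_diff)
      also have "\<dots> \<le> cosh r" by (simp add: cosh_def)
      finally have "t * (sqrt 6 * cosh (r - ?a)) \<le> t * cosh r" using t by (intro mult_left_mono) auto
      then show ?thesis using 3 a by (auto simp: indicator_def mult_ac)
    qed (auto simp: indicator_def)
  qed (use int t in auto)
  also have "\<dots> = ?a + (\<integral>r. ?F (sqrt 6 * t) (- ?a + 1 * r) \<partial>lborel)"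
    using int' a by (subst Bochner_Integration.integral_add) auto
  also have "(\<integral>r. ?F (sqrt 6 * t) (- ?a + 1 * r) \<partial>lborel) = K0 (sqrt 6 * t)"
    unfolding K0F using lborel_integral_real_affine[of 1 "?F (sqrt 6 * t)" "- ?a"] by simp
  finally show ?thesis .
qed

text \<open>Substituting \<open>s = M exp r / sqrt (2 k)\<close> makes the exponent a multiple of \<open>cosh r\<close>.\<close>

lemma
  assumes k: "k > 0" and M: "M > 0"
  defines "f \<equiv> \<lambda>s. exp (- k * s) * (exp (- M\<^sup>2 / (2 * s)) / (2 * pi * s))"
  shows set_integrable_bessel: "set_integrable lborel {0<..} f"
    and set_integral_bessel: "(LBINT s:{0<..}. f s) = K0 (sqrt (2 * k) * M) / pi"
proof -
  define \<tau> where "\<tau> = sqrt (2 * k) * M"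
  define c where "c = M / sqrt (2 * k)"
  have pos: "\<tau> > 0" "c > 0" using k M by (simp_all add: \<tau>_def c_def)
  have kc: "k * c = \<tau> / 2"
    using k by (simp add: c_def \<tau>_def real_sqrt_mult field_simps)
  have Mc: "M\<^sup>2 / (2 * c) = \<tau> / 2"
    using k M by (simp add: c_def \<tau>_def real_sqrt_mult power2_eq_square field_simps)
  have fg: "f (c * exp r) * (c * exp r) = exp (- \<tau> * cosh r) / (2 * pi)" for r
  proof -
    have "- k * (c * exp r) + - M\<^sup>2 / (2 * (c * exp r)) = - (k * c) * exp r - (M\<^sup>2 / (2 * c)) * exp (- r)"
      using pos by (simp add: exp_minus field_simps)
    also have "\<dots> = - \<tau> * cosh r" unfolding kc Mc by (simp add: cosh_def field_simps)
    finally show ?thesis using pos by (simp add: f_def exp_add[symmetric])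
  qed
  have "has_bochner_integral lborel (\<lambda>r. indicator {0..} r *\<^sub>R (exp (- \<tau> * cosh r) / (2 * pi))) (K0 \<tau> / (2 * pi))"
  proof -
    have "set_integrable lborel {0..} (\<lambda>r. exp (- \<tau> * cosh r))"
      using set_integrable_K0[OF pos(1)]
      by (subst set_integrable_discrete_difference[of "{0}" _ "{0<..}"]) auto
    then have "has_bochner_integral lborel (\<lambda>r. indicator {0..} r *\<^sub>R exp (- \<tau> * cosh r)) (K0 \<tau>)"
      unfolding K0_def set_integrable_def set_lebesgue_integral_def by (rule has_bochner_integral_integrable)
    from has_bochner_integral_divide[OF this, of "2 * pi"] show ?thesis by simp
  qed
  from has_bochner_integral_even_function[OF this]
  have even: "has_bochner_integral lborel (\<lambda>r. exp (- \<tau> * cosh r) / (2 * pi)) (K0 \<tau> / pi)"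
    by simp
  have UNIV: "einterval (-\<infinity>) \<infinity> = UNIV" by (auto simp: einterval_iff)
  have A: "((ereal \<circ> (\<lambda>r. c * exp r) \<circ> real_of_ereal) \<longlongrightarrow> 0) (at_right (-\<infinity>))"
  proof -
    have "((\<lambda>r. c * exp r) \<longlongrightarrow> c * 0) at_bot"
      by (intro tendsto_mult tendsto_const exp_at_bot)
    then show ?thesis by (simp add: ereal_tendsto_simps zero_ereal_def)
  qed
  have B: "((ereal \<circ> (\<lambda>r. c * exp r) \<circ> real_of_ereal) \<longlongrightarrow> \<infinity>) (at_left \<infinity>)"
  proof -
    have "filterlim (\<lambda>r. c * exp r) at_top at_top"
      using pos by real_asymp
    then show ?thesis by (simp add: ereal_tendsto_simps)
  qed
  note subst = interval_integral_substitution_nonneg[where f = f and g = "\<lambda>r. c * exp r" and g' = "\<lambda>r. c * exp r"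
      and a = "-\<infinity>" and b = \<infinity> and A = 0 and B = \<infinity>]
  have cont: "isCont f (c * exp r)" for r
    unfolding f_def using pos by (intro continuous_intros) auto
  have deriv: "((\<lambda>r. c * exp r) has_real_derivative c * exp r) (at r)" for r
    by (auto intro!: derivative_eq_intros)
  have nonneg: "0 \<le> f (c * exp r)" for r using pos by (simp add: f_def)
  have int: "set_integrable lborel (einterval (-\<infinity>) \<infinity>) (\<lambda>r. f (c * exp r) * (c * exp r))"
    unfolding UNIV fg set_integrable_def using even by (simp add: has_bochner_integral_iff)
  have cont': "isCont (\<lambda>r. c * exp r) r" for r by (intro continuous_intros)
  show "set_integrable lborel {0<..} f"
    unfolding einterval_0_infty[symmetric]
    by (rule subst(1)) (use deriv cont cont' nonneg int A B pos in \<open>auto\<close>)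
  have "(LBINT s=0..\<infinity>. f s) = (LBINT r=-\<infinity>..\<infinity>. f (c * exp r) * (c * exp r))"
    by (rule subst(2)) (use deriv cont cont' nonneg int A B pos in \<open>auto\<close>)
  also have "\<dots> = K0 \<tau> / pi"
    unfolding fg interval_lebesgue_integral_def UNIV using even
    by (simp add: set_lebesgue_integral_def has_bochner_integral_iff)
  finally show "(LBINT s:{0<..}. f s) = K0 (sqrt (2 * k) * M) / pi"
    by (simp add: interval_lebesgue_integral_def einterval_0_infty \<tau>_def)
qed

section \<open>Comparison of the kernels\<close>

lemma
  assumes s: "s > 0"
  shows heat_nonneg_of_pos [simp]: "0 \<le> heat s k"
    and heat_mult_sqrt_le: "heat s k * sqrt s \<le> 1"
    and heat_mult_square_le: "heat s k * sq k \<le> 17 * sqrt s"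
proof -
  show nn: "0 \<le> heat s k" using s by (intro heat_nonneg) simp
  show "heat s k * sqrt s \<le> 1" "heat s k * sq k \<le> 17 * sqrt s"
    using abs_heat_le_sqrt[OF s, of k] abs_heat_mult_square_le[OF s, of k] nn s by (simp_all add: field_simps)
qed

text \<open>
  For the decay in space, one factor is bounded by \<open>17 sqrt s / k^2\<close> and the other by \<open>1 / sqrt s\<close>.
\<close>

lemma
  assumes s: "s > 0"
  shows heat2_nonneg: "0 \<le> heat s a * heat s b"
    and heat2_mult_time_le: "heat s a * heat s b * s \<le> 1"
    and heat2_mult_square_le: "heat s a * heat s b * (sq a + sq b) \<le> 34"
proof -
  note nn = heat_nonneg_of_pos[OF s] and r = heat_mult_sqrt_le[OF s] and q = heat_mult_square_le[OF s]
  show "0 \<le> heat s a * heat s b" using nn by simp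
  have "(heat s a * sqrt s) * (heat s b * sqrt s) \<le> 1 * 1"
    using nn r s by (intro mult_mono) auto
  moreover have "(heat s a * sqrt s) * (heat s b * sqrt s) = heat s a * heat s b * (sqrt s * sqrt s)"
    by (simp only: mult_ac)
  ultimately show "heat s a * heat s b * s \<le> 1" using s by simp
  have *: "heat s k * heat s l * sq k \<le> 17" for k l
  proof -
    have "heat s k * heat s l * sq k = heat s k * sq k * heat s l" by simp
    also have "\<dots> \<le> 17 * sqrt s * heat s l" using q nn by (intro mult_right_mono) auto
    also have "\<dots> \<le> 17" using r[of l] by (simp add: mult.commute)
    finally show ?thesis .
  qed
  show "heat s a * heat s b * (sq a + sq b) \<le> 34"
    using *[of a b] *[of b a] by (simp add: algebra_simps)
qed

lemma heat3_le:
  assumes s: "s > 0" and Q: "Q > 0" "Q \<le> sq a + sq b + sq c + 1"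
  shows "heat s a * heat s b * heat s c \<le> 53 / (sqrt s * (Q + s))"
proof -
  note nn = heat_nonneg_of_pos[OF s] and r = heat_mult_sqrt_le[OF s] and q = heat_mult_square_le[OF s]
  let ?h = "heat s a * heat s b * heat s c"
  have 1: "heat s i * heat s j * s \<le> 1" for i j by (rule heat2_mult_time_le[OF s])
  have *: "heat s i * heat s j * heat s k * sqrt s * sq k \<le> 17" for i j k
  proof -
    have "heat s i * heat s j * heat s k * sqrt s * sq k
        = heat s i * heat s j * sqrt s * (heat s k * sq k)" by simp
    also have "\<dots> \<le> heat s i * heat s j * sqrt s * (17 * sqrt s)"
      using q nn s by (intro mult_left_mono) auto
    also have "\<dots> = 17 * (heat s i * heat s j * (sqrt s * sqrt s))" by (simp only: mult_ac)
    also have "\<dots> \<le> 17" using 1[of i j] s by simp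
    finally show ?thesis .
  qed
  have "?h * sqrt s * 1 \<le> 1"
  proof -
    have "heat s b * heat s c * (heat s a * sqrt s) \<le> 1 * 1 * 1"
      using r[of a] nn s abs_heat_le_one[of s b] abs_heat_le_one[of s c] by (intro mult_mono) auto
    then show ?thesis by (simp add: mult_ac)
  qed
  moreover have "?h * sqrt s * s \<le> 1"
  proof -
    have "(heat s a * heat s b * s) * (heat s c * sqrt s) \<le> 1 * 1"
      using 1 r nn s by (intro mult_mono) auto
    then show ?thesis by (simp add: mult_ac)
  qed
  moreover have "?h * sqrt s * sq a \<le> 17" "?h * sqrt s * sq b \<le> 17"
    "?h * sqrt s * sq c \<le> 17"
    using *[of b c a] *[of a c b] *[of a b c] by (simp_all add: mult_ac)
  moreover have "?h * sqrt s * (Q + s) \<le> ?h * sqrt s * (sq a + sq b + sq c + 1 + s)"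
    using Q nn s by (intro mult_left_mono) auto
  ultimately have "?h * sqrt s * (Q + s) \<le> 53"
    by (simp only: distrib_left)
  then have "?h * (sqrt s * (Q + s)) \<le> 53" by (simp only: mult.assoc)
  moreover have "0 < sqrt s * (Q + s)" using s Q by simp
  ultimately show ?thesis by (simp only: pos_le_divide_eq)
qed

text \<open>
  The centred Gaussian density in the plane with variance \<open>s\<close>, as a function of the squared distance.
\<close>

definition gauss2 :: "real \<Rightarrow> real \<Rightarrow> real" where
  "gauss2 s u = exp (- u / (2 * s)) / (2 * pi * s)"

lemma
  assumes s: "s > 0" and u: "u \<ge> 0"
  shows gauss2_nonneg: "0 \<le> gauss2 s u"
    and gauss2_mult_time_le: "gauss2 s u * s \<le> 1"
    and gauss2_mult_le: "gauss2 s u * u \<le> 1"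
proof -
  show "0 \<le> gauss2 s u" using s by (simp add: gauss2_def)
  have "exp (- u / (2 * s)) \<le> 1" "1 \<le> 2 * pi" using s u pi_ge_two by auto
  then have "exp (- u / (2 * s)) \<le> 2 * pi" by linarith
  then show "gauss2 s u * s \<le> 1" using s by (simp add: gauss2_def field_simps)
  have "gauss2 s u * u = (u / (2 * s)) * exp (- (u / (2 * s))) / pi"
    using s by (simp add: gauss2_def mult_ac)
  also have "\<dots> \<le> 1 / pi" by (intro divide_right_mono mult_exp_minus_le) auto
  also have "\<dots> \<le> 1" using pi_ge_two by simp
  finally show "gauss2 s u * u \<le> 1" .
qed

lemma heat2_gauss2_diff:
  assumes s: "s > 0"
  shows "\<bar>heat s a * heat s b - gauss2 s (sq a + sq b)\<bar> * s\<^sup>2 \<le> 44"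
proof -
  let ?\<phi> = "\<lambda>k::int. gauss s (real_of_int k)"
  have "gauss2 s (sq a + sq b) = ?\<phi> a * ?\<phi> b"
    using s by (simp add: gauss2_def gauss_def exp_add[symmetric] add_divide_distrib diff_divide_distrib)
  then have "heat s a * heat s b - gauss2 s (sq a + sq b)
      = heat s a * (heat s b - ?\<phi> b) + ?\<phi> b * (heat s a - ?\<phi> a)"
    by (simp add: algebra_simps)
  then have "\<bar>heat s a * heat s b - gauss2 s (sq a + sq b)\<bar>
      \<le> \<bar>heat s a\<bar> * \<bar>heat s b - ?\<phi> b\<bar> + \<bar>?\<phi> b\<bar> * \<bar>heat s a - ?\<phi> a\<bar>"
    using abs_triangle_ineq by (simp add: abs_mult[symmetric])
  also have "\<dots> \<le> 1 / sqrt s * (22 / (s * sqrt s)) + 1 / sqrt s * (22 / (s * sqrt s))"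
  proof (intro add_mono mult_mono)
    have "exp (- sq b / (2 * s)) \<le> 1" using s by simp
    moreover have "sqrt s \<le> sqrt (2 * pi * s)"
      using s pi_ge_two by (intro real_sqrt_le_mono) (simp add: mult_le_cancel_right1)
    ultimately show "\<bar>?\<phi> b\<bar> \<le> 1 / sqrt s"
      unfolding gauss_def using s by (auto simp: abs_div intro!: frac_le)
  qed (use s abs_heat_le_sqrt heat_gauss_diff_le in auto)
  also have "\<dots> = 44 / s\<^sup>2" using s by (simp add: field_simps power2_eq_square)
  finally show ?thesis using s by (simp add: field_simps)
qed

text \<open>
  For \<open>s \<le> m^2\<close> the images of \<open>v\<close> are hardly seen, and both terms are small by themselves.  For
  \<open>s \<ge> m^2\<close> the vertical coordinate is equidistributed, so that three errors remain: \<open>c - p\<close> against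
  \<open>1 / m\<close>, the product of heat kernels against the Gaussian density, and, if \<open>\<bar>y\<bar> < m\<close>, the Gaussian
  density at distance \<open>\<bar>y\<bar>\<close> against distance \<open>m\<close>.
\<close>

lemma kernel_comparison:
  fixes a b v :: int and m :: nat and M s :: real
  assumes m: "m > 0" and s: "s > 0" and v: "2 * \<bar>v\<bar> \<le> int m"
    and M: "M\<^sup>2 = max (sq a + sq b) ((real m)\<^sup>2)"
  shows "\<bar>heat s a * heat s b * (cyc_heat m s v - heat s v) - gauss2 s (M\<^sup>2) / real m\<bar>
    \<le> 14700 * (1 / (sqrt s * (M\<^sup>2 + s)) + 1 / (s\<^sup>2 + M\<^sup>2))"
proof -
  define Y where "Y = sq a + sq b"
  define P where "P = heat s a * heat s b"
  define E where "E = cyc_heat m s v - heat s v"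
  define Q where "Q = M\<^sup>2"
  define n where "n = real m"
  have n: "n \<ge> 1" using m by (simp add: n_def)
  have Q: "Q = max Y (n\<^sup>2)" "Y \<ge> 0" using M by (simp_all add: Q_def Y_def n_def)
  then have Q1: "Q \<ge> n\<^sup>2" "Q \<le> Y + n\<^sup>2" "Q > 0" using n by (auto simp: max_def intro: less_le_trans[of 0 "n\<^sup>2"])
  have P: "0 \<le> P" "P * s \<le> 1" "P * Y \<le> 34"
    unfolding P_def Y_def by (rule heat2_nonneg[OF s] heat2_mult_time_le[OF s] heat2_mult_square_le[OF s])+
  have E: "0 \<le> E" "E \<le> 408 * sqrt s / n\<^sup>2"
    using heat_le_cyc_heat[OF m s v] cyc_heat_minus_heat_le[OF m s v] by (simp_all add: E_def n_def)
  have rs: "sqrt s > 0" "sqrt s * sqrt s = s" using s by auto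
  note g = gauss2_nonneg[OF s] gauss2_mult_time_le[OF s] gauss2_mult_le[OF s]
  have K1: "0 < sqrt s * (Q + s)" and K2: "0 < s\<^sup>2 + Q" using s Q1 rs by (auto intro!: mult_pos_pos add_pos_pos)
  have "\<bar>P * E - gauss2 s Q / n\<bar> \<le> 14700 * (1 / (sqrt s * (Q + s)) + 1 / (s\<^sup>2 + Q))"
  proof (cases "s \<le> n\<^sup>2")
    case True
    then have rn: "sqrt s \<le> n" using n by (intro real_le_lsqrt) auto
    have "P * E * (sqrt s * (Q + s)) \<le> P * (408 * sqrt s / n\<^sup>2) * (sqrt s * (Y + n\<^sup>2 + n\<^sup>2))"
      using P E Q Q1 s True rs by (intro mult_mono) (auto intro!: mult_nonneg_nonneg)
    also have "\<dots> = 408 * (sqrt s * sqrt s) * (P * Y / n\<^sup>2 + 2 * P * (n\<^sup>2 / n\<^sup>2))"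
      by (simp only: distrib_left add_divide_distrib divide_inverse mult_2 distrib_right mult_ac add.assoc)
    also have "\<dots> = 408 * (P * Y * (s / n\<^sup>2) + 2 * (P * s))"
      using rs n by (simp add: algebra_simps)
    also have "\<dots> \<le> 408 * (34 * 1 + 2 * 1)"
      using P s True n Q by (intro mult_left_mono add_mono mult_mono) auto
    finally have 1: "P * E * (sqrt s * (Q + s)) \<le> 14688" by simp
    have "gauss2 s Q / n * (sqrt s * (Q + s)) = (sqrt s / n) * (gauss2 s Q * Q + gauss2 s Q * s)"
      by (simp add: algebra_simps)
    also have "\<dots> \<le> 1 * (1 + 1)"
      using rn n g[of Q] Q1 s by (intro mult_mono add_mono) auto
    finally have 2: "gauss2 s Q / n * (sqrt s * (Q + s)) \<le> 2" by simp
    have "0 \<le> P * E" "0 \<le> gauss2 s Q / n" using P E g[of Q] Q1 n by auto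
    then have "\<bar>P * E - gauss2 s Q / n\<bar> \<le> P * E + gauss2 s Q / n" by linarith
    then have "\<bar>P * E - gauss2 s Q / n\<bar> * (sqrt s * (Q + s)) \<le> (P * E + gauss2 s Q / n) * (sqrt s * (Q + s))"
      using K1 by (intro mult_right_mono) auto
    also have "\<dots> \<le> 14700" using 1 2 by (simp add: distrib_right)
    finally have "\<bar>P * E - gauss2 s Q / n\<bar> \<le> 14700 * (1 / (sqrt s * (Q + s)))"
      using K1 by (simp add: field_simps)
    moreover have "0 \<le> 14700 * (1 / (s\<^sup>2 + Q))" using K2 by simp
    ultimately show ?thesis by (simp only: distrib_left)
  next
    case False
    then have ns: "n\<^sup>2 \<le> s" by simp
    then have rn: "n \<le> sqrt s" using n by (intro real_le_rsqrt) auto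
    have s1: "1 \<le> s" using ns n by (smt (verit) one_le_power)
    then have ss: "s \<le> s\<^sup>2" by (simp add: power2_eq_square)
    let ?D1 = "P * (E - 1 / n)" and ?D2 = "(P - gauss2 s Y) / n" and ?D3 = "(gauss2 s Y - gauss2 s Q) / n"
    have D1: "\<bar>?D1\<bar> * (sqrt s * (Q + s)) \<le> 72"
    proof -
      have "\<bar>E - 1 / n\<bar> \<le> \<bar>cyc_heat m s v - 1 / n\<bar> + \<bar>heat s v\<bar>" by (simp add: E_def)
      also have "\<dots> \<le> n / (2 * s) + 1 / sqrt s"
        using cyc_heat_near_uniform[OF m s, of v] abs_heat_le_sqrt[OF s, of v] by (simp add: n_def)
      also have "n / (2 * s) \<le> sqrt s / s" using rn s n by (intro frac_le) auto
      also have "sqrt s / s = 1 / sqrt s" using rs s by (simp add: field_simps)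
      finally have "\<bar>E - 1 / n\<bar> * sqrt s \<le> 2" using rs by (simp add: field_simps)
      have "\<bar>?D1\<bar> * (sqrt s * (Q + s)) = (\<bar>E - 1 / n\<bar> * sqrt s) * (P * (Q + s))"
        using P by (simp add: abs_mult)
      also have "\<dots> \<le> 2 * (P * (Y + s + s))"
        using P Q Q1 ns s \<open>_ \<le> 2\<close> rs by (intro mult_mono) auto
      also have "\<dots> \<le> 72" using P by (simp add: distrib_left)
      finally show ?thesis .
    qed
    have D2: "\<bar>?D2\<bar> * (s\<^sup>2 + Q) \<le> 123"
    proof -
      let ?d = "\<bar>P - gauss2 s Y\<bar>"
      have d1: "?d * s\<^sup>2 \<le> 44" unfolding P_def Y_def by (rule heat2_gauss2_diff[OF s])
      have "?d * Y \<le> (P + gauss2 s Y) * Y"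
        using P g[of Y] Q by (intro mult_right_mono) auto
      then have d2: "?d * Y \<le> 35" using P g[of Y] Q by (simp add: distrib_right)
      have "\<bar>?D2\<bar> * (s\<^sup>2 + Q) = ?d / n * (s\<^sup>2 + Q)" using n by simp
      also have "\<dots> \<le> ?d / 1 * (s\<^sup>2 + (Y + s\<^sup>2))"
        using n s ns ss Q Q1 by (intro mult_mono frac_le) auto
      also have "\<dots> \<le> 123" using d1 d2 by (simp add: distrib_left)
      finally show ?thesis .
    qed
    have D3: "\<bar>?D3\<bar> * (sqrt s * (Q + s)) \<le> 2"
    proof (cases "Q = Y")
      case False
      then have QQ: "Q = n\<^sup>2" "Y \<le> Q" using Q by (auto simp: max_def split: if_splits)
      have "gauss2 s Y - gauss2 s Q \<le> 1 / (2 * pi * s) - gauss2 s Q"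
        using s Q by (simp add: gauss2_def divide_right_mono)
      also have "\<dots> = (1 - exp (- Q / (2 * s))) / (2 * pi * s)" by (simp add: gauss2_def diff_divide_distrib)
      also have "\<dots> \<le> (Q / (2 * s)) / (2 * pi * s)"
        using s exp_ge_add_one_self[of "- Q / (2 * s)"] by (intro divide_right_mono) auto
      also have "\<dots> \<le> n\<^sup>2 / (1 * s * s)"
        using QQ s n pi_ge_two by (simp add: frac_le mult_mono)
      finally have "gauss2 s Y - gauss2 s Q \<le> n\<^sup>2 / (s * s)" by simp
      moreover have "gauss2 s Q \<le> gauss2 s Y"
        using QQ s by (auto simp: gauss2_def intro!: divide_right_mono)
      ultimately have "\<bar>gauss2 s Y - gauss2 s Q\<bar> / n \<le> n\<^sup>2 / (s * s) / n" using n by (intro divide_right_mono) auto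
      then have "\<bar>?D3\<bar> \<le> n\<^sup>2 / (s * s) / n" using n by simp
      also have "\<dots> = n / (s * s)" using n by (simp add: power2_eq_square)
      also have "\<dots> \<le> sqrt s / (s * s)" using rn s by (intro divide_right_mono) auto
      finally have "\<bar>?D3\<bar> * (sqrt s * (Q + s)) \<le> sqrt s / (s * s) * (sqrt s * (s + s))"
        using QQ ns rs s Q1 by (intro mult_mono) auto
      also have "\<dots> = sqrt s * sqrt s * (2 * s) / (s * s)" by (simp add: mult_ac)
      also have "\<dots> = 2" using rs s by simp
      finally show ?thesis .
    qed simp
    have "P * E - gauss2 s Q / n = ?D1 + ?D3 + ?D2" by (simp add: algebra_simps diff_divide_distrib)
    then have "\<bar>P * E - gauss2 s Q / n\<bar> \<le> (\<bar>?D1\<bar> + \<bar>?D3\<bar>) + \<bar>?D2\<bar>" by linarith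
    also have "\<dots> \<le> 14700 * (1 / (sqrt s * (Q + s))) + 14700 * (1 / (s\<^sup>2 + Q))"
    proof (rule add_mono)
      have "(\<bar>?D1\<bar> + \<bar>?D3\<bar>) * (sqrt s * (Q + s)) \<le> 14700" using D1 D3 by (simp only: distrib_right)
      then show "\<bar>?D1\<bar> + \<bar>?D3\<bar> \<le> 14700 * (1 / (sqrt s * (Q + s)))" using K1 by (simp add: pos_le_divide_eq)
      have "\<bar>?D2\<bar> * (s\<^sup>2 + Q) \<le> 14700" using D2 by linarith
      then show "\<bar>?D2\<bar> \<le> 14700 * (1 / (s\<^sup>2 + Q))" using K2 by (simp only: mult_1_right times_divide_eq_right pos_le_divide_eq)
    qed
    finally show ?thesis by (simp add: distrib_left)
  qed
  then show ?thesis by (simp add: P_def E_def Q_def n_def)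
qed

section \<open>Green's functions as Laplace transforms\<close>

text \<open>
  Up to the factor \<open>1 + e\<close>, these are the Green's functions of the walks on the cubic lattice and on the
  slab with killing at rate \<open>e\<close>; this is proved below by means of the resolvent equation.
\<close>

definition lattice_resolvent :: "real \<Rightarrow> int \<Rightarrow> int \<Rightarrow> int \<Rightarrow> real" where
  "lattice_resolvent e a b c
    = 3 * (LBINT s:{0<..}. exp (- (3 * e) * s) * (heat s a * heat s b * heat s c))"

definition cylinder_resolvent :: "nat \<Rightarrow> real \<Rightarrow> int \<Rightarrow> int \<Rightarrow> int \<Rightarrow> real" where
  "cylinder_resolvent m e a b z
    = 3 * (LBINT s:{0<..}. exp (- (3 * e) * s) * (heat s a * heat s b * cyc_heat m s z))"

lemma set_lebesgue_integral_nonneg: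
  fixes f :: "real \<Rightarrow> real"
  assumes "\<And>x. x \<in> A \<Longrightarrow> 0 \<le> f x"
  shows "0 \<le> (LBINT x:A. f x)"
  unfolding set_lebesgue_integral_def
  by (rule integral_nonneg_AE) (use assms in \<open>auto simp: indicator_def\<close>)

lemma heat3_nonneg: "s > 0 \<Longrightarrow> 0 \<le> heat s a * heat s b * heat s c"
  by (simp add: heat_nonneg)

lemma
  assumes e: "e \<ge> 0"
  shows set_integrable_lattice: "set_integrable lborel {0<..} (\<lambda>s. exp (- (3 * e) * s) * (heat s a * heat s b * heat s c))"
    and lattice_resolvent_nonneg: "0 \<le> lattice_resolvent e a b c"
    and lattice_resolvent_le: "R > 0 \<Longrightarrow> R\<^sup>2 \<le> sq a + sq b + sq c + 1
      \<Longrightarrow> lattice_resolvent e a b c \<le> 159 * pi / R"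
proof -
  let ?h = "\<lambda>s. heat s a * heat s b * heat s c"
  have le: "\<bar>exp (- (3 * e) * s) * ?h s\<bar> \<le> 53 * (1 / (sqrt s * (R\<^sup>2 + s)))"
    if "s > 0" "R > 0" "R\<^sup>2 \<le> sq a + sq b + sq c + 1" for s R
  proof -
    have "exp (- (3 * e) * s) * ?h s \<le> 1 * ?h s"
      using e that heat3_nonneg[of s a b c] by (intro mult_right_mono) auto
    also have "\<dots> \<le> 53 / (sqrt s * (R\<^sup>2 + s))"
      using heat3_le[of s "R\<^sup>2" a b c] that by simp
    finally show ?thesis using that(1) by (simp add: abs_mult heat_nonneg)
  qed
  have cont: "continuous_on {0<..} (\<lambda>s. exp (- (3 * e) * s) * ?h s)"
    by (intro continuous_intros)
  have int: "set_integrable lborel {0<..} (\<lambda>s. 53 * (1 / (sqrt s * (R\<^sup>2 + s))))" if "R > 0" for R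
    using set_integrable_kernel1[OF that] by (intro set_integrable_mult_right) auto
  show "set_integrable lborel {0<..} (\<lambda>s. exp (- (3 * e) * s) * ?h s)"
    using set_integrable_dominated[OF int[of 1] cont] le[of _ 1] by simp
  show "0 \<le> lattice_resolvent e a b c"
    unfolding lattice_resolvent_def
    by (intro mult_nonneg_nonneg set_lebesgue_integral_nonneg) auto
  assume R: "R > 0" "R\<^sup>2 \<le> sq a + sq b + sq c + 1"
  have "\<bar>LBINT s:{0<..}. exp (- (3 * e) * s) * ?h s\<bar> \<le> (LBINT s:{0<..}. 53 * (1 / (sqrt s * (R\<^sup>2 + s))))"
    using R by (intro abs_set_integral_dominated int cont le) auto
  also have "\<dots> = 53 * (pi / R)"
    by (simp only: set_integral_mult_right set_integral_kernel1[OF R(1)])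
  finally show "lattice_resolvent e a b c \<le> 159 * pi / R"
    by (simp add: lattice_resolvent_def)
qed

text \<open>
  A rational form of the bound by \<open>min 1 u\<close>; it produces the first dominating function.
\<close>

lemma one_minus_exp_le: "1 - exp (- u) \<le> 2 * u / (1 + u)" if "u \<ge> 0" for u :: real
proof (cases "u \<le> 1")
  case True
  have "1 - exp (- u) \<le> u" using exp_ge_add_one_self[of "- u"] by simp
  also have "\<dots> \<le> 2 * u / (1 + u)"
    using True that mult_left_mono[of u 1 u] by (simp add: field_simps)
  finally show ?thesis .
next
  case False
  then have "1 \<le> 2 * u / (1 + u)" by (simp add: field_simps)
  moreover have "1 - exp (- u) \<le> 1" by simp
  ultimately show ?thesis by linarith
qed

text \<open>
  The difference of the integrands is dominated with \<open>M = 1 / sqrt (3 e)\<close>.  For \<open>e = 1 / N^2\<close>, the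
  killing changes the Green's function by \<open>O(1 / N)\<close>.
\<close>

lemma
  assumes e: "e > 0"
  shows lattice_resolvent_le_0: "lattice_resolvent e a b c \<le> lattice_resolvent 0 a b c"
    and lattice_resolvent_ge_0: "lattice_resolvent 0 a b c - 318 * pi * sqrt (3 * e) \<le> lattice_resolvent e a b c"
proof -
  let ?h = "\<lambda>s. heat s a * heat s b * heat s c"
  let ?d = "\<lambda>s. exp (- (3 * 0) * s) * ?h s - exp (- (3 * e) * s) * ?h s"
  define M where "M = 1 / sqrt (3 * e)"
  have M: "M > 0" "M\<^sup>2 = 1 / (3 * e)" using e by (simp_all add: M_def power_divide)
  have i0: "set_integrable lborel {0<..} (\<lambda>s. exp (- (3 * 0) * s) * ?h s)"
    and ie: "set_integrable lborel {0<..} (\<lambda>s. exp (- (3 * e) * s) * ?h s)"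
    using e by (intro set_integrable_lattice; simp)+
  have diff: "lattice_resolvent 0 a b c - lattice_resolvent e a b c = 3 * (LBINT s:{0<..}. ?d s)"
    unfolding lattice_resolvent_def set_integral_diff(2)[OF i0 ie] by simp
  have bound: "0 \<le> ?d s" "?d s \<le> 106 * (1 / (sqrt s * (M\<^sup>2 + s)))" if s: "s > 0" for s
  proof -
    have d: "?d s = (1 - exp (- (3 * e * s))) * ?h s" by (simp add: algebra_simps)
    show "0 \<le> ?d s" unfolding d using heat3_nonneg[OF s, of a b c] e s by (intro mult_nonneg_nonneg) auto
    have "?h s \<le> 53 / (sqrt s * (1 + s))" using s by (intro heat3_le) auto
    also have "\<dots> \<le> 53 / (sqrt s * s)" using s by (intro divide_left_mono) auto
    finally have "?d s \<le> (2 * (3 * e * s) / (1 + 3 * e * s)) * (53 / (sqrt s * s))"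
      unfolding d using heat3_nonneg[OF s, of a b c] e s by (intro mult_mono one_minus_exp_le) (auto simp: heat_nonneg)
    also have "\<dots> = 106 * (1 / (sqrt s * ((1 + 3 * e * s) / (3 * e))))"
      using e s by simp
    also have "(1 + 3 * e * s) / (3 * e) = M\<^sup>2 + s" using e by (simp add: M field_simps)
    finally show "?d s \<le> 106 * (1 / (sqrt s * (M\<^sup>2 + s)))" .
  qed
  show "lattice_resolvent e a b c \<le> lattice_resolvent 0 a b c"
    using diff set_lebesgue_integral_nonneg[of "{0<..}" ?d] bound(1) by auto
  have "(LBINT s:{0<..}. ?d s) \<le> (LBINT s:{0<..}. 106 * (1 / (sqrt s * (M\<^sup>2 + s))))"
    using set_integrable_kernel1[OF M(1)] bound(2)
    by (intro set_integral_mono set_integral_diff(1)[OF i0 ie] set_integrable_mult_right) auto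
  also have "\<dots> = 106 * (pi / M)"
    by (simp only: set_integral_mult_right set_integral_kernel1[OF M(1)])
  also have "pi / M = pi * sqrt (3 * e)" by (simp add: M_def)
  finally show "lattice_resolvent 0 a b c - 318 * pi * sqrt (3 * e) \<le> lattice_resolvent e a b c"
    using diff by simp
qed

text \<open>
  From time 264 on, the error in the local central limit theorem is at most half of the main term.
\<close>

lemma heat_ge:
  assumes s: "s \<ge> 264" and k: "sq k \<le> s"
  shows "1 / (12 * sqrt s) \<le> heat s k"
proof -
  have "exp (- 1 / 2) \<le> exp (- sq k / (2 * s))" using s k by simp
  moreover have "1 / 2 \<le> exp (- 1 / 2 :: real)" using exp_ge_add_one_self[of "- 1 / 2 :: real"] by simp
  ultimately have e: "1 / 2 \<le> exp (- sq k / (2 * s))" by linarith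
  have "sqrt (2 * pi * s) \<le> sqrt (3\<^sup>2 * s)"
    using s pi_less_4 by (intro real_sqrt_le_mono mult_right_mono) auto
  then have r: "sqrt (2 * pi * s) \<le> 3 * sqrt s" by (simp add: real_sqrt_mult)
  have "1 / 6 / sqrt s = (1 / 2) / (3 * sqrt s)" by simp
  also have "\<dots> \<le> gauss s (real_of_int k)"
    unfolding gauss_def using e r s by (intro frac_le) auto
  finally have g: "1 / 6 / sqrt s \<le> gauss s (real_of_int k)" .
  have "22 / (s * sqrt s) \<le> 1 / 12 / sqrt s"
    using s by (simp add: field_simps)
  moreover have "\<bar>heat s k - gauss s (real_of_int k)\<bar> \<le> 22 / (s * sqrt s)"
    using s by (intro heat_gauss_diff_le) simp
  ultimately have "1 / 6 / sqrt s - 1 / 12 / sqrt s \<le> heat s k" using g by linarith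
  then show ?thesis by (simp add: field_simps)
qed

text \<open>
  It suffices to integrate over \<open>\<rho>^2 \<le> s \<le> 2 \<rho>^2\<close>, where each of the three heat kernels is at least of
  order \<open>1 / \<rho>\<close>.  The condition \<open>\<rho> \<ge> 17\<close> ensures \<open>\<rho>^2 \<ge> 264\<close>.
\<close>

lemma lattice_resolvent_ge:
  assumes e: "e \<ge> 0" and \<rho>: "\<rho> \<ge> 17"
    and a: "sq a \<le> \<rho>\<^sup>2" and b: "sq b \<le> \<rho>\<^sup>2" and c: "sq c \<le> \<rho>\<^sup>2"
  shows "exp (- (6 * e * \<rho>\<^sup>2)) / (1728 * \<rho>) \<le> lattice_resolvent e a b c"
proof -
  let ?f = "\<lambda>s. exp (- (3 * e) * s) * (heat s a * heat s b * heat s c)"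
  let ?c = "exp (- (6 * e * \<rho>\<^sup>2)) / (5184 * \<rho> ^ 3)"
  have "17\<^sup>2 \<le> \<rho>\<^sup>2" by (rule power_mono[OF \<rho>]) simp
  then have \<rho>2: "\<rho>\<^sup>2 \<ge> 264" by simp
  have int: "integrable lborel (\<lambda>s. indicator {0<..} s * ?f s)"
    using set_integrable_lattice[OF e, of a b c] by (simp add: set_integrable_def)
  have intc: "integrable lborel (\<lambda>s. indicator {\<rho>\<^sup>2..2 * \<rho>\<^sup>2} s * ?c)"
    using \<rho>2 by (intro integrable_mult_left integrable_real_indicator) auto
  have "(\<integral>s. indicator {\<rho>\<^sup>2..2 * \<rho>\<^sup>2} s * ?c \<partial>lborel) \<le> (\<integral>s. indicator {0<..} s * ?f s \<partial>lborel)"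
  proof (intro integral_mono int intc)
    fix s :: real
    show "indicator {\<rho>\<^sup>2..2 * \<rho>\<^sup>2} s * ?c \<le> indicator {0<..} s * ?f s"
    proof (cases "s \<in> {\<rho>\<^sup>2..2 * \<rho>\<^sup>2}")
      case True
      then have s: "s > 0" "s \<ge> 264" "\<rho>\<^sup>2 \<le> s" "s \<le> 2 * \<rho>\<^sup>2" using \<rho>2 by auto
      have "(sqrt s) ^ 3 = s * sqrt s" using s by (simp add: power3_eq_cube)
      also have "\<dots> \<le> (2 * \<rho>\<^sup>2) * (3 / 2 * \<rho>)"
      proof (intro mult_mono)
        show "sqrt s \<le> 3 / 2 * \<rho>"
        proof (rule real_le_lsqrt)
          have "s \<le> 9 / 4 * \<rho>\<^sup>2" using s by simp
          then show "s \<le> (3 / 2 * \<rho>)\<^sup>2" by (simp add: power_mult_distrib power_divide)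
        qed (use \<rho> in auto)
      qed (use s \<rho> in auto)
      also have "\<dots> = 3 * \<rho> ^ 3" by (simp add: power2_eq_square power3_eq_cube)
      finally have s3: "(sqrt s) ^ 3 \<le> 3 * \<rho> ^ 3" .
      have "1 / (5184 * \<rho> ^ 3) \<le> 1 / (1728 * (sqrt s) ^ 3)"
        using s3 s \<rho> by (intro divide_left_mono) auto
      also have "\<dots> = 1 / (12 * sqrt s) * (1 / (12 * sqrt s)) * (1 / (12 * sqrt s))"
        by (simp add: power3_eq_cube)
      also have "\<dots> \<le> heat s a * heat s b * heat s c"
        using s a b c by (intro mult_mono heat_ge) (auto simp: heat_nonneg)
      finally have h: "1 / (5184 * \<rho> ^ 3) \<le> heat s a * heat s b * heat s c" .
      have "e * s \<le> e * (2 * \<rho>\<^sup>2)" using e s by (intro mult_left_mono) auto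
      then have "exp (- (6 * e * \<rho>\<^sup>2)) \<le> exp (- (3 * e) * s)" by simp
      then have "exp (- (6 * e * \<rho>\<^sup>2)) * (1 / (5184 * \<rho> ^ 3)) \<le> ?f s"
        using h \<rho> by (intro mult_mono) auto
      then show ?thesis using True s by simp
    next
      case False
      then show ?thesis using heat3_nonneg[of s a b c] by (auto simp: indicator_def)
    qed
  qed
  moreover have "(\<integral>s. indicator {\<rho>\<^sup>2..2 * \<rho>\<^sup>2} s * ?c \<partial>lborel) = \<rho>\<^sup>2 * ?c"
    by simp
  ultimately have "\<rho>\<^sup>2 * ?c \<le> (LBINT s:{0<..}. ?f s)"
    by (simp only: set_lebesgue_integral_def real_scaleR_def)
  then have le: "3 * (\<rho>\<^sup>2 * ?c) \<le> lattice_resolvent e a b c"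
    unfolding lattice_resolvent_def by (rule mult_left_mono) simp
  have *: "3 * (r\<^sup>2 * (E / (5184 * r ^ 3))) = E / (1728 * r)" if "r \<noteq> 0" for r E :: real
    using that unfolding power2_eq_square power3_eq_cube by (simp add: divide_simps)
  have "\<rho> \<noteq> 0" using \<rho> by linarith
  from le show ?thesis by (simp only: *[OF \<open>\<rho> \<noteq> 0\<close>])
qed

lemma set_integrable_cylinder:
  assumes m: "m > 0" and e: "e > 0"
  shows "set_integrable lborel {0<..} (\<lambda>s. exp (- (3 * e) * s) * (heat s a * heat s b * cyc_heat m s z))"
proof (rule set_integrable_dominated[OF set_integrable_exp_minus[of "3 * e"]])
  show "continuous_on {0<..} (\<lambda>s. exp (- (3 * e) * s) * (heat s a * heat s b * cyc_heat m s z))"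
    by (intro continuous_intros)
  fix s :: real assume s: "s > 0"
  have "heat s a * heat s b * cyc_heat m s z \<le> 1 * 1 * 1"
    using s m abs_heat_le_one[of s a] abs_heat_le_one[of s b]
    by (intro mult_mono) (auto simp: heat_nonneg cyc_heat_nonneg cyc_heat_le_one)
  then show "\<bar>exp (- (3 * e) * s) * (heat s a * heat s b * cyc_heat m s z)\<bar> \<le> exp (- (3 * e) * s)"
    using s m by (simp add: abs_mult heat_nonneg cyc_heat_nonneg)
qed (use e in auto)

lemma continuous_on_gauss2: "continuous_on {0<..} (\<lambda>s. gauss2 s u)"
  unfolding gauss2_def by (rule continuous_intros | auto)+

text \<open>
  The images of \<open>v\<close> contribute \<open>1 / m\<close> times the Green's function of a killed Brownian motion in the
  plane, at distance \<open>M\<close>, up to \<open>O(1 / M)\<close>: the error is the integral of the bound in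
  \<open>kernel_comparison\<close>.
\<close>

lemma
  fixes a b v :: int and m :: nat and M e :: real
  assumes m: "m > 0" and e: "e > 0" and v: "2 * \<bar>v\<bar> \<le> int m" and M0: "M > 0"
    and M: "M\<^sup>2 = max (sq a + sq b) ((real m)\<^sup>2)"
  shows lattice_le_cylinder: "lattice_resolvent e a b v \<le> cylinder_resolvent m e a b v"
    and cylinder_resolvent_approx:
      "\<bar>cylinder_resolvent m e a b v - lattice_resolvent e a b v - 3 / pi * (1 / real m) * K0 (sqrt (6 * e) * M)\<bar>
        \<le> 66150 * pi / M" (is "\<bar>?diff\<bar> \<le> _")
proof -
  let ?e = "\<lambda>s. exp (- (3 * e) * s)"
  let ?l = "\<lambda>s. ?e s * (heat s a * heat s b * heat s v)"
  let ?c = "\<lambda>s. ?e s * (heat s a * heat s b * cyc_heat m s v)"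
  let ?g = "\<lambda>s. ?e s * (exp (- M\<^sup>2 / (2 * s)) / (2 * pi * s))"
  let ?D = "\<lambda>s. heat s a * heat s b * (cyc_heat m s v - heat s v) - gauss2 s (M\<^sup>2) / real m"
  have il: "set_integrable lborel {0<..} ?l" using e by (intro set_integrable_lattice) simp
  have ic: "set_integrable lborel {0<..} ?c" by (rule set_integrable_cylinder[OF m e])
  have ig: "set_integrable lborel {0<..} ?g" using e M0 by (intro set_integrable_bessel) auto
  have gint: "(LBINT s:{0<..}. ?g s) = K0 (sqrt (6 * e) * M) / pi"
    using set_integral_bessel[of "3 * e" M] e M0 by (simp add: mult.commute)
  show "lattice_resolvent e a b v \<le> cylinder_resolvent m e a b v"
    unfolding lattice_resolvent_def cylinder_resolvent_def
    using heat_le_cyc_heat[OF m _ v]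
    by (intro mult_left_mono set_integral_mono il ic) (auto simp: heat_nonneg intro!: mult_left_mono)
  have ig': "set_integrable lborel {0<..} (\<lambda>s. ?g s / real m)"
    using ig by (intro set_integrable_divide) auto
  have pt: "?e s * ?D s = ?c s - ?l s - ?g s / real m" for s
    unfolding gauss2_def by (simp only: right_diff_distrib times_divide_eq_right)
  have "(LBINT s:{0<..}. ?e s * ?D s) = (LBINT s:{0<..}. ?c s - ?l s) - (LBINT s:{0<..}. ?g s / real m)"
    unfolding pt by (rule set_integral_diff(2)[OF set_integral_diff(1)[OF ic il] ig'])
  then have "(LBINT s:{0<..}. ?e s * ?D s)
      = (LBINT s:{0<..}. ?c s) - (LBINT s:{0<..}. ?l s) - (LBINT s:{0<..}. ?g s) / real m"
    by (simp only: set_integral_diff(2)[OF ic il] set_integral_divide_zero)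
  then have eq: "?diff = 3 * (LBINT s:{0<..}. ?e s * ?D s)"
    unfolding lattice_resolvent_def cylinder_resolvent_def gint by (simp add: right_diff_distrib)
  let ?k = "\<lambda>s. 14700 * (1 / (sqrt s * (M\<^sup>2 + s)) + 1 / (s\<^sup>2 + M\<^sup>2))"
  note k12 = set_integrable_kernel1[OF M0] set_integrable_kernel2[OF M0]
  have ik: "set_integrable lborel {0<..} ?k"
    using k12 by (intro set_integrable_mult_right set_integral_add) auto
  have "\<bar>LBINT s:{0<..}. ?e s * ?D s\<bar> \<le> (LBINT s:{0<..}. ?k s)"
  proof (rule abs_set_integral_dominated[OF ik])
    show "continuous_on {0<..} (\<lambda>s. ?e s * ?D s)"
      using m by (intro continuous_intros continuous_on_gauss2) auto
    fix s :: real assume s: "s > 0"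
    have "\<bar>?e s * ?D s\<bar> \<le> 1 * \<bar>?D s\<bar>"
      unfolding abs_mult using e s by (intro mult_right_mono) auto
    also have "\<dots> \<le> ?k s" using kernel_comparison[OF m s v M] by simp
    finally show "\<bar>?e s * ?D s\<bar> \<le> ?k s" .
  qed
  also have "\<dots> = 14700 * (pi / M + pi / (2 * M))"
    by (simp only: set_integral_mult_right set_integral_add(2)[OF k12] set_integral_kernel1[OF M0] set_integral_kernel2[OF M0])
  also have "\<dots> = 22050 * pi / M" using M0 by (simp add: field_simps)
  finally show "\<bar>?diff\<bar> \<le> 66150 * pi / M"
    unfolding eq by (simp add: abs_mult)
qed

section \<open>Resolvent equations\<close>

lemma set_integral_linear_combination:
  fixes f :: "real \<Rightarrow> real" and F :: "'i \<Rightarrow> real \<Rightarrow> real"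
  assumes "finite I" "set_integrable lborel A f" "\<And>i. i \<in> I \<Longrightarrow> set_integrable lborel A (F i)"
  shows "(LBINT s:A. c * f s - d * (\<Sum>i\<in>I. F i s)) = c * (LBINT s:A. f s) - d * (\<Sum>i\<in>I. LBINT s:A. F i s)"
proof -
  have "set_integrable lborel A (\<lambda>s. \<Sum>i\<in>I. F i s)"
    unfolding set_integrable_def scaleR_sum_right
    by (rule Bochner_Integration.integrable_sum) (rule assms(3)[unfolded set_integrable_def])
  moreover have "(LBINT s:A. \<Sum>i\<in>I. F i s) = (\<Sum>i\<in>I. LBINT s:A. F i s)"
    unfolding set_lebesgue_integral_def scaleR_sum_right
    by (rule Bochner_Integration.integral_sum) (rule assms(3)[unfolded set_integrable_def])
  ultimately show ?thesis
    using assms(2) by (subst set_integral_diff(2)) (auto intro: set_integrable_mult_right)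
qed

text \<open>
  The Laplace transform of the heat equation.  The rate 3 and the factor \<open>1/2\<close> come from the time scale
  in which each coordinate jumps at rate 1.
\<close>

lemma resolvent_equation:
  fixes H :: "point \<Rightarrow> real \<Rightarrow> real"
  assumes e: "e > 0"
    and deriv: "\<And>x s. (H x has_real_derivative (\<Sum>u\<in>unit_steps. H (x + u) s) / 2 - 3 * H x s) (at s)"
    and bound: "\<And>x s. s \<ge> 0 \<Longrightarrow> \<bar>H x s\<bar> \<le> 1"
  defines "R \<equiv> \<lambda>x. 3 * (LBINT s:{0<..}. exp (- (3 * e) * s) * H x s)"
  shows "(1 + e) * R x = H x 0 + (\<Sum>u\<in>unit_steps. R (x + u)) / 6"
    and "\<bar>R x\<bar> \<le> 3 * (LBINT s:{0<..}. exp (- (3 * e) * s))"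
proof -
  let ?E = "\<lambda>s. exp (- (3 * e) * s)"
  have contH: "continuous_on A (H x)" for A x
    by (rule DERIV_continuous_on) (rule has_field_derivative_at_within[OF deriv])
  have intE: "set_integrable lborel {0<..} ?E"
    using e by (intro set_integrable_exp_minus) simp
  have le: "\<bar>?E s * H x s\<bar> \<le> ?E s" if "s > 0" for s x
    using bound[of s x] that by (simp add: abs_mult)
  have contEH: "continuous_on {0<..} (\<lambda>s. ?E s * H x s)" for x
    by (intro continuous_intros contH)
  have int: "set_integrable lborel {0<..} (\<lambda>s. ?E s * H x s)" for x
    by (rule set_integrable_dominated[OF intE contEH le])
  show "\<bar>R x\<bar> \<le> 3 * (LBINT s:{0<..}. ?E s)"
    unfolding R_def using abs_set_integral_dominated[OF intE contEH le, of x] by (simp add: abs_mult)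
  let ?H' = "\<lambda>s. (\<Sum>u\<in>unit_steps. H (x + u) s) / 2 - 3 * H x s"
  have "(LBINT s:{0<..}. ?E s * (3 * e * H x s - ?H' s)) = H x 0"
  proof (rule laplace_of_derivative[where B = 6])
    show "continuous_on UNIV ?H'" by (intro continuous_intros contH) simp
    fix s :: real assume s: "s \<ge> 0"
    show "\<bar>H x s\<bar> \<le> 6" using bound[OF s, of x] by simp
    have "\<bar>\<Sum>u\<in>unit_steps. H (x + u) s\<bar> \<le> (\<Sum>u\<in>unit_steps. 1)"
      by (intro order_trans[OF sum_abs] sum_mono bound s)
    then show "\<bar>?H' s\<bar> \<le> 6" using bound[OF s, of x] by (simp add: card_unit_steps)
  qed (use e deriv in auto)
  moreover have "?E s * (3 * e * H x s - ?H' s)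
      = (3 + 3 * e) * (?E s * H x s) - 1 / 2 * (\<Sum>u\<in>unit_steps. ?E s * H (x + u) s)" for s
    unfolding sum_distrib_left[symmetric] by (simp add: algebra_simps)
  ultimately have "(3 + 3 * e) * (LBINT s:{0<..}. ?E s * H x s)
      - 1 / 2 * (\<Sum>u\<in>unit_steps. LBINT s:{0<..}. ?E s * H (x + u) s) = H x 0"
    using set_integral_linear_combination[OF finite_unit_steps int int, of "3 + 3 * e" x "1 / 2" "\<lambda>u. x + u"] by simp
  then show "(1 + e) * R x = H x 0 + (\<Sum>u\<in>unit_steps. R (x + u)) / 6"
    by (simp add: R_def sum_distrib_left[symmetric] algebra_simps)
qed

lemma has_derivative_heat2:
  "((\<lambda>s. heat s a * heat s b * c s) has_real_derivative
      (heat s (a + 1) * heat s b * c s + heat s (a - 1) * heat s b * c s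
      + heat s a * heat s (b + 1) * c s + heat s a * heat s (b - 1) * c s
      + heat s a * heat s b * d + heat s a * heat s b * d') / 2 - 3 * (heat s a * heat s b * c s)) (at s)"
  if "(c has_real_derivative (d + d') / 2 - c s) (at s)"
proof -
  have "((\<lambda>s. heat s a * heat s b * c s) has_real_derivative
    (((heat s (a + 1) + heat s (a - 1)) / 2 - heat s a) * heat s b
      + ((heat s (b + 1) + heat s (b - 1)) / 2 - heat s b) * heat s a) * c s
      + ((d + d') / 2 - c s) * (heat s a * heat s b)) (at s)"
    by (intro DERIV_mult has_derivative_heat that)
  then show ?thesis by (rule DERIV_cong) (simp add: field_simps)
qed

abbreviation lattice_green :: "real \<Rightarrow> point \<Rightarrow> real" where
  "lattice_green e x \<equiv> lattice_resolvent e (fst (fst x)) (snd (fst x)) (snd x)"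

abbreviation cylinder_green :: "nat \<Rightarrow> real \<Rightarrow> point \<Rightarrow> real" where
  "cylinder_green m e x \<equiv> cylinder_resolvent m e (fst (fst x)) (snd (fst x)) (snd x)"

lemma
  assumes e: "e > 0"
  shows lattice_green_equation:
      "(1 + e) * lattice_green e x = (if x = 0 then 1 else 0) + (\<Sum>u\<in>unit_steps. lattice_green e (x + u)) / 6"
    and lattice_green_bounded: "\<exists>B. \<forall>x. \<bar>lattice_green e x\<bar> \<le> B"
proof -
  define H where "H = (\<lambda>(x::point) s. heat s (fst (fst x)) * heat s (snd (fst x)) * heat s (snd x))"
  have deriv: "(H x has_real_derivative (\<Sum>u\<in>unit_steps. H (x + u) s) / 2 - 3 * H x s) (at s)" for x s
    unfolding H_def
    by (rule DERIV_cong[OF has_derivative_heat2[OF has_derivative_heat]]) (simp add: unit_steps_def)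
  have bound: "\<bar>H x s\<bar> \<le> 1" if "s \<ge> 0" for x s
    unfolding H_def abs_mult using abs_heat_le_one[OF that] by (intro mult_le_one) auto
  note eq = resolvent_equation[of e H, OF e deriv bound, unfolded H_def]
  have "x = 0 \<longleftrightarrow> fst (fst x) = 0 \<and> snd (fst x) = 0 \<and> snd x = 0"
    by (auto simp: prod_eq_iff)
  then show "(1 + e) * lattice_green e x = (if x = 0 then 1 else 0) + (\<Sum>u\<in>unit_steps. lattice_green e (x + u)) / 6"
    using eq(1)[of x] by (simp add: lattice_resolvent_def heat_0)
  show "\<exists>B. \<forall>x. \<bar>lattice_green e x\<bar> \<le> B"
    unfolding lattice_resolvent_def by (rule exI, rule allI, rule eq(2))
qed

lemma cylinder_green_slab_add:
  "m > 0 \<Longrightarrow> cylinder_green m e (slab_add (int m) x u) = cylinder_green m e (x + u)"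
  using cyc_heat_mod[of m "(snd x + snd u) mod int m" "snd x + snd u"]
  by (simp add: cylinder_resolvent_def slab_add_def)

lemma
  assumes m: "m > 0" and e: "e > 0"
  shows cylinder_green_equation:
      "x \<in> slab (int m) \<Longrightarrow> (1 + e) * cylinder_green m e x
        = (if x = 0 then 1 else 0) + (\<Sum>u\<in>unit_steps. cylinder_green m e (slab_add (int m) x u)) / 6"
    and cylinder_green_bounded: "\<exists>B. \<forall>x. \<bar>cylinder_green m e x\<bar> \<le> B"
proof -
  define H where "H = (\<lambda>(x::point) s. heat s (fst (fst x)) * heat s (snd (fst x)) * cyc_heat m s (snd x))"
  have deriv: "(H x has_real_derivative (\<Sum>u\<in>unit_steps. H (x + u) s) / 2 - 3 * H x s) (at s)" for x s
    unfolding H_def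
    by (rule DERIV_cong[OF has_derivative_heat2[OF has_derivative_cyc_heat]]) (simp add: unit_steps_def)
  have "\<bar>cyc_heat m s z\<bar> \<le> 1" if "s \<ge> 0" for s z
    using cyc_heat_nonneg[OF m that] cyc_heat_le_one[OF m that] by simp
  then have bound: "\<bar>H x s\<bar> \<le> 1" if "s \<ge> 0" for x s
    unfolding H_def abs_mult using abs_heat_le_one[OF that] that by (intro mult_le_one) auto
  note eq = resolvent_equation[of e H, OF e deriv bound, unfolded H_def]
  show "\<exists>B. \<forall>x. \<bar>cylinder_green m e x\<bar> \<le> B"
    unfolding cylinder_resolvent_def by (rule exI, rule allI, rule eq(2))
  assume x: "x \<in> slab (int m)"
  then have "int m dvd snd x \<longleftrightarrow> snd x = 0"
    by (auto simp: slab_def dest: zdvd_imp_le)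
  then have "x = 0 \<longleftrightarrow> fst (fst x) = 0 \<and> snd (fst x) = 0 \<and> int m dvd snd x"
    by (auto simp: prod_eq_iff)
  then show "(1 + e) * cylinder_green m e x
        = (if x = 0 then 1 else 0) + (\<Sum>u\<in>unit_steps. cylinder_green m e (slab_add (int m) x u)) / 6"
    using eq(1)[of x] m unfolding cylinder_green_slab_add[OF m]
    by (simp add: cylinder_resolvent_def heat_0 cyc_heat_0)
qed

section \<open>Identification with the Markov chains\<close>

text \<open>
  For \<open>l = 1\<close> the probability that the walk with neighbours \<open>nb\<close>, started at 0, is at \<open>x\<close> after \<open>n\<close>
  steps.  For \<open>l > 1\<close> each step is survived with probability \<open>1 / l\<close>.  The recursion goes through the last
  step, which is legitimate because the set of steps is symmetric.
\<close>

primrec step_prob :: "(point \<Rightarrow> point \<Rightarrow> point) \<Rightarrow> real \<Rightarrow> nat \<Rightarrow> point \<Rightarrow> real" where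
  "step_prob nb l 0 x = (if x = 0 then 1 else 0)"
| "step_prob nb l (Suc n) x = (\<Sum>u\<in>unit_steps. step_prob nb l n (nb x u)) / (6 * l)"

lemma step_prob_nonneg: "l > 0 \<Longrightarrow> 0 \<le> step_prob nb l n x"
  by (induction n arbitrary: x) (simp_all add: sum_nonneg)

lemma step_prob_scale: "step_prob nb l n x = step_prob nb 1 n x / l ^ n"
proof (induction n arbitrary: x)
  case (Suc n)
  have "step_prob nb l (Suc n) x = (\<Sum>u\<in>unit_steps. step_prob nb 1 n (nb x u) / l ^ n) / (6 * l)"
    unfolding step_prob.simps(2) by (subst Suc.IH) simp
  then show ?case by (simp add: sum_divide_distrib[symmetric] mult.commute)
qed simp

text \<open>
  Uniqueness of bounded solutions: what remains of \<open>l f\<close> after subtraction of the first \<open>M\<close> terms of the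
  series satisfies the homogeneous equation up to a shift of \<open>M\<close>, and so decays like \<open>l ^ (- M)\<close>.
\<close>

lemma step_prob_sums:
  fixes f :: "point \<Rightarrow> real"
  assumes l: "l > 1" and closed: "\<And>x u. x \<in> S \<Longrightarrow> nb x u \<in> S"
    and eq: "\<And>x. x \<in> S \<Longrightarrow> l * f x = (if x = 0 then 1 else 0) + (\<Sum>u\<in>unit_steps. f (nb x u)) / 6"
    and bound: "\<And>x. \<bar>f x\<bar> \<le> B" and x: "x \<in> S"
  shows "(\<lambda>n. step_prob nb l n x) sums (l * f x)"
proof -
  let ?r = "\<lambda>M x. l * f x - (\<Sum>n<M. step_prob nb l n x)"
  have rec: "?r (Suc M) x = (\<Sum>u\<in>unit_steps. ?r M (nb x u)) / (6 * l)" if "x \<in> S" for M x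
  proof -
    have "(\<Sum>n<Suc M. step_prob nb l n x) = (if x = 0 then 1 else 0) + (\<Sum>n<M. step_prob nb l (Suc n) x)"
      by (simp only: sum.lessThan_Suc_shift step_prob.simps(1))
    also have "(\<Sum>n<M. step_prob nb l (Suc n) x) = (\<Sum>u\<in>unit_steps. \<Sum>n<M. step_prob nb l n (nb x u)) / (6 * l)"
      by (simp add: sum_divide_distrib[symmetric] sum.swap[of _ "{..<M}"])
    finally have "?r (Suc M) x = (\<Sum>u\<in>unit_steps. f (nb x u)) / 6
        - (\<Sum>u\<in>unit_steps. \<Sum>n<M. step_prob nb l n (nb x u)) / (6 * l)"
      using eq[OF that] by simp
    also have "(\<Sum>u\<in>unit_steps. f (nb x u)) / 6 = (\<Sum>u\<in>unit_steps. l * f (nb x u)) / (6 * l)"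
      using l by (simp add: sum_distrib_left[symmetric])
    finally show ?thesis by (simp add: sum_subtractf diff_divide_distrib)
  qed
  have B: "\<bar>?r M x\<bar> \<le> l * B / l ^ M" if "x \<in> S" for M x
    using that
  proof (induction M arbitrary: x)
    case 0
    then show ?case using bound[of x] l by (simp add: abs_mult)
  next
    case (Suc M)
    have "\<bar>\<Sum>u\<in>unit_steps. ?r M (nb x u)\<bar> \<le> (\<Sum>u\<in>unit_steps. l * B / l ^ M)"
      by (intro order_trans[OF sum_abs] sum_mono Suc.IH closed Suc.prems)
    then have "\<bar>\<Sum>u\<in>unit_steps. ?r M (nb x u)\<bar> / (6 * l) \<le> 6 * (l * B / l ^ M) / (6 * l)"
      using l by (intro divide_right_mono) (auto simp: card_unit_steps)
    then show ?case unfolding rec[OF Suc.prems] using l by (simp add: abs_divide)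
  qed
  have "(\<lambda>M. l * B * (1 / l) ^ M) \<longlonglongrightarrow> l * B * 0"
    using l by (intro tendsto_mult tendsto_const LIMSEQ_power_zero) auto
  then have "(\<lambda>M. l * B / l ^ M) \<longlonglongrightarrow> 0" by (simp add: power_divide)
  then have "(\<lambda>M. ?r M x) \<longlonglongrightarrow> 0"
    by (rule Lim_null_comparison[rotated]) (use B[OF x] in auto)
  from tendsto_diff[OF tendsto_const[of "l * f x"] this] show ?thesis
    by (simp add: sums_def)
qed

text \<open>
  The chains on the slab and on the lattice are treated together.  The set \<open>S\<close> is the state space
  proper; for the slab the points outside of it are never visited.
\<close>

lemma visit_prob_eq_step_prob:
  fixes w :: "point \<Rightarrow> point \<Rightarrow> real"
  assumes w: "\<And>x x'. w x x' = 1 / 6 * real (card {u \<in> unit_steps. x' = nb x u})"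
    and k: "k \<ge> 0" and total: "\<And>x. total_weight w (\<lambda>_. k) x = 1 + k"
    and closed: "\<And>x u. nb x u \<in> S" and zero: "0 \<in> S"
    and inv: "\<And>x x' u. x \<in> S \<Longrightarrow> x' \<in> S \<Longrightarrow> x' = nb x u \<longleftrightarrow> x = nb x' (- u)"
  shows "visit_prob w (\<lambda>_. k) 0 n x' = (if x' \<in> S then ennreal (step_prob nb (1 + k) n x') else 0)"
proof (induction n arbitrary: x')
  case 0
  then show ?case using zero k by (subst visit_prob_0) (auto simp: total)
next
  case (Suc n)
  have w0: "w x x' = 0" if "x' \<notin> nb x ` unit_steps" for x x'
  proof -
    have "{u \<in> unit_steps. x' = nb x u} = {}" using that by auto
    then show ?thesis by (simp add: w)
  qed
  have pmf: "pmf (jump_pmf w (\<lambda>_. k) s) (Some x') = w s x' / (1 + k)" for s x'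
    using pmf_jump_pmf(2)[of "nb s ` unit_steps" w s "\<lambda>_. k" x'] w0 k total[of s] by (simp add: w)
  have step: "visit_prob w (\<lambda>_. k) 0 (Suc n) x' = (\<integral>\<^sup>+s. ennreal (w s x' / (1 + k))
      * (if s \<in> S then ennreal (step_prob nb (1 + k) n s) else 0) \<partial>count_space UNIV)"
    using k by (subst visit_prob_Suc) (simp_all add: total pmf Suc.IH)
  show ?case
  proof (cases "x' \<in> S")
    case False
    then have "w s x' = 0" for s by (intro w0) (metis closed imageE)
    then show ?thesis using False step by simp
  next
    case True
    let ?T = "nb x' ` unit_steps"
    have minus: "uminus ` unit_steps = unit_steps"
      by (auto simp: unit_steps_def)
    have T: "s \<in> ?T" if "s \<in> S" "w s x' \<noteq> 0" for s
    proof -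
      from that w0 obtain u where "u \<in> unit_steps" "x' = nb s u" by fastforce
      then have "- u \<in> unit_steps" "s = nb x' (- u)" using inv[OF that(1) True] minus by auto
      then show ?thesis by auto
    qed
    have "visit_prob w (\<lambda>_. k) 0 (Suc n) x' = (\<Sum>s\<in>?T. ennreal (w s x' / (1 + k))
      * (if s \<in> S then ennreal (step_prob nb (1 + k) n s) else 0))"
      unfolding step
    proof (rule nn_integral_count_space')
      fix s assume "s \<notin> ?T"
      with T have "s \<notin> S \<or> w s x' = 0" by blast
      then show "ennreal (w s x' / (1 + k)) * (if s \<in> S then ennreal (step_prob nb (1 + k) n s) else 0) = 0"
        by (elim disjE) simp_all
    qed simp_all
    also have "\<dots> = (\<Sum>s\<in>?T. ennreal (w s x' / (1 + k) * step_prob nb (1 + k) n s))"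
    proof (rule sum.cong[OF refl])
      fix s assume "s \<in> ?T"
      then have "s \<in> S" by (metis closed imageE)
      moreover have "0 \<le> w s x' / (1 + k)" using k by (simp add: w)
      ultimately show "ennreal (w s x' / (1 + k)) * (if s \<in> S then ennreal (step_prob nb (1 + k) n s) else 0)
        = ennreal (w s x' / (1 + k) * step_prob nb (1 + k) n s)"
        using k by (simp only: if_True) (rule ennreal_mult[symmetric], simp_all add: step_prob_nonneg)
    qed
    also have "\<dots> = ennreal (\<Sum>s\<in>?T. w s x' / (1 + k) * step_prob nb (1 + k) n s)"
      using k by (intro sum_ennreal) (simp add: w step_prob_nonneg)
    also have "(\<Sum>s\<in>?T. w s x' / (1 + k) * step_prob nb (1 + k) n s)
        = (\<Sum>s\<in>?T. \<Sum>u\<in>unit_steps. (if s = nb x' (- u) then step_prob nb (1 + k) n s else 0) / (6 * (1 + k)))"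
    proof (rule sum.cong[OF refl])
      fix s assume "s \<in> ?T"
      then have "s \<in> S" by (metis closed imageE)
      then have "{u \<in> unit_steps. x' = nb s u} = {u \<in> unit_steps. s = nb x' (- u)}"
        using inv[OF _ True] by blast
      then have "w s x' = 1 / 6 * (\<Sum>u\<in>unit_steps. if s = nb x' (- u) then 1 else 0)"
        by (simp add: w sum.If_cases Int_def)
      then show "w s x' / (1 + k) * step_prob nb (1 + k) n s
        = (\<Sum>u\<in>unit_steps. (if s = nb x' (- u) then step_prob nb (1 + k) n s else 0) / (6 * (1 + k)))"
        by (auto simp: sum_distrib_left sum_distrib_right sum_divide_distrib intro!: sum.cong)
    qed
    also have "\<dots> = (\<Sum>u\<in>unit_steps. \<Sum>s\<in>?T. (if s = nb x' (- u) then step_prob nb (1 + k) n s else 0) / (6 * (1 + k)))"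
      by (rule sum.swap)
    also have "\<dots> = (\<Sum>u\<in>unit_steps. step_prob nb (1 + k) n (nb x' (- u)) / (6 * (1 + k)))"
    proof (rule sum.cong[OF refl])
      fix u assume "u \<in> unit_steps"
      then have "nb x' (- u) \<in> ?T" using minus by blast
      then show "(\<Sum>s\<in>?T. (if s = nb x' (- u) then step_prob nb (1 + k) n s else 0) / (6 * (1 + k)))
        = step_prob nb (1 + k) n (nb x' (- u)) / (6 * (1 + k))"
        by (simp add: sum_divide_distrib[symmetric] sum.delta)
    qed
    also have "\<dots> = (\<Sum>u\<in>unit_steps. step_prob nb (1 + k) n (nb x' u) / (6 * (1 + k)))"
      by (rule sum.reindex_bij_witness[of _ uminus uminus]) (use minus in auto)
    finally show ?thesis using True by (simp add: sum_divide_distrib)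
  qed
qed

lemma ennreal_suminf_step_prob:
  assumes "(\<lambda>n. step_prob nb l n x) sums a" "l > 0"
  shows "(\<Sum>n. ennreal (step_prob nb l n x)) = ennreal a"
  using assms by (intro suminf_ennreal_eq) (auto simp: step_prob_nonneg)

lemma green_slab_eq:
  assumes m: "m > 0" and e: "e > 0" and x: "x \<in> slab (int m)"
  shows "green (slab_weight (int m)) (\<lambda>_. e) 0 x = cylinder_green m e x / (1 + e)"
proof -
  obtain B where B: "\<And>x. \<bar>cylinder_green m e x\<bar> \<le> B" using cylinder_green_bounded[OF m e] by blast
  have closed: "slab_add (int m) x u \<in> slab (int m)" for x u
    using m by (auto simp: slab_add_def slab_def)
  have sums: "(\<lambda>n. step_prob (slab_add (int m)) (1 + e) n x) sums ((1 + e) * cylinder_green m e x)"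
    using e closed B x by (intro step_prob_sums[where S = "slab (int m)"] cylinder_green_equation[OF m e]) auto
  have pos: "0 < total_weight (slab_weight (int m)) (\<lambda>_. e) x" for x
    using e by (simp add: total_weight_slab)
  have inv: "x' = slab_add (int m) x u \<longleftrightarrow> x = slab_add (int m) x' (- u)"
    if "x \<in> slab (int m)" "x' \<in> slab (int m)" for x x' u
  proof -
    have shift: "b = (a + d) mod int m \<longleftrightarrow> a = (b - d) mod int m"
      if "0 \<le> a" "a < int m" "0 \<le> b" "b < int m" for a b d :: int
    proof
      assume "b = (a + d) mod int m"
      then show "a = (b - d) mod int m" using that by (simp add: mod_diff_left_eq)
    next
      assume "a = (b - d) mod int m"
      then show "b = (a + d) mod int m" using that by (simp add: mod_add_left_eq)
    qed
    show ?thesis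
    proof -
      have "snd x' = (snd x + snd u) mod int m \<longleftrightarrow> snd x = (snd x' - snd u) mod int m"
        using that by (intro shift) (auto simp: slab_def)
      moreover have "fst x' = fst x + fst u \<longleftrightarrow> fst x = fst x' - fst u" by (auto simp: algebra_simps)
      ultimately show ?thesis by (simp add: slab_add_def prod_eq_iff[of x] prod_eq_iff[of x'])
    qed
  qed
  have "visit_prob (slab_weight (int m)) (\<lambda>_. e) 0 n x = ennreal (step_prob (slab_add (int m)) (1 + e) n x)" for n
  proof -
    have "0 \<in> slab (int m)" using m by (simp add: slab_def zero_prod_def)
    from visit_prob_eq_step_prob[OF slab_weight_def _ total_weight_slab closed this inv, of e n x] e x
    show ?thesis by simp
  qed
  then have "(\<Sum>n. visit_prob (slab_weight (int m)) (\<lambda>_. e) 0 n x) = ennreal ((1 + e) * cylinder_green m e x)"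
    using ennreal_suminf_step_prob[OF sums] e by simp
  moreover have "0 \<le> (1 + e) * cylinder_green m e x"
    using sums_le[OF _ sums_zero sums] e by (simp add: step_prob_nonneg)
  ultimately show ?thesis
    using e by (subst green_eq_suminf_visit_prob[OF pos])
      (simp add: total_weight_slab power2_eq_square)
qed

text \<open>
  Without killing there is no unique bounded solution any more.  The identity is the limit \<open>e \<rightarrow> 0\<close>
  of the identities with killing, where monotonicity in \<open>e\<close> gives one inequality and the bound
  \<open>O(sqrt e)\<close> for the difference gives the other.
\<close>

lemma Z3_green_eq: "Z3_green x = lattice_green 0 x"
proof -
  let ?u = "\<lambda>n. step_prob (+) 1 n x"
  have sums: "(\<lambda>n. ?u n / (1 + e) ^ n) sums ((1 + e) * lattice_green e x)" if e: "e > 0" for e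
  proof -
    obtain B where B: "\<And>x. \<bar>lattice_green e x\<bar> \<le> B" using lattice_green_bounded[OF e] by blast
    have "(\<lambda>n. step_prob (+) (1 + e) n x) sums ((1 + e) * lattice_green e x)"
      using e B by (intro step_prob_sums[where S = UNIV] lattice_green_equation[OF e]) auto
    then show ?thesis using e by (simp add: step_prob_scale[of _ "1 + e"])
  qed
  have u0: "0 \<le> ?u n" for n by (simp add: step_prob_nonneg)
  have part: "(\<Sum>n<M. ?u n) \<le> lattice_green 0 x" for M
  proof (rule tendsto_le)
    show "((\<lambda>e. (1 + e) * lattice_green 0 x) \<longlongrightarrow> lattice_green 0 x) (at_right 0)"
      by (auto intro!: tendsto_eq_intros)
    show "((\<lambda>e. \<Sum>n<M. ?u n / (1 + e) ^ n) \<longlongrightarrow> (\<Sum>n<M. ?u n)) (at_right 0)"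
      by (auto intro!: tendsto_eq_intros)
    show "\<forall>\<^sub>F e in at_right 0. (\<Sum>n<M. ?u n / (1 + e) ^ n) \<le> (1 + e) * lattice_green 0 x"
      using eventually_at_right_less[of 0]
    proof eventually_elim
      case (elim e)
      have "(\<Sum>n<M. ?u n / (1 + e) ^ n) \<le> (1 + e) * lattice_green e x"
        using sum_le_suminf[OF sums_summable[OF sums[OF elim]], of "{..<M}"] sums_unique[OF sums[OF elim]] u0 elim
        by simp
      also have "\<dots> \<le> (1 + e) * lattice_green 0 x"
        using elim lattice_resolvent_le_0[OF elim] by (intro mult_left_mono) auto
      finally show ?case .
    qed
  qed simp
  have summable: "summable ?u"
    by (rule summableI_nonneg_bounded[OF u0 part])
  have le: "suminf ?u \<le> lattice_green 0 x"
    by (rule suminf_le_const[OF summable part])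
  have "lattice_green 0 x \<le> suminf ?u"
  proof (rule tendsto_le)
    show "((\<lambda>e. suminf ?u) \<longlongrightarrow> suminf ?u) (at_right 0)" by simp
    show "((\<lambda>e. (1 + e) * (lattice_green 0 x - 318 * pi * sqrt (3 * e))) \<longlongrightarrow> lattice_green 0 x) (at_right 0)"
      by (auto intro!: tendsto_eq_intros)
    show "\<forall>\<^sub>F e in at_right 0. (1 + e) * (lattice_green 0 x - 318 * pi * sqrt (3 * e)) \<le> suminf ?u"
      using eventually_at_right_less[of 0]
    proof eventually_elim
      case (elim e)
      have "(1 + e) * (lattice_green 0 x - 318 * pi * sqrt (3 * e)) \<le> (1 + e) * lattice_green e x"
        using elim lattice_resolvent_ge_0[OF elim] by (intro mult_left_mono) auto
      also have "\<dots> = (\<Sum>n. ?u n / (1 + e) ^ n)" using sums_unique[OF sums[OF elim]] by simp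
      also have "\<dots> \<le> suminf ?u"
      proof (rule suminf_le[OF _ sums_summable[OF sums[OF elim]] summable])
        fix n
        have "?u n / (1 + e) ^ n \<le> ?u n / 1"
          using u0 elim by (intro divide_left_mono) auto
        then show "?u n / (1 + e) ^ n \<le> ?u n" by simp
      qed
      finally show ?case .
    qed
  qed simp
  with le have eq: "suminf ?u = lattice_green 0 x" by linarith
  have sum: "?u sums lattice_green 0 x" using summable by (simp add: eq[symmetric] summable_sums)
  have inv: "x' = y + u \<longleftrightarrow> y = x' + (- u)" for x' y u :: point by auto
  have "visit_prob Z3_weight (\<lambda>_. 0) 0 n x = ennreal (?u n)" for n
    using visit_prob_eq_step_prob[OF Z3_weight_def _ total_weight_Z3 UNIV_I UNIV_I inv, of 0 n x] by simp
  then have "(\<Sum>n. visit_prob Z3_weight (\<lambda>_. 0) 0 n x) = ennreal (lattice_green 0 x)"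
    using ennreal_suminf_step_prob[OF sum] by simp
  then have "Z3_green x = enn2real (ennreal (lattice_green 0 x))"
    unfolding Z3_green_def using integral_transition_prob[of Z3_weight "\<lambda>_. 0" "0" x]
    by (simp add: total_weight_Z3 zero_prod_def)
  then show ?thesis using lattice_resolvent_nonneg[of 0] by simp
qed

section \<open>Asymptotics of the slab Green's function\<close>

lemma height_nat:
  assumes "height_function h" "N \<ge> 1"
  obtains m :: nat where "height h N = int m" "0 < m" "m \<le> N"
proof
  have h: "1 \<le> h (real N)" "h (real N) \<le> real N"
    using assms by (auto simp: height_function_def)
  then have 1: "1 \<le> height h N" by (simp add: height_def)
  moreover have "real_of_int (height h N) \<le> real N"
    using h(2) of_int_floor_le[of "h (real N)"] unfolding height_def by linarith
  ultimately show "height h N = int (nat (height h N))" "0 < nat (height h N)" "nat (height h N) \<le> N"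
    by linarith+
qed

lemma max_power2:
  fixes u v :: real
  assumes "0 \<le> u" "0 \<le> v" shows "(max u v)\<^sup>2 = max (u\<^sup>2) (v\<^sup>2)"
proof (cases "u \<le> v")
  case True
  then show ?thesis using power_mono[OF True assms(1), of 2] by (simp only: max_absorb2)
next
  case False
  then have "v \<le> u" by simp
  then show ?thesis using power_mono[OF \<open>v \<le> u\<close> assms(2), of 2] by (simp only: max_absorb1)
qed

text \<open>
  The central estimate.  The constant depends on none of the parameters, and the first inequality
  holds because the images contribute nonnegative terms.
\<close>

lemma slab_green_decomposition:
  fixes h :: "real \<Rightarrow> real" and N :: nat and x :: point and m :: nat
  assumes N: "N \<ge> 1" and hm: "height h N = int m" and m: "m > 0" and x: "x \<in> slab (int m)"
  defines "e \<equiv> 1 / (real N)\<^sup>2" and "M \<equiv> max (norm2 (fst x)) (real m)"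
  shows "lattice_green e (lift (int m) x) \<le> (1 + e) * slab_green h N x"
    and "\<bar>(1 + e) * slab_green h N x - lattice_green e (lift (int m) x)
            - 3 / pi * (1 / real m) * K0 (sqrt 6 * (M / real N))\<bar> \<le> 66150 * pi / M"
proof -
  have e: "e > 0" using N by (simp add: e_def)
  let ?a = "fst (fst x)" and ?b = "snd (fst x)" and ?v = "cyc_rep (int m) (snd x)"
  have z: "0 \<le> snd x" "snd x < int m" using x by (auto simp: slab_def)
  note rep = cyc_rep_minimal(1,2)[OF z]
  have "norm2 (fst x) = sqrt (sq ?a + sq ?b)"
    by (simp add: norm2_def norm_Pair)
  then have y: "(norm2 (fst x))\<^sup>2 = sq ?a + sq ?b" "0 \<le> norm2 (fst x)" by simp_all
  have M: "M\<^sup>2 = max (sq ?a + sq ?b) ((real m)\<^sup>2)"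
    unfolding M_def y(1)[symmetric] by (rule max_power2[OF y(2)]) simp
  have M0: "M > 0" using m by (simp add: M_def less_max_iff_disj)
  have "snd x mod int m = cyc_rep (int m) (snd x) mod int m" using rep(1) z by simp
  then have "cyc_heat m s (snd x) = cyc_heat m s ?v" for s by (rule cyc_heat_mod[OF m])
  then have "cylinder_green m e x = cylinder_resolvent m e ?a ?b ?v"
    by (simp only: cylinder_resolvent_def)
  moreover have "slab_green h N x = cylinder_green m e x / (1 + e)"
    unfolding slab_green_def hm using green_slab_eq[OF m e x] by (simp add: e_def zero_prod_def)
  ultimately have g: "(1 + e) * slab_green h N x = cylinder_resolvent m e ?a ?b ?v"
    using e by simp
  have l: "lattice_green e (lift (int m) x) = lattice_resolvent e ?a ?b ?v"
    by (simp add: lift_def)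
  have "sqrt (6 * e) * M = sqrt 6 * (M / real N)"
    using N by (simp add: e_def real_sqrt_mult real_sqrt_divide)
  from cylinder_resolvent_approx[OF m e rep(2) M0 M, unfolded this]
  show "\<bar>(1 + e) * slab_green h N x - lattice_green e (lift (int m) x)
            - 3 / pi * (1 / real m) * K0 (sqrt 6 * (M / real N))\<bar> \<le> 66150 * pi / M"
    unfolding g l .
  show "lattice_green e (lift (int m) x) \<le> (1 + e) * slab_green h N x"
    unfolding g l by (rule lattice_le_cylinder[OF m e rep(2) M0 M])
qed

lemma norm3_sq: "(norm3 w)\<^sup>2 = (real_of_int (fst (fst w)))\<^sup>2 + (real_of_int (snd (fst w)))\<^sup>2 + (real_of_int (snd w))\<^sup>2"
  by (simp add: norm3_def norm_Pair)

lemma norm3_nonneg: "0 \<le> norm3 w"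
  by (simp add: norm3_def)

lemma lattice_green_le:
  "e \<ge> 0 \<Longrightarrow> lattice_green e w \<le> 159 * pi / max (norm3 w) 1"
  by (rule lattice_resolvent_le) (auto simp: max_def norm3_sq)

text \<open>
  Lemma \<open>lattice_resolvent_ge\<close> with \<open>\<rho> = 17 R\<close>, where \<open>R\<close> is the maximum of the norm and 1; the
  constants are \<open>1734 = 6 * 17^2\<close> and \<open>29376 = 1728 * 17\<close>.
\<close>

lemma lattice_green_ge:
  assumes e: "e \<ge> 0" and B: "sqrt e * max (norm3 w) 1 \<le> B"
  shows "exp (- (1734 * B\<^sup>2)) / 29376 / max (norm3 w) 1 \<le> lattice_green e w"
proof -
  define R where "R = max (norm3 w) 1"
  have R: "R \<ge> 1" "norm3 w \<le> R" by (simp_all add: R_def)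
  have "(norm3 w)\<^sup>2 \<le> (17 * R)\<^sup>2" using R norm3_nonneg[of w] by (intro power_mono) auto
  then have "exp (- (6 * e * (17 * R)\<^sup>2)) / (1728 * (17 * R)) \<le> lattice_green e w"
    using R e by (intro lattice_resolvent_ge) (auto simp: norm3_sq intro: order_trans[rotated])
  moreover have "e * R\<^sup>2 \<le> B\<^sup>2"
  proof -
    have "(sqrt e * R)\<^sup>2 \<le> B\<^sup>2" using B e R by (intro power_mono) (auto simp: R_def)
    then show ?thesis using e by (simp add: power_mult_distrib)
  qed
  then have "exp (- (1734 * B\<^sup>2)) \<le> exp (- (6 * e * (17 * R)\<^sup>2))"
    by (simp add: power_mult_distrib)
  then have "exp (- (1734 * B\<^sup>2)) / (1728 * (17 * R)) \<le> exp (- (6 * e * (17 * R)\<^sup>2)) / (1728 * (17 * R))"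
    using R by (intro divide_right_mono) auto
  ultimately show ?thesis unfolding R_def[symmetric] by simp
qed

lemma slab_norm_bounds:
  assumes m: "m > 0" and x: "x \<in> slab (int m)"
  defines "M \<equiv> max (norm2 (fst x)) (real m)"
  shows "max (slab_norm (int m) x) 1 \<le> 2 * M" and "norm2 (fst x) \<le> slab_norm (int m) x"
    and "1 \<le> M"
proof -
  have z: "0 \<le> snd x" "snd x < int m" using x by (auto simp: slab_def)
  note rep = cyc_rep_minimal(2)[OF z]
  have y: "(norm2 (fst x))\<^sup>2 = (real_of_int (fst (fst x)))\<^sup>2 + (real_of_int (snd (fst x)))\<^sup>2" "0 \<le> norm2 (fst x)"
    by (simp_all add: norm2_def norm_Pair)
  have n3: "(slab_norm (int m) x)\<^sup>2 = (norm2 (fst x))\<^sup>2 + (real_of_int (cyc_rep (int m) (snd x)))\<^sup>2"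
    by (simp add: slab_norm_def norm3_sq lift_def y)
  show M1: "1 \<le> M" using m by (simp add: M_def le_max_iff_disj)
  show "norm2 (fst x) \<le> slab_norm (int m) x"
  proof (rule power2_le_imp_le)
    show "(norm2 (fst x))\<^sup>2 \<le> (slab_norm (int m) x)\<^sup>2" unfolding n3 by simp
  qed (simp add: slab_norm_def norm3_nonneg)
  have "\<bar>real_of_int (cyc_rep (int m) (snd x))\<bar> \<le> M"
    using rep by (simp add: M_def le_max_iff_disj) linarith
  then have "(real_of_int (cyc_rep (int m) (snd x)))\<^sup>2 \<le> M\<^sup>2"
    using M1 by (simp add: abs_le_square_iff[symmetric])
  moreover have "(norm2 (fst x))\<^sup>2 \<le> M\<^sup>2"
    using y(2) by (intro power_mono) (auto simp: M_def)
  moreover have "(2 * M)\<^sup>2 = 4 * M\<^sup>2" "0 \<le> M\<^sup>2" by simp_all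
  ultimately have "(slab_norm (int m) x)\<^sup>2 \<le> (2 * M)\<^sup>2"
    using n3 by linarith
  then have "slab_norm (int m) x \<le> 2 * M"
    by (rule power2_le_imp_le) (use M1 in simp)
  then show "max (slab_norm (int m) x) 1 \<le> 2 * M" using M1 by simp
qed

text \<open>
  The error \<open>O(1 / M)\<close> in the central estimate is at most a multiple of \<open>1 / R\<close> with \<open>R = \<parallel>x\<parallel> \<or> 1\<close>, which
  for the lower bound is in turn at most a multiple of the Green's function itself.  The factor
  \<open>sqrt 6\<close> in the argument of \<open>K0\<close> costs a constant, because the argument stays bounded.
\<close>

theorem slab_green_two_sided_bounds:
  assumes C0: "C0 \<ge> 1"
  shows "\<exists>c>0. \<exists>c'>0. \<exists>C>0. \<exists>C'>0. \<forall>h N x.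
        height_function h \<and> N \<ge> 1 \<and> x \<in> slab (height h N) \<and>
        slab_norm (height h N) x \<le> C0 * real N \<longrightarrow>
          c / max (slab_norm (height h N) x) 1
            + c' / real_of_int (height h N)
                * K0 (max (norm2 (fst x)) (real_of_int (height h N)) / real N)
          \<le> slab_green h N x
        \<and> slab_green h N x
          \<le> C / max (slab_norm (height h N) x) 1
            + C' / real_of_int (height h N)
                * K0 (max (norm2 (fst x)) (real_of_int (height h N)) / real N)"
proof -
  define cl where "cl = exp (- (1734 * C0\<^sup>2)) / 29376"
  define L where "L = ln (2 * sqrt 6) / K0 (sqrt 6 * C0)"
  define D where "D = 2 * (2 + 132300 * pi / cl)"
  have cl: "cl > 0" by (simp add: cl_def)
  have D: "D > 0" using cl pi_gt_zero by (simp add: D_def add_pos_pos)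
  have K: "K0 (sqrt 6 * C0) > 0" using C0 by (intro K0_pos) simp
  have s6: "1 \<le> sqrt 6" by (rule real_le_rsqrt) simp
  then have ln0: "0 \<le> ln (2 * sqrt 6)" by (intro ln_ge_zero) linarith
  then have L: "L \<ge> 0" using K by (simp add: L_def)
  (* cl is the constant in the lower bound for the lattice term, L the cost of the factor sqrt 6. *)
  have main: "cl / D / R + 3 / pi / ((1 + L) * D) / real_of_int (height h N) * K0 (M / real N) \<le> slab_green h N x
     \<and> slab_green h N x \<le> 132459 * pi / R + 3 / pi / real_of_int (height h N) * K0 (M / real N)"
    if h: "height_function h" and N: "N \<ge> 1" and x: "x \<in> slab (height h N)"
      and n: "slab_norm (height h N) x \<le> C0 * real N"
      and R: "R = max (slab_norm (height h N) x) 1" and M: "M = max (norm2 (fst x)) (real_of_int (height h N))"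
    for h N x R M
  proof -
    obtain m where hm: "height h N = int m" and m: "0 < m" "m \<le> N" by (rule height_nat[OF h N])
    define e where "e = 1 / (real N)\<^sup>2"
    define G where "G = lattice_green e (lift (int m) x)"
    define X where "X = (1 + e) * slab_green h N x"
    define T where "T = 3 / pi * (1 / real m) * K0 (sqrt 6 * (M / real N))"
    have e: "0 < e" "e \<le> 1" using N by (simp_all add: e_def)
    have M': "M = max (norm2 (fst x)) (real m)" by (simp add: M hm)
    have xs: "x \<in> slab (int m)" using x by (simp add: hm)
    note dec = slab_green_decomposition[OF N hm m(1) xs, folded M' e_def, folded G_def X_def T_def]
    note bd = slab_norm_bounds[OF m(1) xs, folded M', folded hm, folded R]
    have Rn: "R = max (norm3 (lift (int m) x)) 1" by (simp add: R hm slab_norm_def)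
    have R1: "R \<ge> 1" by (simp add: R)
    have NN: "real N \<ge> 1" using N by simp
    have RC: "R \<le> C0 * real N" using n C0 NN mult_mono[of 1 C0 1 "real N"] by (simp add: R)
    have t: "M / real N > 0" "M / real N \<le> C0"
    proof -
      show "M / real N > 0" using bd(3) NN by simp
      have "real m \<le> C0 * real N" using m(2) C0 mult_mono[of 1 C0 "real N" "real N"] by simp
      moreover have "norm2 (fst x) \<le> C0 * real N" using bd(2) n by linarith
      ultimately show "M / real N \<le> C0" using NN by (simp add: M' field_simps)
    qed
    have Gle: "G \<le> 159 * pi / R" unfolding G_def Rn using e by (intro lattice_green_le) simp
    have Gge: "cl / R \<le> G"
    proof -
      have "sqrt e * R \<le> C0" using RC NN by (simp add: e_def real_sqrt_divide field_simps)
      then show ?thesis unfolding G_def cl_def Rn using e by (intro lattice_green_ge) auto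
    qed
    have invM: "66150 * pi / M \<le> 132300 * pi / R"
    proof -
      have "66150 * pi * R \<le> 66150 * pi * (2 * M)" using bd(1) by (intro mult_left_mono) auto
      then show ?thesis using R1 bd(3) by (simp add: field_simps)
    qed
    have Gpos: "0 \<le> G" using Gge cl R1 by (meson divide_nonneg_pos dual_order.trans less_imp_le less_le_trans zero_less_one)
    have X: "slab_green h N x \<le> X" "X \<le> 2 * slab_green h N x"
    proof -
      have "0 \<le> X" using dec(1) Gpos by linarith
      then have g: "0 \<le> slab_green h N x" using e by (simp add: X_def zero_le_mult_iff)
      show "slab_green h N x \<le> X" using g e by (simp add: X_def mult_le_cancel_right1)
      have "(1 + e) * slab_green h N x \<le> 2 * slab_green h N x" using g e by (intro mult_right_mono) auto
      then show "X \<le> 2 * slab_green h N x" by (simp add: X_def)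
    qed
    have m0: "real m > 0" using m by simp
    have Tle: "T \<le> 3 / pi / real m * K0 (M / real N)"
    proof -
      have "K0 (sqrt 6 * (M / real N)) \<le> K0 (M / real N)"
        using t(1) mult_right_mono[OF s6, of "M / real N"] by (intro K0_antimono) simp_all
      then have "3 / pi / real m * K0 (sqrt 6 * (M / real N)) \<le> 3 / pi / real m * K0 (M / real N)"
        by (intro mult_left_mono) auto
      then show ?thesis by (simp add: T_def)
    qed
    have Tge: "3 / pi / real m * K0 (M / real N) \<le> (1 + L) * T"
    proof -
      have "K0 (sqrt 6 * C0) \<le> K0 (sqrt 6 * (M / real N))"
        by (intro K0_antimono mult_left_mono mult_pos_pos t) simp_all
      then have "L * K0 (sqrt 6 * C0) \<le> L * K0 (sqrt 6 * (M / real N))" using L by (rule mult_left_mono)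
      then have "ln (2 * sqrt 6) \<le> L * K0 (sqrt 6 * (M / real N))" using K by (simp add: L_def)
      with K0_le_scaled[OF t(1)] have "K0 (M / real N) \<le> (1 + L) * K0 (sqrt 6 * (M / real N))"
        by (simp add: distrib_right)
      then have "3 / pi / real m * K0 (M / real N) \<le> 3 / pi / real m * ((1 + L) * K0 (sqrt 6 * (M / real N)))"
        by (intro mult_left_mono) auto
      then show ?thesis by (simp add: T_def mult_ac)
    qed
    have upper: "slab_green h N x \<le> 132459 * pi / R + 3 / pi / real m * K0 (M / real N)"
    proof -
      have "X \<le> G + T + 66150 * pi / M" using dec(2) by linarith
      also have "\<dots> \<le> 159 * pi / R + 3 / pi / real m * K0 (M / real N) + 132300 * pi / R"
        using Gle Tle invM by linarith
      also have "\<dots> = 132459 * pi / R + 3 / pi / real m * K0 (M / real N)"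
        by (simp add: add_divide_distrib[symmetric])
      finally show ?thesis using X by linarith
    qed
    have "cl / R + T \<le> X * (2 + 132300 * pi / cl)"
    proof -
      have clX: "cl / R \<le> X" using Gge dec(1) by linarith
      have "T \<le> X + 132300 * pi / R" using dec invM Gpos by linarith
      also have "132300 * pi / R = (132300 * pi / cl) * (cl / R)" using cl by simp
      also have "\<dots> \<le> (132300 * pi / cl) * X" using clX cl by (intro mult_left_mono) auto
      finally show ?thesis using clX by (simp add: algebra_simps)
    qed
    also have "\<dots> \<le> (2 * slab_green h N x) * (2 + 132300 * pi / cl)"
      using X cl by (intro mult_right_mono) (auto intro: add_nonneg_nonneg)
    also have "\<dots> = D * slab_green h N x" by (simp only: D_def mult_ac)
    finally have low: "cl / R + T \<le> D * slab_green h N x" .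
    have "3 / pi / real m * K0 (M / real N) / (1 + L) \<le> T"
      by (rule pos_divide_le_eq[THEN iffD2]) (use Tge L in \<open>simp_all only: mult.commute[of T]\<close>)
    with low have "cl / R + 3 / pi / real m * K0 (M / real N) / (1 + L) \<le> D * slab_green h N x" by linarith
    then have "(cl / R + 3 / pi / real m * K0 (M / real N) / (1 + L)) / D \<le> slab_green h N x"
      using D by (simp add: pos_divide_le_eq mult.commute)
    moreover have "(cl / R + 3 / pi / real m * K0 (M / real N) / (1 + L)) / D
        = cl / D / R + 3 / pi / ((1 + L) * D) / real m * K0 (M / real N)"
      by (simp add: add_divide_distrib mult_ac)
    ultimately show ?thesis using upper by (simp add: hm)
  qed
  have "cl / D > 0" "3 / pi / ((1 + L) * D) > 0" "132459 * pi > 0" "3 / pi > 0"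
    using cl D L by auto
  with main show ?thesis by (metis (no_types, lifting))
qed

text \<open>
  Without killing the lattice term changes by \<open>O(1 / N)\<close>.  So does its product with the exponential
  factor, since it is at most a multiple of \<open>1 / \<parallel>x\<parallel>\<close> while \<open>1 - exp (- u) \<le> u\<close> with \<open>u\<close> of order
  \<open>\<parallel>x\<parallel> / N\<close>.
\<close>

lemma slab_green_error:
  fixes h :: "real \<Rightarrow> real" and N :: nat and x :: point and m :: nat
  assumes N: "N \<ge> 1" and hm: "height h N = int m" and m: "m > 0" and x: "x \<in> slab (int m)"
  defines "M \<equiv> max (norm2 (fst x)) (real m)"
  shows "\<bar>(1 + 1 / (real N)\<^sup>2) * slab_green h N x
      - (3 / pi * (1 / real m) * K0 (sqrt 6 * (M / real N))
         + Z3_green (lift (int m) x) * exp (- sqrt 6 * (slab_norm (int m) x / real N)))\<bar>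
    \<le> 70000 * pi * (1 / M + 1 / real N)"
proof -
  define e where "e = 1 / (real N)\<^sup>2"
  define \<rho> where "\<rho> = slab_norm (int m) x"
  define u where "u = sqrt 6 * (\<rho> / real N)"
  let ?w = "lift (int m) x"
  have e: "e > 0" using N by (simp add: e_def)
  have NN: "real N > 0" using N by simp
  have M: "M > 0" using slab_norm_bounds(3)[OF m x] by (simp add: M_def)
  have \<rho>: "\<rho> = norm3 ?w" "0 \<le> \<rho>" by (simp_all add: \<rho>_def slab_norm_def norm3_nonneg)
  have u: "u \<ge> 0" using \<rho> by (simp add: u_def)
  have s3: "sqrt 3 \<le> 2" by (rule real_le_lsqrt) simp_all
  have s6: "sqrt 6 \<le> 3" by (rule real_le_lsqrt) simp_all
  have "sqrt (3 * e) = sqrt 3 / real N" by (simp add: e_def real_sqrt_mult real_sqrt_divide)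
  then have "\<bar>lattice_green e ?w - lattice_green 0 ?w\<bar> \<le> 318 * pi * (sqrt 3 / real N)"
    using lattice_resolvent_le_0[OF e, of "fst (fst ?w)" "snd (fst ?w)" "snd ?w"]
      lattice_resolvent_ge_0[OF e, of "fst (fst ?w)" "snd (fst ?w)" "snd ?w"] by (simp only: abs_le_iff) linarith
  also have "\<dots> \<le> 318 * pi * (2 / real N)"
    using s3 by (intro mult_left_mono divide_right_mono) auto
  finally have 1: "\<bar>lattice_green e ?w - lattice_green 0 ?w\<bar> \<le> 636 * pi / real N" by simp
  have 2: "\<bar>lattice_green 0 ?w - lattice_green 0 ?w * exp (- u)\<bar> \<le> 477 * pi / real N"
  proof -
    let ?R = "max (norm3 ?w) 1"
    have G: "0 \<le> lattice_green 0 ?w" by (rule lattice_resolvent_nonneg) simp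
    have "1 - exp (- u) \<le> u" using exp_ge_add_one_self[of "- u"] by simp
    then have "lattice_green 0 ?w * (1 - exp (- u)) \<le> 159 * pi / ?R * u"
      using G u lattice_green_le[of 0 ?w] by (intro mult_mono) auto
    also have "\<dots> \<le> 159 * pi / ?R * (3 * (?R / real N))"
      unfolding u_def using s6 \<rho> NN by (intro mult_left_mono mult_mono divide_right_mono) auto
    also have "\<dots> = 477 * pi / real N * (?R / ?R)" by simp
    also have "?R / ?R = 1" by (rule divide_self) (simp add: max_def)
    finally have "lattice_green 0 ?w * (1 - exp (- u)) \<le> 477 * pi / real N" by simp
    moreover have "0 \<le> lattice_green 0 ?w * (1 - exp (- u))" using G u by (intro mult_nonneg_nonneg) auto
    moreover have "lattice_green 0 ?w - lattice_green 0 ?w * exp (- u) = lattice_green 0 ?w * (1 - exp (- u))"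
      by (simp add: algebra_simps)
    ultimately show ?thesis by simp
  qed
  note 3 = slab_green_decomposition(2)[OF N hm m x, folded e_def M_def]
  have sum: "66150 * pi / M + 636 * pi / real N + 477 * pi / real N \<le> 70000 * pi * (1 / M + 1 / real N)"
  proof -
    have "0 \<le> 3850 * pi / M" "0 \<le> 68887 * pi / real N" using M by simp_all
    moreover have "70000 * pi * (1 / M + 1 / real N)
      = (66150 * pi / M + 636 * pi / real N + 477 * pi / real N) + (3850 * pi / M + 68887 * pi / real N)"
      by (simp add: distrib_left add_divide_distrib[symmetric])
    ultimately show ?thesis by linarith
  qed
  have "- sqrt 6 * (\<rho> / real N) = - u" by (simp add: u_def)
  then show ?thesis
    unfolding e_def[symmetric] \<rho>_def[symmetric] Z3_green_eq using 1 2 3 sum by (simp only:)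
qed

lemma eventually_le_of_limsup_finite:
  fixes f :: "nat \<Rightarrow> real"
  assumes "limsup (\<lambda>N. ereal (f N)) < \<infinity>"
  obtains C where "C \<ge> 1" "\<forall>\<^sub>F N in sequentially. f N \<le> C"
proof -
  obtain n :: nat where "limsup (\<lambda>N. ereal (f N)) < ereal (real n)"
    using assms less_PInf_Ex_of_nat[of "limsup (\<lambda>N. ereal (f N))"] by auto
  then have "\<forall>\<^sub>F N in sequentially. ereal (f N) < ereal (real n)" by (rule Limsup_lessD)
  then have "\<forall>\<^sub>F N in sequentially. f N \<le> max 1 (real n)"
    by (rule eventually_mono) auto
  then show thesis by (rule that[rotated]) simp
qed

text \<open>
  By the previous lemmas the relative error is at most a multiple of \<open>m / (M K) + m / (N K)\<close> with
  \<open>K = K0 (sqrt 6 M / N)\<close>, and both quotients tend to 0 (facts \<open>W\<close> and \<open>V\<close> of the proof).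
\<close>

theorem slab_green_asymptotics:
  fixes h :: "real \<Rightarrow> real" and x :: "nat \<Rightarrow> point"
  assumes h: "height_function h"
    and lim: "(\<lambda>N. real_of_int (height h N) / real N) \<longlonglongrightarrow> 0"
    and x: "\<And>N. N \<ge> 1 \<Longrightarrow> x N \<in> slab (height h N)"
    and bounded: "limsup (\<lambda>N. ereal (slab_norm (height h N) (x N) / real N)) < \<infinity>"
  shows "(\<lambda>N. slab_green h N (x N)
             / (3 / pi * (1 / real_of_int (height h N))
                  * K0 (sqrt 6 * (max (norm2 (fst (x N))) (real_of_int (height h N)) / real N))
                + Z3_green (lift (height h N) (x N))
                  * exp (- sqrt 6 * (slab_norm (height h N) (x N) / real N))))
          \<longlonglongrightarrow> 1"
proof -
  define H where "H N = real_of_int (height h N)" for N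
  define M where "M N = max (norm2 (fst (x N))) (H N)" for N
  define K where "K N = K0 (sqrt 6 * (M N / real N))" for N
  define T where "T N = 3 / pi * (1 / H N) * K N" for N
  define D where "D N = T N + Z3_green (lift (height h N) (x N))
      * exp (- sqrt 6 * (slab_norm (height h N) (x N) / real N))" for N
  define g where "g N = slab_green h N (x N)" for N
  obtain C where C: "C \<ge> 1" and evC: "\<forall>\<^sub>F N in sequentially. slab_norm (height h N) (x N) / real N \<le> C"
    using eventually_le_of_limsup_finite[OF bounded] .
  define \<kappa> where "\<kappa> = K0 (sqrt 6 * C)"
  have \<kappa>: "\<kappa> > 0" using C by (simp add: \<kappa>_def K0_pos)
  have basic: "H N \<ge> 1 \<and> H N \<le> real N \<and> M N \<ge> H N \<and> K N > 0
      \<and> \<bar>(1 + 1 / (real N)\<^sup>2) * g N - D N\<bar> \<le> 70000 * pi * (1 / M N + 1 / real N)" if N: "N \<ge> 1" for N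
  proof -
    obtain m where hm: "height h N = int m" and m: "0 < m" "m \<le> N" by (rule height_nat[OF h N])
    have H: "H N = real m" by (simp add: H_def hm)
    have "x N \<in> slab (int m)" using x[OF N] by (simp add: hm)
    from slab_green_error[OF N hm m(1) this]
    have "\<bar>(1 + 1 / (real N)\<^sup>2) * g N - D N\<bar> \<le> 70000 * pi * (1 / M N + 1 / real N)"
      unfolding g_def D_def T_def K_def M_def H hm .
    moreover have "M N \<ge> H N" by (simp add: M_def)
    moreover have "H N \<ge> 1" "H N \<le> real N" using m by (simp_all add: H)
    ultimately show ?thesis using N by (simp add: K_def K0_pos)
  qed
  have ev1: "\<forall>\<^sub>F N in sequentially. N \<ge> (1::nat)" by (rule eventually_ge_at_top)
  have evK: "\<forall>\<^sub>F N in sequentially. \<kappa> \<le> K N"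
    using evC ev1
  proof eventually_elim
    case (elim N)
    obtain m where hm: "height h N = int m" and m: "0 < m" "m \<le> N" by (rule height_nat[OF h elim(2)])
    have xs: "x N \<in> slab (int m)" using x[OF elim(2)] by (simp add: hm)
    have "norm2 (fst (x N)) \<le> slab_norm (height h N) (x N)"
      using slab_norm_bounds(2)[OF m(1) xs] by (simp add: hm)
    also have "\<dots> \<le> C * real N" using elim by (simp add: pos_divide_le_eq)
    finally have "norm2 (fst (x N)) \<le> C * real N" .
    moreover have "H N \<le> C * real N"
    proof -
      have "1 * real N \<le> C * real N" using C by (intro mult_right_mono) auto
      then show ?thesis using basic[OF elim(2)] by linarith
    qed
    ultimately have "M N / real N \<le> C" using elim by (simp add: M_def pos_divide_le_eq)
    moreover have "M N / real N > 0" using basic[OF elim(2)] elim by simp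
    ultimately show ?case unfolding \<kappa>_def K_def by (intro K0_antimono mult_left_mono mult_pos_pos) auto
  qed
  have ratio: "filterlim (\<lambda>N. real N / H N) at_top sequentially"
  proof -
    have "filterlim (\<lambda>N. H N / real N) (at_right 0) sequentially"
      unfolding filterlim_at
    proof
      show "\<forall>\<^sub>F N in sequentially. H N / real N \<in> {0<..} \<and> H N / real N \<noteq> 0"
        using ev1
      proof eventually_elim
        case (elim N)
        then have "H N / real N > 0" using basic[OF elim] by (intro divide_pos_pos) auto
        then show ?case unfolding greaterThan_iff by (intro conjI) linarith+
      qed
      show "(\<lambda>N. H N / real N) \<longlonglongrightarrow> 0" using lim by (simp add: H_def)
    qed
    then have "filterlim (\<lambda>N. inverse (H N / real N)) at_top sequentially"
      by (rule filterlim_compose[OF filterlim_inverse_at_top_right])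
    then show ?thesis by (simp add: divide_inverse mult.commute)
  qed
  have V: "filterlim (\<lambda>N. real N / H N * K N) at_top sequentially"
  proof (rule filterlim_at_top_mono)
    show "filterlim (\<lambda>N. real N / H N * \<kappa>) at_top sequentially"
      using filterlim_tendsto_pos_mult_at_top[OF tendsto_const \<kappa> ratio] by (simp add: mult.commute)
    show "\<forall>\<^sub>F N in sequentially. real N / H N * \<kappa> \<le> real N / H N * K N"
      using evK ev1
    proof eventually_elim
      case (elim N)
      show ?case using basic[OF elim(2)] by (intro mult_left_mono elim(1) divide_nonneg_nonneg) auto
    qed
  qed
  \<comment> \<open>Either \<open>M / N\<close> is small, so that \<open>K N\<close> is large, or \<open>M\<close> is comparable to \<open>N\<close>.\<close>
  have W: "filterlim (\<lambda>N. M N / H N * K N) at_top sequentially"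
  proof (rule filterlim_at_top_gt[where c = 0, THEN iffD2], intro allI impI)
    fix A :: real assume A: "A > 0"
    obtain \<delta> where \<delta>: "\<delta> > 0" "\<And>t. 0 < t \<Longrightarrow> t \<le> \<delta> \<Longrightarrow> A \<le> K0 t"
      by (rule K0_tendsto_infinity[OF A]) blast
    have "\<forall>\<^sub>F N in sequentially. A * sqrt 6 / \<delta> \<le> real N / H N * K N"
      using V by (simp add: filterlim_at_top)
    then show "\<forall>\<^sub>F N in sequentially. A \<le> M N / H N * K N"
      using ev1
    proof eventually_elim
      case (elim N)
      note b = basic[OF elim(2)]
      have N0: "real N > 0" using elim by simp
      show ?case
      proof (cases "sqrt 6 * (M N / real N) \<le> \<delta>")
        case True
        have "A \<le> K N" unfolding K_def using b N0 True by (intro \<delta>(2)) auto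
        moreover have "1 * K N \<le> M N / H N * K N" using b by (intro mult_right_mono) auto
        ultimately show ?thesis by simp
      next
        case False
        then have "\<delta> / sqrt 6 * real N \<le> M N" using N0 by (simp add: field_simps)
        then have "\<delta> / sqrt 6 * real N / H N * K N \<le> M N / H N * K N"
          using b by (intro mult_right_mono divide_right_mono) auto
        moreover have "A \<le> \<delta> / sqrt 6 * real N / H N * K N"
        proof -
          have "\<delta> / sqrt 6 * (A * sqrt 6 / \<delta>) \<le> \<delta> / sqrt 6 * (real N / H N * K N)"
            using elim(1) \<delta>(1) by (intro mult_left_mono) auto
          then show ?thesis using \<delta>(1) by simp
        qed
        ultimately show ?thesis by linarith
      qed
    qed
  qed
  define err where "err N = 70000 * pi * (pi / 3) * (inverse (M N / H N * K N) + inverse (real N / H N * K N))" for N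
  have err: "err \<longlonglongrightarrow> 0"
  proof -
    have "(\<lambda>N. inverse (M N / H N * K N)) \<longlonglongrightarrow> 0" "(\<lambda>N. inverse (real N / H N * K N)) \<longlonglongrightarrow> 0"
      by (rule tendsto_inverse_0_at_top[OF W], rule tendsto_inverse_0_at_top[OF V])
    then have "err \<longlonglongrightarrow> 70000 * pi * (pi / 3) * (0 + 0)"
      unfolding err_def by (intro tendsto_intros)
    then show ?thesis by simp
  qed
  have D: "D N \<ge> T N \<and> T N > 0" if "N \<ge> 1" for N
  proof -
    have "0 \<le> Z3_green (lift (height h N) (x N))" by (simp add: Z3_green_def)
    then have "D N \<ge> T N" by (simp add: D_def)
    then show ?thesis using basic[OF that] by (simp add: T_def)
  qed
  have "\<forall>\<^sub>F N in sequentially. norm ((1 + 1 / (real N)\<^sup>2) * g N / D N - 1) \<le> err N"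
    using ev1
  proof eventually_elim
    case (elim N)
    note b = basic[OF elim] and d = D[OF elim]
    have "norm ((1 + 1 / (real N)\<^sup>2) * g N / D N - 1) = \<bar>(1 + 1 / (real N)\<^sup>2) * g N - D N\<bar> / D N"
      using d by (simp add: abs_div_pos diff_divide_distrib)
    also have "\<dots> \<le> 70000 * pi * (1 / M N + 1 / real N) / T N"
      using b d elim by (intro frac_le) auto
    also have "\<dots> = err N"
      using b elim by (simp add: err_def T_def field_simps)
    finally show ?case .
  qed
  then have "(\<lambda>N. (1 + 1 / (real N)\<^sup>2) * g N / D N - 1) \<longlonglongrightarrow> 0"
    by (rule Lim_null_comparison[OF _ err])
  then have "(\<lambda>N. (1 + 1 / (real N)\<^sup>2) * g N / D N) \<longlonglongrightarrow> 1"
    by (simp add: LIM_zero_iff)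
  moreover have "(\<lambda>N. 1 + 1 / (real N)\<^sup>2) \<longlonglongrightarrow> 1" by real_asymp
  ultimately have "(\<lambda>N. (1 + 1 / (real N)\<^sup>2) * g N / D N / (1 + 1 / (real N)\<^sup>2)) \<longlonglongrightarrow> 1 / 1"
    by (rule tendsto_divide) simp
  moreover have "(1 + 1 / (real N)\<^sup>2) * g N / D N / (1 + 1 / (real N)\<^sup>2) = g N / D N" for N
  proof -
    have "1 + 1 / (real N)\<^sup>2 \<noteq> 0" by (rule less_imp_neq[symmetric]) (simp add: add_pos_nonneg)
    then show ?thesis by simp
  qed
  ultimately have "(\<lambda>N. g N / D N) \<longlonglongrightarrow> 1" by simp
  then show ?thesis unfolding g_def D_def T_def K_def M_def H_def .
qed

theorem theorem2p1:
  shows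
    "(\<forall>C0\<ge>1. \<exists>c>0. \<exists>c'>0. \<exists>C>0. \<exists>C'>0. \<forall>h N x.
        height_function h \<and> N \<ge> 1 \<and> x \<in> slab (height h N) \<and>
        slab_norm (height h N) x \<le> C0 * real N \<longrightarrow>
          c / max (slab_norm (height h N) x) 1
            + c' / real_of_int (height h N)
                * K0 (max (norm2 (fst x)) (real_of_int (height h N)) / real N)
          \<le> slab_green h N x
        \<and> slab_green h N x
          \<le> C / max (slab_norm (height h N) x) 1
            + C' / real_of_int (height h N)
                * K0 (max (norm2 (fst x)) (real_of_int (height h N)) / real N))
   \<and> (\<forall>h x.
        height_function h \<and>
        (\<lambda>N. real_of_int (height h N) / real N) \<longlonglongrightarrow> 0 \<and>
        (\<forall>N\<ge>1. x N \<in> slab (height h N)) \<and>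
        (\<exists>L. (\<lambda>N. ereal (slab_norm (height h N) (x N))) \<longlonglongrightarrow> L) \<and>
        limsup (\<lambda>N. ereal (slab_norm (height h N) (x N) / real N)) < \<infinity> \<longrightarrow>
          (\<lambda>N. slab_green h N (x N)
             / (3 / pi * (1 / real_of_int (height h N))
                  * K0 (sqrt 6 * (max (norm2 (fst (x N))) (real_of_int (height h N)) / real N))
                + Z3_green (lift (height h N) (x N))
                  * exp (- sqrt 6 * (slab_norm (height h N) (x N) / real N))))
          \<longlonglongrightarrow> 1)"
  using slab_green_two_sided_bounds slab_green_asymptotics by blast

end
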